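(* Let $\nu$ be a non-zero finite Borel measure on $(0,1)$ that is $L^q$-regular; then the spectral dimension $s_\nu=\underline s_\nu=\overline s_\nu$ exists and: (1) $\overline\delta_\nu=\delta_\nu^*\iff s_\nu=\dfrac{\delta_\nu^*}{1+\delta_\nu^*}$; (2) $\overline{\dim}_M(\nu)=\dim_H(\nu)\implies s_\nu=\dfrac{\delta_\nu^*}{1+\delta_\nu^*}$; (3) if $\beta_\nu$ is differentiable at $1$ and $s_\nu=\dfrac{\delta_\nu^*}{1+\delta_\nu^*}$, then $\overline{\dim}_M(\nu)=\dim_H(\nu)=\underline{\dim}_H(\nu)=\dim_P(\nu)$.
   Context: $\Lambda$ is Lebesgue measure. For $n\in\mathbb N$ and $0\le k<2^n$ let $A^n_k:=(k2^{-n},(k+1)2^{-n}]$ and $\mathcal D_{\nu,n}:=\{A^n_k:\nu(A^n_k)>0\}$. For $q\in\mathbb R$ put $\beta^\nu_n(q):=\frac{1}{\log 2^n}\log\sum_{C\in\mathcal D_{\nu,n}}\nu(C)^q$ and $\beta_\nu(q):=\limsup_{n\to\infty}\beta_n^\nu(q)$. For all large $n$ there is a unique $q_n\ge0$ with $\beta_n^\nu(q_n)=q_n$; $\overline q_\nu:=\limsup_{n\to\infty}q_n$. $\nu$ is called $L^q$-regular if (a) there is $\varepsilon>0$ with $\beta_\nu(q)=\liminf_n\beta_n^\nu(q)$ for all $q\in(\overline q_\nu-\varepsilon,\overline q_\nu)$, or (b) $\beta_\nu(\overline q_\nu)=\liminf_n\beta_n^\nu(\overline q_\nu)$ and $\beta_\nu$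 is differentiable at $\overline q_\nu$. $\overline\delta_\nu:=\lim_{t\nearrow1}\frac{\beta_\nu(t)}{1-t}$. Dimensions. $\delta_\nu^*:=\overline{\dim}_M(\nu):=\overline{\dim}_M(\operatorname{supp}\nu)$, the upper Minkowski dimension of the support; $\dim_H(E)$, $\dim_P(E)$ are Hausdorff and packing dimension of a Borel set $E$; $\dim_H(\nu):=\inf\{\dim_H(A):\nu(A^{\complement})=0\}$, $\dim_P(\nu):=\inf\{\dim_P(A):\nu(A^{\complement})=0\}$, $\underline{\dim}_H(\nu):=\inf\{\dim_H(E):\nu(E)>0\}$. Spectral dimension. $\nu$ is regarded as a measure on $[0,1]$. $H^1_0(0,1)$ is the space of functions $f:[0,1]\to\mathbb R$ with $f(x)=\int_{[0,x]}g\,d\Lambda$ for some $g\in L^2_\Lambda([0,1])$ and $f(0)=f(1)=0$; $\nabla_\Lambda f:=g$. $C_\nu([0,1])$ is the set of continuous real functions on $[0,1]$ that are affine linear on every connected component of $[0,1]\setminus\operatorname{supp}\nu$. $\operatorname{dom}(\mathcal E_\nu):=H^1_0(0,1)\cap C_\nu([0,1])$, $\mathcal E_\nu(f,g):=\int_{(0,1)}\nabla_\Lambda f\,\nabla_\Lambda g\,d\Lambda$. A number $\lambda$ is an eigenvalue of $\mathcal E_\nu$ if there is $f\in\operatorname{dom}(\mathcal E_\nu)\setminus\{0\}$ with $\mathcal E_\nu(f,g)=\lambda\int fg\,d\nu$ for all $g\in\operatorname{dom}(\mathcal E_\nu)$. $N_\nu(x)$ is the number of eigenvalues $\le x$ (with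 multiplicity). $\underline{s}_\nu:=\liminf_{x\to\infty}\frac{\log N_\nu(x)}{\log x}$, $\overline{s}_\nu:=\limsup_{x\to\infty}\frac{\log N_\nu(x)}{\log x}$. *)

theory Defs
  imports "HOL-Analysis.Analysis" "HOL-Library.Function_Algebras"
begin

text \<open>A measure \<open>\<nu>\<close> on \<open>(0,1)\<close> is represented as a Borel measure on the real line for which the
  complement of \<open>(0,1)\<close> is a null set.\<close>

section \<open>The \<open>L\<^sup>q\<close>-spectrum\<close>

definition dyadic :: "nat \<Rightarrow> nat \<Rightarrow> real set" where
  "dyadic n k = {real k / 2 ^ n <.. (real k + 1) / 2 ^ n}"

definition dyadic_pos :: "real measure \<Rightarrow> nat \<Rightarrow> real set set" where
  "dyadic_pos \<nu> n = {dyadic n k | k. k < 2 ^ n \<and> measure \<nu> (dyadic n k) > 0}"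

definition beta_n :: "real measure \<Rightarrow> nat \<Rightarrow> real \<Rightarrow> real" where
  "beta_n \<nu> n q = 1 / ln (2 ^ n) * ln (\<Sum>C\<in>dyadic_pos \<nu> n. measure \<nu> C powr q)"

text \<open>Extended-real valued: for \<open>q < 0\<close> the upper limit may be \<open>\<infinity>\<close>.\<close>

definition beta :: "real measure \<Rightarrow> real \<Rightarrow> ereal" where
  "beta \<nu> q = limsup (\<lambda>n. ereal (beta_n \<nu> n q))"

definition beta_lower :: "real measure \<Rightarrow> real \<Rightarrow> ereal" where
  "beta_lower \<nu> q = liminf (\<lambda>n. ereal (beta_n \<nu> n q))"

text \<open>The fixed point is unique only for all large \<open>n\<close>; the finitely many other values do not
  affect the upper limit. For large \<open>n\<close> it lies in \<open>[0,1)\<close>, so the upper limit is a real number.\<close>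

definition q_n :: "real measure \<Rightarrow> nat \<Rightarrow> real" where
  "q_n \<nu> n = (THE q. q \<ge> 0 \<and> beta_n \<nu> n q = q)"

definition q_upper :: "real measure \<Rightarrow> real" where
  "q_upper \<nu> = real_of_ereal (limsup (\<lambda>n. ereal (q_n \<nu> n)))"

definition ereal_differentiable_at :: "(real \<Rightarrow> ereal) \<Rightarrow> real \<Rightarrow> bool" where
  "ereal_differentiable_at f x \<longleftrightarrow>
     (\<forall>\<^sub>F t in nhds x. \<bar>f t\<bar> \<noteq> \<infinity>) \<and> (\<lambda>t. real_of_ereal (f t)) differentiable (at x)"

definition Lq_regular :: "real measure \<Rightarrow> bool" where
  "Lq_regular \<nu> \<longleftrightarrow>
     (\<exists>\<epsilon>>0. \<forall>q\<in>{q_upper \<nu> - \<epsilon> <..< q_upper \<nu>}. beta \<nu> q = beta_lower \<nu> q) \<or>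
     (beta \<nu> (q_upper \<nu>) = beta_lower \<nu> (q_upper \<nu>) \<and> ereal_differentiable_at (beta \<nu>) (q_upper \<nu>))"

definition delta_upper :: "real measure \<Rightarrow> ereal" where
  "delta_upper \<nu> = Lim (at_left 1) (\<lambda>t. beta \<nu> t / ereal (1 - t))"

section \<open>Dimensions of subsets of the real line\<close>

text \<open>The convention is that \<open>(diam U)\<^sup>0 = 1\<close> for nonempty \<open>U\<close>, whereas \<open>0 powr 0 = 0\<close>.\<close>

definition diam_pow :: "real \<Rightarrow> real set \<Rightarrow> ennreal" where
  "diam_pow s U = (if U = {} then 0 else if s = 0 then 1 else ennreal (diameter U powr s))"

definition hausdorff_premeasure :: "real \<Rightarrow> real \<Rightarrow> real set \<Rightarrow> ennreal" where
  "hausdorff_premeasure s \<delta> E =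
     (INF U \<in> {U :: nat \<Rightarrow> real set. (\<forall>i. bounded (U i) \<and> diameter (U i) \<le> \<delta>) \<and> E \<subseteq> (\<Union>i. U i)}.
        \<Sum>i. diam_pow s (U i))"

definition hausdorff_measure :: "real \<Rightarrow> real set \<Rightarrow> ennreal" where
  "hausdorff_measure s E = (SUP \<delta>\<in>{0<..}. hausdorff_premeasure s \<delta> E)"

definition hausdorff_dim :: "real set \<Rightarrow> ereal" where
  "hausdorff_dim E = Inf {ereal s | s. s \<ge> 0 \<and> hausdorff_measure s E = 0}"

text \<open>A packing of \<open>E\<close> is given by the set of centres and radii of its disjoint closed balls.\<close>

definition packings :: "real \<Rightarrow> real set \<Rightarrow> (real \<times> real) set set" where
  "packings \<delta> E = {F. (\<forall>(x, r)\<in>F. x \<in> E \<and> 0 < r \<and> r \<le> \<delta>) \<and>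
                      disjoint_family_on (\<lambda>(x, r). cball x r) F}"

definition packing_premeasure :: "real \<Rightarrow> real set \<Rightarrow> ennreal" where
  "packing_premeasure s E =
     (INF \<delta>\<in>{0<..}. SUP F\<in>packings \<delta> E. \<Sum>\<^sub>\<infinity>(x, r)\<in>F. diam_pow s (cball x r))"

definition packing_measure :: "real \<Rightarrow> real set \<Rightarrow> ennreal" where
  "packing_measure s E =
     (INF A \<in> {A :: nat \<Rightarrow> real set. E \<subseteq> (\<Union>i. A i)}. \<Sum>i. packing_premeasure s (A i))"

definition packing_dim :: "real set \<Rightarrow> ereal" where
  "packing_dim E = Inf {ereal s | s. s \<ge> 0 \<and> packing_measure s E = 0}"

text \<open>Least number of sets of diameter at most \<open>\<delta>\<close> covering the bounded set \<open>E\<close>.\<close>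

definition covering_number :: "real \<Rightarrow> real set \<Rightarrow> nat" where
  "covering_number \<delta> E =
     (LEAST m. \<exists>F. finite F \<and> card F = m \<and> (\<forall>U\<in>F. bounded U \<and> diameter U \<le> \<delta>) \<and> E \<subseteq> \<Union>F)"

definition upper_minkowski_dim :: "real set \<Rightarrow> ereal" where
  "upper_minkowski_dim E =
     Limsup (at_right 0) (\<lambda>\<delta>. ereal (ln (real (covering_number \<delta> E)) / - ln \<delta>))"

section \<open>Dimensions of measures\<close>

definition supp :: "real measure \<Rightarrow> real set" where
  "supp \<nu> = {x. \<forall>U. open U \<longrightarrow> x \<in> U \<longrightarrow> emeasure \<nu> U > 0}"

definition dim_M_measure :: "real measure \<Rightarrow> ereal" where
  "dim_M_measure \<nu> = upper_minkowski_dim (supp \<nu>)"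

definition dim_H_measure :: "real measure \<Rightarrow> ereal" where
  "dim_H_measure \<nu> = Inf {hausdorff_dim A | A. A \<in> sets borel \<and> emeasure \<nu> (- A) = 0}"

definition dim_P_measure :: "real measure \<Rightarrow> ereal" where
  "dim_P_measure \<nu> = Inf {packing_dim A | A. A \<in> sets borel \<and> emeasure \<nu> (- A) = 0}"

definition lower_dim_H_measure :: "real measure \<Rightarrow> ereal" where
  "lower_dim_H_measure \<nu> = Inf {hausdorff_dim E | E. E \<in> sets borel \<and> emeasure \<nu> E > 0}"

section \<open>The spectral dimension\<close>

definition L2_unit :: "(real \<Rightarrow> real) set" where
  "L2_unit = {g. set_borel_measurable lborel {0..1} g \<and> set_integrable lborel {0..1} (\<lambda>x. (g x)\<^sup>2)}"

text \<open>Functions on \<open>[0,1]\<close> are represented by functions on the real line vanishing outside \<open>[0,1]\<close>;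
  thus two of them are equal iff they agree on \<open>[0,1]\<close>.\<close>

definition is_weak_deriv :: "(real \<Rightarrow> real) \<Rightarrow> (real \<Rightarrow> real) \<Rightarrow> bool" where
  "is_weak_deriv f g \<longleftrightarrow> g \<in> L2_unit \<and> (\<forall>x\<in>{0..1}. f x = (LINT t:{0..x}|lborel. g t))"

definition H10 :: "(real \<Rightarrow> real) set" where
  "H10 = {f. (\<exists>g. is_weak_deriv f g) \<and> f 0 = 0 \<and> f 1 = 0 \<and> (\<forall>x. x \<notin> {0..1} \<longrightarrow> f x = 0)}"

text \<open>The derivative is determined on \<open>[0,1]\<close> only almost everywhere; the form below does not depend
  on the choice.\<close>

definition grad :: "(real \<Rightarrow> real) \<Rightarrow> real \<Rightarrow> real" where
  "grad f = (SOME g. is_weak_deriv f g)"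

definition C_nu :: "real measure \<Rightarrow> (real \<Rightarrow> real) set" where
  "C_nu \<nu> = {f. continuous_on {0..1} f \<and>
                (\<forall>I\<in>components ({0..1} - supp \<nu>). \<exists>a b. \<forall>x\<in>I. f x = a * x + b)}"

definition dom_form :: "real measure \<Rightarrow> (real \<Rightarrow> real) set" where
  "dom_form \<nu> = H10 \<inter> C_nu \<nu>"

definition energy_form :: "(real \<Rightarrow> real) \<Rightarrow> (real \<Rightarrow> real) \<Rightarrow> real" where
  "energy_form f g = (LINT x:{0<..<1}|lborel. grad f x * grad g x)"

definition eigenspace :: "real measure \<Rightarrow> real \<Rightarrow> (real \<Rightarrow> real) set" where
  "eigenspace \<nu> l = {f \<in> dom_form \<nu>. \<forall>g\<in>dom_form \<nu>. energy_form f g = l * (\<integral>x. f x * g x \<partial>\<nu>)}"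

definition is_eigenvalue :: "real measure \<Rightarrow> real \<Rightarrow> bool" where
  "is_eigenvalue \<nu> l \<longleftrightarrow> (\<exists>f\<in>eigenspace \<nu> l. f \<noteq> (\<lambda>x. 0))"

interpretation fun_vs: vector_space "\<lambda>(c::real) (f::real \<Rightarrow> real) x. c * f x"
  by unfold_locales (auto simp: fun_eq_iff algebra_simps)

text \<open>The form has compact resolvent, so there are only finitely many eigenvalues below any bound and
  all eigenspaces are finite-dimensional.\<close>

definition eigenvalue_count :: "real measure \<Rightarrow> real \<Rightarrow> nat" where
  "eigenvalue_count \<nu> x = (\<Sum>l | is_eigenvalue \<nu> l \<and> l \<le> x. fun_vs.dim (eigenspace \<nu> l))"

definition s_lower :: "real measure \<Rightarrow> ereal" where
  "s_lower \<nu> = Liminf at_top (\<lambda>x. ereal (ln (real (eigenvalue_count \<nu> x)) / ln x))"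

definition s_upper :: "real measure \<Rightarrow> ereal" where
  "s_upper \<nu> = Limsup at_top (\<lambda>x. ereal (ln (real (eigenvalue_count \<nu> x)) / ln x))"

end

theory Submission
  imports Defs "HOL-Complex_Analysis.Great_Picard" "HOL-Real_Asymp.Real_Asymp"
begin

text \<open>
  The Green function \<open>min x y - x y\<close> of the Dirichlet Laplacian yields an operator \<open>T\<close> with
  \<open>\<E>(T f, g) = \<integral>fg d\<nu>\<close>, so that the eigenfunctions of \<open>\<E>\<close> are those of the compact operator \<open>T\<close> and
  the min-max principle is available on all of \<open>H\<^sup>1\<^sub>0\<close>. If \<open>f\<close> vanishes at the end points of a partition into
  intervals with \<open>\<nu>(I) \<Lambda>(I) < 1/x\<close>, then \<open>\<E>(f, f) > x \<integral>f\<^sup>2 d\<nu>\<close>; a stopping time argument on dyadic intervals then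
  bounds \<open>N(x)\<close> by a multiple of \<open>x powr q\<close> for every \<open>q > q_upper\<close>. Conversely, tents over
  dyadic intervals with \<open>\<nu>(C) \<Lambda>(C) \<ge> 2/x\<close> bound \<open>N(x)\<close> from below, and a large deviation estimate based
  on \<open>L\<^sup>q\<close>-regularity supplies enough of them. Hence \<open>s = q_upper\<close>.

  Since \<open>\<beta>\<close> is convex with \<open>\<beta>(1) = 0\<close>, \<open>\<beta>(q_upper) = q_upper\<close> (if \<open>q_upper > 0\<close>) and \<open>\<beta>(0)\<close> is the Minkowski dimension,
  \<open>s = \<beta>(0)/(1 + \<beta>(0))\<close> holds iff \<open>\<beta>\<close> is affine on \<open>[0, 1]\<close>, that is iff the left slope at 1 is \<open>\<beta>(0)\<close>.
  By Borel--Cantelli the left and right slopes of \<open>\<beta>\<close> at 1 bound the Hausdorff dimension of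
  \<open>\<nu>\<close> from above and its lower Hausdorff dimension from below.
\<close>

section \<open>The energy form\<close>

text \<open>\<open>beta\<close> is an upper limit: upper bounds on \<open>beta_n\<close> hold for
  all large n, lower bounds only for infinitely many. The upper estimate of N(x) uses the former;
  the lower one needs many heavy intervals on every large level, which is what equality with the
  lower limit supplies. The exponent comes from the fixed point: if the intervals dominating the sum
  with exponent q have mass about 2^(-na), there are about 2^(n(beta(q) + aq)) of them, and with
  length 2^(-n) they are seen at x of size 2^(n(1+a)). This gives the growth exponent (beta(q) +
  aq)/(1 + a), which is at least q once beta(q) >= q. Here -a is the slope of beta at q and has to
  be nearly the same on both sides; hence differentiability, or a range of exponents to choose q
  from. Two obstacles recur: the total mass need not be 1, so that \<open>beta_n\<close> decreases
  only up to an error vanishing in n; and beta may be infinite for negative q and jump at 0, so that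
  continuity is available only for q > 0 and \<open>q_upper = 0\<close> is a case of its
  own.\<close>

text \<open>Weak derivatives are normalised to vanish off \<open>[0,1]\<close>; by uniqueness almost everywhere the choice
  made in \<open>grad\<close> is irrelevant.\<close>

definition h1_grad :: "(real \<Rightarrow> real) \<Rightarrow> (real \<Rightarrow> real) \<Rightarrow> bool" where
  "h1_grad f g \<longleftrightarrow> g \<in> borel_measurable lborel \<and> (\<forall>x. x \<notin> {0..1} \<longrightarrow> g x = 0) \<and>
     integrable lborel (\<lambda>x. (g x)\<^sup>2) \<and>
     (\<forall>x\<in>{0..1}. f x = (LINT t|lborel. indicator {..x} t * g t))"

lemma square_integrable_imp_integrable:
  fixes g :: "real \<Rightarrow> real"
  assumes "g \<in> borel_measurable lborel" "\<And>x. x \<notin> {0..1} \<Longrightarrow> g x = 0"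
    "integrable lborel (\<lambda>x. (g x)\<^sup>2)"
  shows "integrable lborel g"
proof (rule Bochner_Integration.integrable_bound[where f="\<lambda>x. indicator {0..1} x + (g x)\<^sup>2"])
  show "integrable lborel (\<lambda>x. indicator {0..1} x + (g x)\<^sup>2)"
    using assms(3) by (intro Bochner_Integration.integrable_add) auto
  have "\<bar>y\<bar> \<le> 1 + y\<^sup>2" for y :: real
  proof -
    have "0 \<le> (\<bar>y\<bar> - 1)\<^sup>2" by simp
    then show ?thesis by (simp add: power2_diff)
  qed
  then show "AE x in lborel. norm (g x) \<le> norm (indicator {0..1} x + (g x)\<^sup>2)"
    using assms(2) by (intro AE_I2) (auto simp: indicator_def)
qed (use assms in auto)

lemma square_integrable_mult:
  fixes g h :: "real \<Rightarrow> real"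
  assumes "g \<in> borel_measurable lborel" "h \<in> borel_measurable lborel"
    "integrable lborel (\<lambda>x. (g x)\<^sup>2)" "integrable lborel (\<lambda>x. (h x)\<^sup>2)"
  shows "integrable lborel (\<lambda>x. g x * h x)"
proof (rule Bochner_Integration.integrable_bound[where f="\<lambda>x. (g x)\<^sup>2 + (h x)\<^sup>2"])
  have "\<bar>a * b\<bar> \<le> a\<^sup>2 + b\<^sup>2" for a b :: real
  proof -
    have "0 \<le> (\<bar>a\<bar> - \<bar>b\<bar>)\<^sup>2" "0 \<le> a\<^sup>2 + b\<^sup>2" by simp_all
    then have "2 * (\<bar>a\<bar> * \<bar>b\<bar>) \<le> a\<^sup>2 + b\<^sup>2" by (simp add: power2_diff abs_mult)
    moreover have "0 \<le> \<bar>a\<bar> * \<bar>b\<bar>" by simp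
    ultimately show ?thesis unfolding abs_mult by linarith
  qed
  then show "AE x in lborel. norm (g x * h x) \<le> norm ((g x)\<^sup>2 + (h x)\<^sup>2)"
    by (intro AE_I2) auto
qed (use assms in auto)

lemma integrable_indicator_mult:
  fixes f :: "'a \<Rightarrow> real"
  assumes "A \<in> sets M" "integrable M f"
  shows "integrable M (\<lambda>x. indicator A x * f x)"
  using integrable_mult_indicator[OF assms] by simp

text \<open>The sets over which \<open>u\<close> integrates to 0 form a Dynkin system, because the
  total integral vanishes. It contains the half-lines, an intersection-stable generator, hence every
  Borel set.\<close>

lemma AE_zero_of_integrals:
  fixes u :: "real \<Rightarrow> real"
  assumes u: "integrable lborel u" and z: "\<And>x. (LINT t|lborel. indicator {..x} t * u t) = 0"
    and tot: "(LINT t|lborel. u t) = 0"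
  shows "AE x in lborel. u x = 0"
proof -
  have um: "u \<in> borel_measurable lborel" using u by auto
  have "(LINT t:A|lborel. u t) = 0" if "A \<in> sets borel" for A
  proof -
    have g: "sets (borel :: real measure) = sigma_sets UNIV (range (\<lambda>x. {..x}))"
      by (subst borel_eq_atMost) simp
    have subset_Pow_UNIV: "range (\<lambda>x::real. {..x}) \<subseteq> Pow UNIV" by simp
    have st: "Int_stable (range (\<lambda>x::real. {..x}))"
      by (auto simp: Int_stable_def)
    show ?thesis
      using that unfolding g
    proof (induction rule: sigma_sets_induct_disjoint[OF st subset_Pow_UNIV, consumes 1, case_names basic empty compl union])
      case (basic A)
      then show ?case using z by (auto simp: set_lebesgue_integral_def)
    next
      case empty then show ?case by (simp add: set_lebesgue_integral_def)
    next
      case (compl A)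
      then have A: "A \<in> sets lborel" by (simp add: g)
      have "(LINT t:A \<union> (UNIV - A)|lborel. u t) = (LINT t:A|lborel. u t) + (LINT t:(UNIV-A)|lborel. u t)"
        using A u by (intro set_integral_Un)
          (auto simp: set_integrable_def intro!: integrable_indicator_mult)
      moreover have "A \<union> (UNIV - A) = UNIV" by auto
      ultimately show ?case using compl(2) tot by (simp add: set_lebesgue_integral_def)
    next
      case (union A)
      have A: "A i \<in> sets lborel" for i using union(2) by (auto simp: g)
      have "(LINT t:(\<Union>i. A i)|lborel. u t) = (\<Sum>i. LINT t:A i|lborel. u t)"
        using A u union(1) by (intro lebesgue_integral_countable_add)
          (auto simp: set_integrable_def disjoint_family_on_def intro!: integrable_indicator_mult)
      then show ?case using union(3) by simp
    qed
  qed
  then have "AE x in lborel. u x = (\<lambda>_. 0) x"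
    using u by (intro density_unique_real) auto
  then show ?thesis by simp
qed

text \<open>The primitives agree on [0,1]; as both gradients vanish off [0,1], they agree at every
  end point, which is the form that \<open>AE_zero_of_integrals\<close> requires.\<close>

lemma h1_grad_unique:
  assumes "h1_grad f g" "h1_grad f h"
  shows "AE x in lborel. g x = h x"
proof -
  have gi: "integrable lborel g" and hi: "integrable lborel h"
    using assms by (auto simp: h1_grad_def intro!: square_integrable_imp_integrable)
  have ig: "integrable lborel (\<lambda>t. indicator {..x} t * g t)" "integrable lborel (\<lambda>t. indicator {..x} t * h t)" for x
    using integrable_mult_indicator[OF _ gi, of "{..x}"] integrable_mult_indicator[OF _ hi, of "{..x}"] by auto
  have 1: "(LINT t|lborel. indicator {..x} t * (g t - h t)) = 0" if "x \<in> {0..1}" for x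
    using assms that ig by (simp add: h1_grad_def right_diff_distrib)
  have z: "(LINT t|lborel. indicator {..x} t * (g t - h t)) = 0" for x
  proof -
    consider "x < 0" | "x \<in> {0..1}" | "x > 1" by fastforce
    then show ?thesis
    proof cases
      case 1
      then have "(\<lambda>t. indicator {..x} t * (g t - h t)) = (\<lambda>t. 0)"
        using assms by (auto simp: h1_grad_def indicator_def fun_eq_iff)
      then show ?thesis by simp
    next
      case 3
      then have "(\<lambda>t. indicator {..x} t * (g t - h t)) = (\<lambda>t. indicator {..1} t * (g t - h t))"
        using assms by (auto simp: h1_grad_def indicator_def fun_eq_iff)
      then show ?thesis using 1[of 1] by simp
    qed (fact 1)
  qed
  have "(\<lambda>t. indicator {..1} t * (g t - h t)) = (\<lambda>t. g t - h t)"
    using assms by (auto simp: h1_grad_def indicator_def fun_eq_iff)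
  then have "(LINT t|lborel. (g t - h t)) = 0" using z[of 1] by simp
  with AE_zero_of_integrals[of "\<lambda>t. g t - h t"] z gi hi show ?thesis by auto
qed

lemma weak_deriv_iff_h1_grad:
  "is_weak_deriv f g \<longleftrightarrow> h1_grad f (\<lambda>x. indicator {0..1} x * g x)"
proof -
  have sq: "(indicat_real {0..1} x * g x)\<^sup>2 = indicator {0..1} x * (g x)\<^sup>2" for x
    by (auto simp: indicator_def)
  have i: "(\<lambda>t. indicator {..x} t * (indicator {0..1} t * g t)) = (\<lambda>t. indicat_real {0..x} t *\<^sub>R g t)"
    if "x \<in> {0..1}" for x
    using that by (auto simp: indicator_def fun_eq_iff)
  show ?thesis
    unfolding is_weak_deriv_def h1_grad_def L2_unit_def set_borel_measurable_def set_integrable_def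
      set_lebesgue_integral_def
    using i by (auto simp: sq)
qed

lemma h1_grad_imp_weak_deriv: "h1_grad f g \<Longrightarrow> is_weak_deriv f g"
proof -
  assume *: "h1_grad f g"
  then have "(\<lambda>x. indicator {0..1} x * g x) = g"
    by (auto simp: h1_grad_def fun_eq_iff indicator_def)
  with * show "is_weak_deriv f g" by (simp add: weak_deriv_iff_h1_grad)
qed

lemma h1_grad_grad: "h1_grad f g \<Longrightarrow> h1_grad f (\<lambda>x. indicator {0..1} x * grad f x)"
  unfolding grad_def
  using h1_grad_imp_weak_deriv[of f g] weak_deriv_iff_h1_grad someI_ex[of "is_weak_deriv f"] by blast

lemma energy_form_eq:
  assumes f: "h1_grad f g" and f': "h1_grad f' g'"
  shows "energy_form f f' = (LINT t|lborel. g t * g' t)"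
proof -
  let ?h = "\<lambda>x. indicator {0..1} x * grad f x" and ?h' = "\<lambda>x. indicator {0..1} x * grad f' x"
  have 1: "h1_grad f ?h" "h1_grad f' ?h'" using f f' h1_grad_grad by blast+
  have "AE x in lborel. x \<noteq> (0::real)" "AE x in lborel. x \<noteq> (1::real)"
    by (rule AE_lborel_singleton)+
  then have ae: "AE x in lborel. indicat_real {0<..<1} x *\<^sub>R (grad f x * grad f' x) = ?h x * ?h' x"
    by eventually_elim (auto simp: indicator_def)
  have m: "(\<lambda>x. ?h x * ?h' x) \<in> borel_measurable lborel"
    using 1 by (auto simp: h1_grad_def)
  have "(\<lambda>x. indicat_real {0<..<1} x * (?h x * ?h' x)) \<in> borel_measurable lborel"
    by (rule borel_measurable_times[OF _ m]) auto
  moreover have "(\<lambda>x. indicat_real {0<..<1} x * (?h x * ?h' x)) =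
      (\<lambda>x. indicat_real {0<..<1} x *\<^sub>R (grad f x * grad f' x))"
    by (auto simp: indicator_def fun_eq_iff)
  ultimately have "energy_form f f' = (LINT t|lborel. ?h t * ?h' t)"
    unfolding energy_form_def set_lebesgue_integral_def
    using ae m by (intro integral_cong_AE) auto
  also have "\<dots> = (LINT t|lborel. g t * g' t)"
    using h1_grad_unique[OF f 1(1)] h1_grad_unique[OF f' 1(2)] f f' 1
    by (intro integral_cong_AE) (auto simp: h1_grad_def)
  finally show ?thesis .
qed

lemma H10_iff:
  "f \<in> H10 \<longleftrightarrow> (\<exists>g. h1_grad f g) \<and> f 0 = 0 \<and> f 1 = 0 \<and> (\<forall>x. x \<notin> {0..1} \<longrightarrow> f x = 0)"
  unfolding H10_def using weak_deriv_iff_h1_grad h1_grad_imp_weak_deriv by blast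

lemma h1_grad_integrable: "h1_grad f g \<Longrightarrow> integrable lborel g"
  by (auto simp: h1_grad_def intro!: square_integrable_imp_integrable)

lemma h1_grad_integrable_mult: "h1_grad f g \<Longrightarrow> h1_grad f' g' \<Longrightarrow> integrable lborel (\<lambda>x. g x * g' x)"
  by (auto simp: h1_grad_def intro!: square_integrable_mult)

lemma h1_grad_add:
  assumes "h1_grad f g" "h1_grad f' g'"
  shows "h1_grad (\<lambda>x. f x + f' x) (\<lambda>x. g x + g' x)"
proof -
  note [simp] = h1_grad_integrable[OF assms(1)] h1_grad_integrable[OF assms(2)]
  have "integrable lborel (\<lambda>x. (g x)\<^sup>2 + (g' x)\<^sup>2 + 2 * (g x * g' x))"
    using assms h1_grad_integrable_mult[OF assms] by (auto simp: h1_grad_def)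
  moreover have "(\<lambda>x. (g x)\<^sup>2 + (g' x)\<^sup>2 + 2 * (g x * g' x)) = (\<lambda>x. (g x + g' x)\<^sup>2)"
    by (simp add: power2_sum algebra_simps)
  moreover have "integrable lborel (\<lambda>t. indicator {..x} t * g t)" "integrable lborel (\<lambda>t. indicator {..x} t * g' t)" for x
    using integrable_mult_indicator[of "{..x}" lborel g] integrable_mult_indicator[of "{..x}" lborel g'] by auto
  ultimately show ?thesis
    using assms by (auto simp: h1_grad_def distrib_left)
qed

lemma h1_grad_scale:
  assumes "h1_grad f g"
  shows "h1_grad (\<lambda>x. c * f x) (\<lambda>x. c * g x)"
proof -
  have *: "(LINT t|lborel. indicator {..x} t * (c * g t)) = c * (LINT t|lborel. indicator {..x} t * g t)" for x
    by (subst integral_mult_right_zero[symmetric]) (simp add: algebra_simps)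
  show ?thesis
    using assms by (auto simp: h1_grad_def power_mult_distrib *)
qed

lemma h1_grad_sum:
  assumes "\<And>i. i \<in> I \<Longrightarrow> h1_grad (f i) (g i)"
  shows "h1_grad (\<lambda>x. \<Sum>i\<in>I. f i x) (\<lambda>x. \<Sum>i\<in>I. g i x)"
proof -
  have 0: "h1_grad (\<lambda>x. 0) (\<lambda>x. 0)" by (auto simp: h1_grad_def)
  show ?thesis
    using assms by (induction I rule: infinite_finite_induct) (auto simp: 0 h1_grad_add)
qed

lemma H10_zero: "(\<lambda>x. 0) \<in> H10"
  using h1_grad_sum[of "{}"] by (auto simp: H10_iff)

lemma H10_add: "f \<in> H10 \<Longrightarrow> g \<in> H10 \<Longrightarrow> (\<lambda>x. f x + g x) \<in> H10"
  unfolding H10_iff using h1_grad_add by fastforce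

lemma H10_scale: "f \<in> H10 \<Longrightarrow> (\<lambda>x. c * f x) \<in> H10"
  unfolding H10_iff using h1_grad_scale by fastforce

lemma H10_diff: "f \<in> H10 \<Longrightarrow> g \<in> H10 \<Longrightarrow> (\<lambda>x. f x - g x) \<in> H10"
  using H10_add[of f "\<lambda>x. (-1) * g x"] H10_scale[of g "-1"] by simp

lemma H10_sum: "(\<And>i. i \<in> I \<Longrightarrow> f i \<in> H10) \<Longrightarrow> (\<lambda>x. \<Sum>i\<in>I. f i x) \<in> H10"
  by (induction I rule: infinite_finite_induct) (auto simp: H10_zero H10_add)

lemma energy_form_commute: "energy_form f g = energy_form g f"
  by (simp add: energy_form_def mult.commute)

lemma energy_form_add_left:
  assumes "f \<in> H10" "g \<in> H10" "h \<in> H10"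
  shows "energy_form (\<lambda>x. f x + g x) h = energy_form f h + energy_form g h"
proof -
  obtain f' g' h' where *: "h1_grad f f'" "h1_grad g g'" "h1_grad h h'"
    using assms by (auto simp: H10_iff)
  show ?thesis
    using h1_grad_integrable_mult[OF *(1,3)] h1_grad_integrable_mult[OF *(2,3)]
    by (simp add: energy_form_eq[OF h1_grad_add[OF *(1,2)] *(3)] energy_form_eq[OF *(1,3)]
        energy_form_eq[OF *(2,3)] distrib_right)
qed

lemma energy_form_scale_left:
  assumes "f \<in> H10" "h \<in> H10"
  shows "energy_form (\<lambda>x. c * f x) h = c * energy_form f h"
proof -
  obtain f' h' where *: "h1_grad f f'" "h1_grad h h'"
    using assms by (auto simp: H10_iff)
  show ?thesis
    by (simp add: energy_form_eq[OF h1_grad_scale[OF *(1)] *(2)] energy_form_eq[OF *] mult.assoc)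
qed

lemma energy_form_diff_left:
  assumes "f \<in> H10" "g \<in> H10" "h \<in> H10"
  shows "energy_form (\<lambda>x. f x - g x) h = energy_form f h - energy_form g h"
  using energy_form_add_left[of f "\<lambda>x. (-1) * g x" h] energy_form_scale_left[of g h "-1"] H10_scale[of g "-1"] assms
  by simp

lemma energy_form_zero_left: "h \<in> H10 \<Longrightarrow> energy_form (\<lambda>x. 0) h = 0"
  using energy_form_scale_left[of "\<lambda>x. 0" h 0] H10_zero by simp

lemma energy_form_sum_left:
  assumes "\<And>i. i \<in> I \<Longrightarrow> f i \<in> H10" "h \<in> H10"
  shows "energy_form (\<lambda>x. \<Sum>i\<in>I. f i x) h = (\<Sum>i\<in>I. energy_form (f i) h)"
  using assms by (induction I rule: infinite_finite_induct)
    (auto simp: energy_form_zero_left energy_form_add_left H10_sum)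

lemma energy_form_sum_right:
  assumes "\<And>i. i \<in> I \<Longrightarrow> f i \<in> H10" "h \<in> H10"
  shows "energy_form h (\<lambda>x. \<Sum>i\<in>I. f i x) = (\<Sum>i\<in>I. energy_form h (f i))"
  using energy_form_sum_left[OF assms] by (simp add: energy_form_commute)

lemma energy_form_nonneg: assumes "f \<in> H10" shows "energy_form f f \<ge> 0"
proof -
  obtain f' where *: "h1_grad f f'" using assms by (auto simp: H10_iff)
  show ?thesis unfolding energy_form_eq[OF * *] by (rule integral_nonneg_AE) auto
qed

section \<open>Pointwise bounds by the energy\<close>

text \<open>Cauchy--Schwarz for \<open>g\<close> against the constant 1, read off from the
  nonnegativity of the variance of \<open>g\<close> about its mean \<open>m\<close>.\<close>

lemma square_integral_le:
  fixes g :: "real \<Rightarrow> real"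
  assumes "integrable lborel g" "integrable lborel (\<lambda>x. (g x)\<^sup>2)" "a \<le> b" 
  shows "(LINT t|lborel. indicator {a<..b} t * g t)\<^sup>2 \<le> (b - a) * (LINT t|lborel. indicator {a<..b} t * (g t)\<^sup>2)"
proof (cases "a = b")
  case False
  with assms have ab: "a < b" by simp
  define m where "m = (LINT t|lborel. indicator {a<..b} t * g t) / (b - a)"
  have i1: "integrable lborel (\<lambda>t. indicator {a<..b} t * g t)"
    using integrable_mult_indicator[OF _ assms(1), of "{a<..b}"] by simp
  have i2: "integrable lborel (\<lambda>t. indicator {a<..b} t * (g t)\<^sup>2)"
    using integrable_mult_indicator[OF _ assms(2), of "{a<..b}"] by simp
  have i3: "integrable lborel (indicat_real {a<..b})" using ab by simp
  have l: "(LINT t|lborel. indicat_real {a<..b} t) = b - a" using ab by simp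
  have "0 \<le> (LINT t|lborel. indicator {a<..b} t * (g t - m)\<^sup>2)"
    by (rule integral_nonneg_AE) auto
  also have "(\<lambda>t. indicat_real {a<..b} t * (g t - m)\<^sup>2) = (\<lambda>t. indicator {a<..b} t * (g t)\<^sup>2
      - (2 * m) * (indicator {a<..b} t * g t) + m\<^sup>2 * indicat_real {a<..b} t)"
    by (auto simp: power2_diff algebra_simps)
  also have "(LINT t|lborel. \<dots> t) = (LINT t|lborel. indicator {a<..b} t * (g t)\<^sup>2)
      - 2 * m * (LINT t|lborel. indicator {a<..b} t * g t) + m\<^sup>2 * (b - a)"
    using i1 i2 i3 l by simp
  also have "\<dots> = (LINT t|lborel. indicator {a<..b} t * (g t)\<^sup>2) - (LINT t|lborel. indicator {a<..b} t * g t)\<^sup>2 / (b - a)"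
  proof -
    have "2 * (I / d) * I - (I / d)\<^sup>2 * d = I\<^sup>2 / d" if "d > 0" for I d :: real
      using that by (simp add: power2_eq_square field_simps)
    from this[of "b - a"] show ?thesis using ab unfolding m_def by (smt (verit))
  qed
  finally show ?thesis using ab by (simp add: field_simps)
qed simp

lemma h1_grad_diff_eq:
  assumes "h1_grad f g" "0 \<le> x" "x \<le> y" "y \<le> 1"
  shows "f y - f x = (LINT t|lborel. indicator {x<..y} t * g t)"
proof -
  have gi: "integrable lborel g" by (rule h1_grad_integrable[OF assms(1)])
  have i: "integrable lborel (\<lambda>t. indicator {..z} t * g t)" for z
    using integrable_mult_indicator[OF _ gi, of "{..z}"] by simp
  have "f y - f x = (LINT t|lborel. indicator {..y} t * g t - indicator {..x} t * g t)"
    using assms i by (simp add: h1_grad_def)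
  also have "(\<lambda>t. indicator {..y} t * g t - indicator {..x} t * g t) = (\<lambda>t. indicator {x<..y} t * g t)"
    using assms by (auto simp: indicator_def fun_eq_iff)
  finally show ?thesis .
qed

text \<open>The increment over [x,y] is bounded by the energy of a surrounding interval. With
  \<open>x\<close> replaced by a zero of \<open>f\<close> at its left end, this controls
  \<open>f\<close> on a whole partition interval by the energy of that interval alone.\<close>

lemma h1_grad_local:
  assumes "h1_grad f g" "0 \<le> a" "a \<le> x" "x \<le> y" "y \<le> b" "b \<le> 1"
  shows "(f y - f x)\<^sup>2 \<le> (y - x) * (LINT t|lborel. indicator {a<..b} t * (g t)\<^sup>2)"
proof -
  have g: "integrable lborel g" "integrable lborel (\<lambda>x. (g x)\<^sup>2)"
    using h1_grad_integrable[OF assms(1)] assms(1) by (simp_all add: h1_grad_def)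
  have i2: "integrable lborel (\<lambda>t. indicator {c<..d} t * (g t)\<^sup>2)" for c d
    using integrable_mult_indicator[OF _ g(2), of "{c<..d}"] by simp
  have "(f y - f x)\<^sup>2 \<le> (y - x) * (LINT t|lborel. indicator {x<..y} t * (g t)\<^sup>2)"
    using h1_grad_diff_eq[OF assms(1), of x y] square_integral_le[OF g, of x y] assms by simp
  also have "\<dots> \<le> (y - x) * (LINT t|lborel. indicator {a<..b} t * (g t)\<^sup>2)"
    using assms i2 by (intro mult_left_mono integral_mono) (auto simp: indicator_def)
  finally show ?thesis .
qed

lemma H10_holder:
  assumes "f \<in> H10" "x \<in> {0..1}" "y \<in> {0..1}"
  shows "(f y - f x)\<^sup>2 \<le> \<bar>y - x\<bar> * energy_form f f"
proof -
  obtain g where g: "h1_grad f g" using assms by (auto simp: H10_iff)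
  have e: "energy_form f f = (LINT t|lborel. (g t)\<^sup>2)"
    by (simp add: energy_form_eq[OF g g] power2_eq_square)
  have g2: "integrable lborel (\<lambda>x. (g x)\<^sup>2)" using g by (auto simp: h1_grad_def)
  then have "(LINT t|lborel. indicator {0<..1} t * (g t)\<^sup>2) \<le> (LINT t|lborel. (g t)\<^sup>2)"
    using integrable_mult_indicator[OF _ g2, of "{0<..1}"]
    by (intro integral_mono) (auto simp: indicator_def)
  then have *: "(f y - f x)\<^sup>2 \<le> \<bar>y - x\<bar> * energy_form f f" if "x \<in> {0..1}" "y \<in> {0..1}" "x \<le> y" for x y
    using that h1_grad_local[OF g, of 0 x y 1] unfolding e
    by (smt (verit, best) atLeastAtMost_iff mult_left_mono)
  show ?thesis
    using *[of x y] *[of y x] assms by (cases "x \<le> y") (auto simp: power2_commute abs_minus_commute)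
qed

text \<open>The increment from the zero at 0. It makes the energy definite on \<open>H10\<close> and
  turns convergence in energy into uniform convergence.\<close>

lemma H10_bound: assumes "f \<in> H10" shows "(f x)\<^sup>2 \<le> energy_form f f"
proof (cases "x \<in> {0..1}")
  case True
  have "(f x)\<^sup>2 \<le> x * energy_form f f"
    using H10_holder[OF assms, of 0 x] assms True by (auto simp: H10_iff)
  also have "\<dots> \<le> energy_form f f" using True energy_form_nonneg[OF assms] by (simp add: mult_left_le_one_le)
  finally show ?thesis .
qed (use assms energy_form_nonneg[OF assms] in \<open>auto simp: H10_iff\<close>)

lemma H10_eq_zero: "f \<in> H10 \<Longrightarrow> energy_form f f = 0 \<Longrightarrow> f = (\<lambda>x. 0)"
  using H10_bound[of f] by (auto simp: fun_eq_iff)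

lemma H10_continuous: assumes "f \<in> H10" shows "continuous_on {0..1} f"
proof -
  have "uniformly_continuous_on {0..1} f"
    unfolding uniformly_continuous_on_def
  proof safe
    fix e :: real assume e: "e > 0"
    define d where "d = e\<^sup>2 / (energy_form f f + 1)"
    have E: "energy_form f f \<ge> 0" using assms by (rule energy_form_nonneg)
    show "\<exists>d>0. \<forall>x\<in>{0..1}. \<forall>x'\<in>{0..1}. dist x' x < d \<longrightarrow> dist (f x') (f x) < e"
    proof (intro exI[of _ d] conjI ballI impI)
      show "d > 0" using e E by (simp add: d_def)
      fix x x' :: real assume xx: "x \<in> {0..1}" "x' \<in> {0..1}" "dist x' x < d"
      have "(f x' - f x)\<^sup>2 \<le> \<bar>x' - x\<bar> * energy_form f f" using H10_holder[OF assms xx(1,2)] .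
      also have "\<dots> \<le> \<bar>x' - x\<bar> * (energy_form f f + 1)" by (intro mult_left_mono) auto
      also have "\<dots> < d * (energy_form f f + 1)" using E xx(3) by (intro mult_strict_right_mono) (auto simp: dist_real_def)
      also have "\<dots> = e\<^sup>2" using E by (simp add: d_def)
      finally show "dist (f x') (f x) < e" using e
        by (simp add: dist_real_def ) (metis power2_abs power2_less_imp_less less_imp_le)
    qed
  qed
  then show ?thesis by (rule uniformly_continuous_imp_continuous)
qed

lemma measurable_zero_outside:
  fixes f :: "real \<Rightarrow> real"
  assumes "continuous_on {0..1} f" "\<And>x. x \<notin> {0..1} \<Longrightarrow> f x = 0"
  shows "f \<in> borel_measurable borel"
proof -
  have "(\<lambda>x. indicator {0..1} x *\<^sub>R f x) \<in> borel_measurable borel"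
    using assms(1) by (intro borel_measurable_continuous_on_indicator) auto
  moreover have "(\<lambda>x. indicator {0..1} x *\<^sub>R f x) = f" using assms(2) by (auto simp: fun_eq_iff indicator_def)
  ultimately show ?thesis by simp
qed

lemma H10_measurable: "f \<in> H10 \<Longrightarrow> f \<in> borel_measurable borel"
  by (rule measurable_zero_outside[OF H10_continuous]) (auto simp: H10_iff)

locale unit_interval_measure = finite_measure \<nu> for \<nu> :: "real measure" +
  assumes sets_eq [measurable_cong, simp]: "sets \<nu> = sets borel"
    and null_outside: "emeasure \<nu> (- {0<..<1}) = 0"
    and nonzero: "emeasure \<nu> {0<..<1} \<noteq> 0"
begin

lemma space_eq [simp]: "space \<nu> = UNIV"
  using sets_eq_imp_space_eq[OF sets_eq] by simp

lemma measurable_eq [simp]: "borel_measurable \<nu> = borel_measurable borel"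
  by (rule measurable_cong_sets) auto

lemma AE_unit: "AE y in \<nu>. y \<in> {0<..<1}"
  by (rule AE_I[of _ _ "- {0<..<1}"]) (use null_outside in auto)

text \<open>The functions on which the Green operator acts: all integrals against the finite measure
  exist, and the class contains \<open>H10\<close> as well as uniform limits of its elements, which
  are not known to have a weak derivative beforehand.\<close>

definition bdd_fun :: "(real \<Rightarrow> real) \<Rightarrow> bool" where
  "bdd_fun f \<longleftrightarrow> f \<in> borel_measurable borel \<and> (\<exists>K. \<forall>x. \<bar>f x\<bar> \<le> K) \<and> (\<forall>x. x \<notin> {0..1} \<longrightarrow> f x = 0)"

lemma bdd_fun_H10: assumes "f \<in> H10" shows "bdd_fun f"
proof -
  have "\<bar>f x\<bar> \<le> sqrt (energy_form f f)" for x
    using H10_bound[OF assms, of x] by (simp add: real_le_rsqrt)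
  then show ?thesis
    using H10_measurable[OF assms] assms by (auto simp: bdd_fun_def H10_iff)
qed

lemma integrable_bounded:
  fixes f :: "real \<Rightarrow> real"
  assumes "f \<in> borel_measurable borel" "\<And>x. \<bar>f x\<bar> \<le> K"
  shows "integrable \<nu> f"
  using assms by (intro integrable_const_bound[of f K]) auto

lemma integral_abs_le:
  fixes f :: "real \<Rightarrow> real"
  assumes "f \<in> borel_measurable borel" "\<And>x. \<bar>f x\<bar> \<le> K"
  shows "(\<integral>x. \<bar>f x\<bar> \<partial>\<nu>) \<le> K * measure \<nu> UNIV" "\<bar>\<integral>x. f x \<partial>\<nu>\<bar> \<le> K * measure \<nu> UNIV"
proof -
  have i: "integrable \<nu> f" using assms by (rule integrable_bounded)
  then have "(\<integral>x. \<bar>f x\<bar> \<partial>\<nu>) \<le> (\<integral>x. K \<partial>\<nu>)"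
    using assms(2) by (intro integral_mono) auto
  then show 1: "(\<integral>x. \<bar>f x\<bar> \<partial>\<nu>) \<le> K * measure \<nu> UNIV" by (simp add: mult.commute)
  show "\<bar>\<integral>x. f x \<partial>\<nu>\<bar> \<le> K * measure \<nu> UNIV"
    using integral_norm_bound[of \<nu> f] 1 unfolding real_norm_def by (rule order_trans)
qed

lemma bdd_fun_mult_integrable:
  assumes "bdd_fun f" "bdd_fun g"
  shows "integrable \<nu> (\<lambda>x. f x * g x)"
proof -
  obtain K L where K: "\<And>x. \<bar>f x\<bar> \<le> K" and L: "\<And>x. \<bar>g x\<bar> \<le> L" using assms by (auto simp: bdd_fun_def)
  have K0: "0 \<le> K" using K[of 0] by linarith
  have "\<bar>f x * g x\<bar> \<le> K * L" for x
    unfolding abs_mult using K[of x] L[of x] K0 by (intro mult_mono) auto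
  then show ?thesis using assms by (intro integrable_bounded[of _ "K*L"]) (auto simp: bdd_fun_def)
qed

text \<open>The inner product of L2(\<nu>), on functions instead of classes. In general it is only
  semidefinite on \<open>H10\<close>: it does not see functions that vanish on the support.\<close>

definition mip :: "(real \<Rightarrow> real) \<Rightarrow> (real \<Rightarrow> real) \<Rightarrow> real" where
  "mip f g = (\<integral>x. f x * g x \<partial>\<nu>)"

lemma mip_commute: "mip f g = mip g f" by (simp add: mip_def mult.commute)

lemma bdd_fun_add: assumes "bdd_fun f" "bdd_fun g" shows "bdd_fun (\<lambda>x. f x + g x)"
proof -
  obtain K L where "\<And>x. \<bar>f x\<bar> \<le> K" "\<And>x. \<bar>g x\<bar> \<le> L" using assms by (auto simp: bdd_fun_def)
  then have "\<And>x. \<bar>f x + g x\<bar> \<le> K + L" by (meson abs_triangle_ineq add_mono order_trans)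
  then show ?thesis using assms unfolding bdd_fun_def by auto
qed

lemma bdd_fun_scale: assumes "bdd_fun f" shows "bdd_fun (\<lambda>x. c * f x)"
proof -
  obtain K where "\<And>x. \<bar>f x\<bar> \<le> K" using assms by (auto simp: bdd_fun_def)
  then have "\<And>x. \<bar>c * f x\<bar> \<le> \<bar>c\<bar> * K" by (simp add: abs_mult mult_left_mono)
  then show ?thesis using assms unfolding bdd_fun_def by auto
qed

lemma bdd_fun_diff: "bdd_fun f \<Longrightarrow> bdd_fun g \<Longrightarrow> bdd_fun (\<lambda>x. f x - g x)"
  using bdd_fun_add[of f "\<lambda>x. (-1) * g x"] bdd_fun_scale[of g "-1"] by simp

lemma mip_add_left: "bdd_fun f \<Longrightarrow> bdd_fun g \<Longrightarrow> bdd_fun h \<Longrightarrow> mip (\<lambda>x. f x + g x) h = mip f h + mip g h"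
  by (simp add: mip_def distrib_right bdd_fun_mult_integrable)

lemma mip_scale_left: "mip (\<lambda>x. c * f x) h = c * mip f h"
  by (simp add: mip_def mult.assoc)

lemma mip_sum_left:
  assumes "\<And>i. i \<in> I \<Longrightarrow> bdd_fun (f i)" "bdd_fun h"
  shows "mip (\<lambda>x. \<Sum>i\<in>I. f i x) h = (\<Sum>i\<in>I. mip (f i) h)"
  unfolding mip_def sum_distrib_right
  using assms by (intro Bochner_Integration.integral_sum bdd_fun_mult_integrable) auto

lemma mip_nonneg: "mip f f \<ge> 0"
  unfolding mip_def by (rule integral_nonneg_AE) auto

lemma mip_abs_le:
  assumes "bdd_fun f" "bdd_fun g" "\<And>x. \<bar>f x\<bar> \<le> a" "\<And>x. \<bar>g x\<bar> \<le> b"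
  shows "\<bar>mip f g\<bar> \<le> a * b * measure \<nu> UNIV"
proof -
  have a: "0 \<le> a" using assms(3)[of 0] by linarith
  have "\<bar>f x * g x\<bar> \<le> a * b" for x
    unfolding abs_mult using assms(3,4)[of x] a by (intro mult_mono) auto
  then show ?thesis
    unfolding mip_def using assms(1,2) by (intro integral_abs_le) (auto simp: bdd_fun_def)
qed

section \<open>The Green operator\<close>

definition green :: "(real \<Rightarrow> real) \<Rightarrow> real \<Rightarrow> real" where
  "green f x = (if x \<in> {0..1} then \<integral>y. (min x y - x * y) * f y \<partial>\<nu> else 0)"

text \<open>The derivative of the Green kernel in its first variable, integrated against
  \<open>f\<close>: it is \<open>1 - y\<close> for \<open>t \<le> y\<close> and \<open>- y\<close>
  beyond.\<close>

definition green_grad :: "(real \<Rightarrow> real) \<Rightarrow> real \<Rightarrow> real" where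
  "green_grad f t = indicator {0..1} t * (\<integral>y. ((if t \<le> y then 1 else 0) - y) * f y \<partial>\<nu>)"

lemma Fubini_mult:
  fixes g :: "real \<Rightarrow> real" and k :: "real \<Rightarrow> real \<Rightarrow> real"
  assumes g: "integrable lborel g" and k: "case_prod k \<in> borel_measurable (lborel \<Otimes>\<^sub>M \<nu>)"
    and K: "\<And>t y. \<bar>k t y\<bar> \<le> K"
  shows "(LINT t|lborel. g t * (\<integral>y. k t y \<partial>\<nu>)) = (\<integral>y. (LINT t|lborel. g t * k t y) \<partial>\<nu>)"
proof -
  interpret pair_sigma_finite lborel \<nu> ..
  have gm [measurable]: "g \<in> borel_measurable lborel" using g by auto
  note k[measurable]
  have kt [measurable]: "k t \<in> borel_measurable borel" for t
    using measurable_compose[OF measurable_Pair1' k, of t] by simp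
  have K0: "0 \<le> K" using K[of 0 0] by linarith
  have f: "(\<lambda>(t, y). g t * k t y) \<in> borel_measurable (lborel \<Otimes>\<^sub>M \<nu>)" by measurable
  have "integrable (lborel \<Otimes>\<^sub>M \<nu>) (\<lambda>(t, y). g t * k t y)"
  proof (rule Fubini_integrable[OF f])
    show "integrable lborel (\<lambda>t. \<integral>y. norm (case (t, y) of (t, y) \<Rightarrow> g t * k t y) \<partial>\<nu>)"
    proof (rule Bochner_Integration.integrable_bound[where f="\<lambda>t. (K * measure \<nu> UNIV) * g t"])
      show "integrable lborel (\<lambda>t. (K * measure \<nu> UNIV) * g t)" using g by auto
      show "(\<lambda>t. \<integral>y. norm (case (t, y) of (t, y) \<Rightarrow> g t * k t y) \<partial>\<nu>) \<in> borel_measurable lborel"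
        by measurable
      have "\<bar>\<integral>y. \<bar>g t\<bar> * \<bar>k t y\<bar> \<partial>\<nu>\<bar> \<le> K * measure \<nu> UNIV * \<bar>g t\<bar>" for t
      proof -
        have "(\<integral>y. \<bar>k t y\<bar> \<partial>\<nu>) \<le> K * measure \<nu> UNIV"
          by (rule integral_abs_le(1)[OF kt K])
        moreover have "0 \<le> (\<integral>y. \<bar>k t y\<bar> \<partial>\<nu>)" by simp
        ultimately have "\<bar>(\<integral>y. \<bar>k t y\<bar> \<partial>\<nu>)\<bar> \<le> K * measure \<nu> UNIV" by (simp add: mult.commute)
        then show ?thesis by (simp add: abs_mult mult.commute mult_left_mono)
      qed
      then show "AE t in lborel. norm (\<integral>y. norm (case (t, y) of (t, y) \<Rightarrow> g t * k t y) \<partial>\<nu>)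
          \<le> norm (K * measure \<nu> UNIV * g t)"
        using K0 by (simp add: abs_mult)
    qed
    have "\<bar>g t * k t y\<bar> \<le> \<bar>g t\<bar> * K" for t y unfolding abs_mult using K by (intro mult_left_mono) auto
    then show "AE t in lborel. integrable \<nu> (\<lambda>y. case (t, y) of (t, y) \<Rightarrow> g t * k t y)"
      using integrable_bounded[of "\<lambda>y. g t * k t y" "\<bar>g t\<bar> * K" for t] by (intro AE_I2) auto
  qed
  from Fubini_integral[OF this] show ?thesis by simp
qed

lemma green_kernel:
  assumes "bdd_fun f"
  defines "k \<equiv> \<lambda>t y. ((if t \<le> y then 1 else 0) - y) * f y"
  shows "case_prod k \<in> borel_measurable (lborel \<Otimes>\<^sub>M \<nu>)" "\<exists>K\<ge>0. \<forall>t y. \<bar>k t y\<bar> \<le> K"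
proof -
  have [measurable]: "f \<in> borel_measurable borel" using assms by (auto simp: bdd_fun_def)
  show "case_prod k \<in> borel_measurable (lborel \<Otimes>\<^sub>M \<nu>)" unfolding k_def by measurable
  obtain K where K: "\<And>x. \<bar>f x\<bar> \<le> K" using assms by (auto simp: bdd_fun_def)
  have "\<bar>k t y\<bar> \<le> 1 * K" for t y
  proof (cases "y \<in> {0..1}")
    case True
    then show ?thesis unfolding k_def abs_mult using K[of y] by (intro mult_mono) auto
  next
    case False
    then show ?thesis using assms K[of y] by (auto simp: k_def bdd_fun_def)
  qed
  moreover have "0 \<le> K" using K[of 0] by linarith
  ultimately show "\<exists>K\<ge>0. \<forall>t y. \<bar>k t y\<bar> \<le> K" by auto
qed

text \<open>One exchange of integrals serves twice: with \<open>g\<close> the indicator of {0..x} it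
  yields the values of \<open>green f\<close>, with \<open>g\<close> a gradient it yields the energy
  identity.\<close>

lemma green_integral:
  assumes f: "bdd_fun f" and g: "integrable lborel g" "\<And>x. x \<notin> {0..1} \<Longrightarrow> g x = 0"
  shows "(LINT t|lborel. g t * green_grad f t) =
    (\<integral>y. f y * ((LINT t|lborel. indicator {..y} t * g t) - y * (LINT t|lborel. g t)) \<partial>\<nu>)"
proof -
  obtain K where K: "\<And>t y. \<bar>((if t \<le> y then 1 else 0) - y) * f y\<bar> \<le> K"
    using green_kernel[OF f] by blast
  have "(LINT t|lborel. g t * green_grad f t) = (LINT t|lborel. g t * (\<integral>y. ((if t \<le> y then 1 else 0) - y) * f y \<partial>\<nu>))"
    using g(2) by (intro Bochner_Integration.integral_cong) (auto simp: green_grad_def indicator_def)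
  also have "\<dots> = (\<integral>y. (LINT t|lborel. g t * (((if t \<le> y then 1 else 0) - y) * f y)) \<partial>\<nu>)"
    by (rule Fubini_mult[OF g(1) green_kernel(1)[OF f] K])
  also have "\<dots> = (\<integral>y. f y * ((LINT t|lborel. indicator {..y} t * g t) - y * (LINT t|lborel. g t)) \<partial>\<nu>)"
  proof (rule Bochner_Integration.integral_cong)
    fix y
    have i: "integrable lborel (\<lambda>t. indicator {..y} t * g t)"
      by (rule integrable_indicator_mult[OF _ g(1)]) auto
    have "(\<lambda>t. g t * (((if t \<le> y then 1 else 0) - y) * f y)) = (\<lambda>t. f y * (indicator {..y} t * g t - y * g t))"
      by (auto simp: fun_eq_iff indicator_def algebra_simps)
    then show "(LINT t|lborel. g t * (((if t \<le> y then 1 else 0) - y) * f y)) =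
        f y * ((LINT t|lborel. indicator {..y} t * g t) - y * (LINT t|lborel. g t))"
      using i g(1) by simp
  qed simp
  finally show ?thesis .
qed

lemma h1_grad_green:
  assumes f: "bdd_fun f"
  shows "h1_grad (green f) (green_grad f)"
proof -
  note [measurable] = green_kernel(1)[OF f]
  obtain K where K: "\<And>t y. \<bar>((if t \<le> y then 1 else 0) - y) * f y\<bar> \<le> K" "K \<ge> 0"
    using green_kernel(2)[OF f] by blast
  have m: "green_grad f \<in> borel_measurable lborel"
    unfolding green_grad_def by measurable
  have kt: "(\<lambda>y. ((if t \<le> y then 1 else 0) - y) * f y) \<in> borel_measurable borel" for t
    using f by (auto simp: bdd_fun_def)
  have b: "\<bar>green_grad f t\<bar> \<le> K * measure \<nu> UNIV" for t
  proof -
    have "\<bar>\<integral>y. ((if t \<le> y then 1 else 0) - y) * f y \<partial>\<nu>\<bar> \<le> K * measure \<nu> UNIV"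
      by (rule integral_abs_le(2)[OF kt K(1)])
    then show ?thesis using K(2) by (auto simp: green_grad_def indicator_def)
  qed
  have "integrable lborel (\<lambda>x. (green_grad f x)\<^sup>2)"
  proof (rule Bochner_Integration.integrable_bound[where f="\<lambda>x. (K * measure \<nu> UNIV)\<^sup>2 * indicator {0..1} x"])
    have "(green_grad f x)\<^sup>2 \<le> (K * measure \<nu> UNIV)\<^sup>2" for x
      using b[of x] by (simp add: abs_le_square_iff[symmetric])
    moreover have "green_grad f x = 0" if "x \<notin> {0..1}" for x
      using that by (simp add: green_grad_def)
    ultimately show "AE x in lborel. norm ((green_grad f x)\<^sup>2) \<le> norm ((K * measure \<nu> UNIV)\<^sup>2 * indicator {0..1} x)"
      by (intro AE_I2) (auto simp: indicator_def)
  qed (use m in auto)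
  moreover have "green f x = (LINT t|lborel. indicator {..x} t * green_grad f t)" if x: "x \<in> {0..1}" for x
  proof -
    have "(LINT t|lborel. indicator {..x} t * green_grad f t) = (LINT t|lborel. indicator {0..x} t * green_grad f t)"
      by (intro Bochner_Integration.integral_cong) (auto simp: green_grad_def indicator_def)
    also have "\<dots> = (\<integral>y. f y * ((LINT t|lborel. indicator {..y} t * indicator {0..x} t) - y * (LINT t|lborel. indicator {0..x} t)) \<partial>\<nu>)"
    proof (rule green_integral[OF f])
      show "integrable lborel (indicat_real {0..x})"
        by (intro integrable_real_indicator) (auto simp: emeasure_lborel_Icc_eq)
      show "indicator {0..x} t = (0::real)" if "t \<notin> {0..1}" for t
        using that x by (auto simp: indicator_def)
    qed
    also have "\<dots> = (\<integral>y. (min x y - x * y) * f y \<partial>\<nu>)"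
    proof (rule integral_cong_AE)
      show "AE y in \<nu>. f y * ((LINT t|lborel. indicator {..y} t * indicator {0..x} t) - y * (LINT t|lborel. indicator {0..x} t)) =
          (min x y - x * y) * f y"
        using AE_unit
      proof eventually_elim
        case (elim y)
        have "(\<lambda>t. indicat_real {..y} t * indicator {0..x} t) = indicator {0..min x y}"
          by (auto simp: indicator_def fun_eq_iff)
        then show ?case using elim x by simp
      qed
      have [measurable]: "f \<in> borel_measurable borel" using f by (auto simp: bdd_fun_def)
      have *: "(\<lambda>t. indicat_real {..y} t * indicator {0..x} t) = indicator {0..min x y}" for y
        by (auto simp: indicator_def fun_eq_iff)
      show "(\<lambda>y. f y * ((LINT t|lborel. indicator {..y} t * indicator {0..x} t) - y * (LINT t|lborel. indicator {0..x} t))) \<in> borel_measurable \<nu>"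
      proof -
        have "(LINT t|lborel. indicat_real {0..z} t) = max 0 z" for z
          by (cases "0 \<le> z") (auto simp: max_def)
        then show ?thesis unfolding * by simp
      qed
      show "(\<lambda>y. (min x y - x * y) * f y) \<in> borel_measurable \<nu>" by simp
    qed
    finally show ?thesis using x by (simp add: green_def)
  qed
  ultimately show ?thesis using m by (auto simp: h1_grad_def green_grad_def)
qed

lemma green_H10: assumes f: "bdd_fun f" shows "green f \<in> H10"
proof -
  have "green f 1 = 0"
  proof -
    have "AE y in \<nu>. (min 1 y - 1 * y) * f y = 0" using AE_unit by eventually_elim auto
    then have "(\<integral>y. (min 1 y - 1 * y) * f y \<partial>\<nu>) = 0" by (rule integral_eq_zero_AE)
    then show ?thesis by (simp add: green_def)
  qed
  moreover have "green f 0 = 0"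
  proof -
    have "AE y in \<nu>. (min 0 y - 0 * y) * f y = 0" using AE_unit by eventually_elim auto
    then have "(\<integral>y. (min 0 y - 0 * y) * f y \<partial>\<nu>) = 0" by (rule integral_eq_zero_AE)
    then show ?thesis by (simp add: green_def)
  qed
  ultimately show ?thesis using h1_grad_green[OF f] by (auto simp: H10_iff green_def)
qed

text \<open>In \<open>green_integral\<close> the term with \<open>y\<close> drops out, because the
  gradient of \<open>h\<close> has integral \<open>h 1 = 0\<close>; what remains is the primitive of
  that gradient, which is \<open>h\<close>.\<close>

lemma energy_green:
  assumes f: "bdd_fun f" and h: "h \<in> H10"
  shows "energy_form (green f) h = mip f h"
proof -
  obtain g where g: "h1_grad h g" using h by (auto simp: H10_iff)
  have z: "(LINT t|lborel. g t) = 0"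
  proof -
    have "(LINT t|lborel. g t) = (LINT t|lborel. indicator {..1} t * g t)"
      using g by (intro Bochner_Integration.integral_cong) (auto simp: h1_grad_def indicator_def)
    also have "\<dots> = h 1" using g by (simp add: h1_grad_def)
    finally show ?thesis using h by (simp add: H10_iff)
  qed
  have "energy_form (green f) h = (LINT t|lborel. g t * green_grad f t)"
    by (simp add: energy_form_eq[OF h1_grad_green[OF f] g] mult.commute)
  also have "\<dots> = (\<integral>y. f y * (LINT t|lborel. indicator {..y} t * g t) \<partial>\<nu>)"
    using green_integral[OF f h1_grad_integrable[OF g]] g z by (simp add: h1_grad_def)
  also have "\<dots> = mip f h"
    unfolding mip_def
  proof (rule Bochner_Integration.integral_cong)
    show "f y * (LINT t|lborel. indicator {..y} t * g t) = f y * h y" for y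
      using f g by (cases "y \<in> {0..1}") (auto simp: bdd_fun_def h1_grad_def)
  qed simp
  finally show ?thesis .
qed

lemma green_abs_le:
  assumes f: "bdd_fun f" and e: "\<And>x. \<bar>f x\<bar> \<le> e"
  shows "\<bar>green f x\<bar> \<le> e * measure \<nu> UNIV"
proof -
  have e0: "0 \<le> e" using e[of 0] by linarith
  have [measurable]: "f \<in> borel_measurable borel" using f by (auto simp: bdd_fun_def)
  have *: "\<bar>(min x y - x * y) * f y\<bar> \<le> e" if "x \<in> {0..1}" for y
  proof (cases "y \<in> {0..1}")
    case True
    have "0 \<le> min x y - x * y" "min x y - x * y \<le> 1"
      using True that by (auto simp: min_def mult_left_le mult_left_le_one_le)
        (smt (verit) mult_nonneg_nonneg)+
    then have "\<bar>(min x y - x * y) * f y\<bar> \<le> 1 * e" unfolding abs_mult using e[of y] by (intro mult_mono) auto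
    then show ?thesis by simp
  qed (use f e0 in \<open>auto simp: bdd_fun_def\<close>)
  show ?thesis
  proof (cases "x \<in> {0..1}")
    case True
    have "\<bar>\<integral>y. (min x y - x * y) * f y \<partial>\<nu>\<bar> \<le> e * measure \<nu> UNIV"
      by (rule integral_abs_le(2)[OF _ *[OF True]]) measurable
    then show ?thesis using True by (simp add: green_def)
  qed (use e0 in \<open>auto simp: green_def\<close>)
qed

lemma green_diff:
  assumes "bdd_fun f" "bdd_fun g"
  shows "green (\<lambda>x. f x - g x) = (\<lambda>x. green f x - green g x)"
proof
  fix x :: real
  have "integrable \<nu> (\<lambda>y. (min x y - x * y) * h y)" if h: "bdd_fun h" "x \<in> {0..1}" for h
  proof -
    have "bdd_fun (\<lambda>y. indicator {0..1} y * (min x y - x * y))"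
      unfolding bdd_fun_def using that(2)
      by (auto intro!: exI[of _ 2] simp: indicator_def min_def mult_le_one abs_le_iff)
        (smt (verit) mult_nonneg_nonneg mult_le_one)+
    from bdd_fun_mult_integrable[OF this h(1)] 
    have "integrable \<nu> (\<lambda>y. indicator {0..1} y * (min x y - x * y) * h y)" .
    moreover have "(\<lambda>y. indicator {0..1} y * (min x y - x * y) * h y) = (\<lambda>y. (min x y - x * y) * h y)"
      using h by (auto simp: fun_eq_iff indicator_def bdd_fun_def)
    ultimately show ?thesis by simp
  qed
  then show "green (\<lambda>x. f x - g x) x = green f x - green g x"
    using assms by (auto simp: green_def right_diff_distrib)
qed

section \<open>Functions affine off the support\<close>

lemma closed_supp: "closed (supp \<nu>)"
proof -
  have "- supp \<nu> = \<Union>{U. open U \<and> emeasure \<nu> U = 0}"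
    by (auto simp: supp_def not_gr_zero)
  then have "open (- supp \<nu>)" by (metis (no_types, lifting) mem_Collect_eq open_Union)
  then show ?thesis by (simp add: open_closed)
qed

text \<open>The complement of the support is a union of open null sets, of which countably many
  suffice by Lindelof's theorem.\<close>

lemma null_compl_supp: "emeasure \<nu> (- supp \<nu>) = 0"
proof -
  let ?F = "{U. open U \<and> emeasure \<nu> U = 0}"
  have eq: "- supp \<nu> = \<Union>?F"
    by (auto simp: supp_def not_gr_zero)
  obtain F' where F': "F' \<subseteq> ?F" "countable F'" "\<Union>F' = \<Union>?F"
    using Lindelof[of ?F] by (metis (no_types, lifting) mem_Collect_eq)
  have "(\<Union>U\<in>F'. U) \<in> null_sets \<nu>"
    using F' by (intro null_sets_UN') (auto intro!: null_setsI)
  then show ?thesis using eq F' by auto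
qed

lemma AE_supp: "AE y in \<nu>. y \<in> supp \<nu>"
  by (rule AE_I[of _ _ "- supp \<nu>"]) (use null_compl_supp closed_supp in auto)

text \<open>Almost every y lies in the support, hence on one fixed side of a gap of the support. The
  kernel is therefore affine in x on the gap; the reference point \<open>x0\<close> decides on which
  side y lies.\<close>

lemma green_dom: assumes f: "bdd_fun f" shows "green f \<in> dom_form \<nu>"
proof -
  have "\<exists>a b. \<forall>x\<in>I. green f x = a * x + b" if I: "I \<in> components ({0..1} - supp \<nu>)" for I
  proof -
    have c: "connected I" and sub: "I \<subseteq> {0..1} - supp \<nu>" and "I \<noteq> {}"
      using I in_components_connected in_components_subset in_components_nonempty by blast+
    then obtain x0 where x0: "x0 \<in> I" by blast
    have [measurable]: "f \<in> borel_measurable borel" using f by (auto simp: bdd_fun_def)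
    obtain K where K: "\<And>x. \<bar>f x\<bar> \<le> K" using f by (auto simp: bdd_fun_def)
    have fz: "f y = 0" if "y \<notin> {0..1}" for y using f that by (auto simp: bdd_fun_def)
    let ?a = "\<lambda>y. (indicator {x0..} y - y) * f y" and ?b = "\<lambda>y. indicator {..<x0} y * y * f y"
    have K0: "0 \<le> K" using K[of 0] by linarith
    have "\<bar>c * f y\<bar> \<le> 1 * K" if "\<bar>c\<bar> \<le> 1 \<or> y \<notin> {0..1}" for c y
      using that K[of y] fz[of y] K0 by (cases "y \<in> {0..1}") (auto simp: abs_mult intro: mult_mono[of _ 1 _ K, simplified])
    moreover have "\<bar>indicator {x0..} y - y\<bar> \<le> 1 \<or> y \<notin> {0..1}" "\<bar>indicator {..<x0} y * y\<bar> \<le> 1 \<or> y \<notin> {0..1}" for y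
      by (auto simp: indicator_def)
    ultimately have "\<bar>?a y\<bar> \<le> K" "\<bar>?b y\<bar> \<le> K" for y
      by simp_all
    then have i: "integrable \<nu> ?a" "integrable \<nu> ?b"
      by (auto intro!: integrable_bounded[of _ K])
    have "green f x = (\<integral>y. ?a y \<partial>\<nu>) * x + (\<integral>y. ?b y \<partial>\<nu>)" if x: "x \<in> I" for x
    proof -
      have "green f x = (\<integral>y. (min x y - x * y) * f y \<partial>\<nu>)"
        using x sub by (auto simp: green_def)
      also have "\<dots> = (\<integral>y. x * ?a y + ?b y \<partial>\<nu>)"
      proof (rule integral_cong_AE)
        show "AE y in \<nu>. (min x y - x * y) * f y = x * ?a y + ?b y"
          using AE_supp
        proof eventually_elim
          case (elim y)
          then have y: "y \<notin> I" using sub by auto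
          have "y < x \<longleftrightarrow> y < x0"
            using y connectedD_interval[OF c x x0, of y] connectedD_interval[OF c x0 x, of y] 
            by (metis linorder_not_le nle_le x x0)
          then show ?case using y x x0 by (cases "y < x") (auto simp: indicator_def algebra_simps)
        qed
      qed auto
      finally show ?thesis using i by (simp add: mult.commute)
    qed
    then show ?thesis by blast
  qed
  moreover have "continuous_on {0..1} (green f)"
    using H10_continuous[OF green_H10[OF f]] .
  ultimately show ?thesis using green_H10[OF f] by (auto simp: dom_form_def C_nu_def)
qed

lemma dom_form_add: assumes "f \<in> dom_form \<nu>" "g \<in> dom_form \<nu>" shows "(\<lambda>x. f x + g x) \<in> dom_form \<nu>"
proof -
  have "\<exists>a b. \<forall>x\<in>I. f x + g x = a * x + b" if I: "I \<in> components ({0..1} - supp \<nu>)" for I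
  proof -
    obtain a b c d where "\<forall>x\<in>I. f x = a * x + b" "\<forall>x\<in>I. g x = c * x + d"
      using assms I unfolding dom_form_def C_nu_def by blast
    then have "\<forall>x\<in>I. f x + g x = (a + c) * x + (b + d)" by (simp add: algebra_simps)
    then show ?thesis by blast
  qed
  then show ?thesis using assms by (auto simp: dom_form_def C_nu_def H10_add intro!: continuous_on_add)
qed

lemma dom_form_scale: assumes "f \<in> dom_form \<nu>" shows "(\<lambda>x. c * f x) \<in> dom_form \<nu>"
proof -
  have "\<exists>a b. \<forall>x\<in>I. c * f x = a * x + b" if I: "I \<in> components ({0..1} - supp \<nu>)" for I
  proof -
    obtain a b where "\<forall>x\<in>I. f x = a * x + b"
      using assms I unfolding dom_form_def C_nu_def by blast
    then have "\<forall>x\<in>I. c * f x = (c * a) * x + c * b" by (simp add: algebra_simps)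
    then show ?thesis by blast
  qed
  then show ?thesis using assms by (auto simp: dom_form_def C_nu_def H10_scale intro!: continuous_on_mult_left)
qed

lemma dom_form_diff: "f \<in> dom_form \<nu> \<Longrightarrow> g \<in> dom_form \<nu> \<Longrightarrow> (\<lambda>x. f x - g x) \<in> dom_form \<nu>"
  using dom_form_add[of f "\<lambda>x. (-1) * g x"] dom_form_scale[of g "-1"] by simp

lemma dom_form_H10: "f \<in> dom_form \<nu> \<Longrightarrow> f \<in> H10" by (simp add: dom_form_def)

lemma eigenspace_H10: "f \<in> eigenspace \<nu> l \<Longrightarrow> f \<in> H10"
  by (simp add: eigenspace_def dom_form_def)

text \<open>The test functions are no longer confined to the domain. The defect of the equation at
  \<open>w\<close> is the energy product of \<open>w\<close> with
  \<open>u = f - l * green f\<close>; since \<open>u\<close> belongs to the domain, testing with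
  \<open>u\<close> itself gives it energy 0, so \<open>u = 0\<close>.\<close>

lemma eigenspace_energy:
  assumes f: "f \<in> eigenspace \<nu> l" and h: "h \<in> H10"
  shows "energy_form f h = l * mip f h"
proof -
  have fd: "f \<in> dom_form \<nu>" using f by (simp add: eigenspace_def)
  have bf: "bdd_fun f" using bdd_fun_H10[OF eigenspace_H10[OF f]] .
  define u where "u = (\<lambda>x. f x - l * green f x)"
  have u: "u \<in> dom_form \<nu>" unfolding u_def using fd bf by (intro dom_form_diff dom_form_scale green_dom)
  have *: "energy_form u w = energy_form f w - l * mip f w" if w: "w \<in> H10" for w
    unfolding u_def using w eigenspace_H10[OF f] bf
    by (simp add: energy_form_diff_left energy_form_scale_left green_H10 H10_scale energy_green)
  have "energy_form f u = l * mip f u"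
    using f u by (simp add: eigenspace_def mip_def)
  then have "energy_form u u = 0" using *[of u] u by (simp add: dom_form_H10)
  then have "u = (\<lambda>x. 0)" using H10_eq_zero u dom_form_H10 by blast
  then show ?thesis using *[OF h] energy_form_zero_left[OF h] by simp
qed

end

section \<open>Linear systems and Cauchy--Schwarz inequalities\<close>

text \<open>Elimination of the unknown \<open>p\<close> with pivot \<open>c i p\<close>. It replaces
  dimension theory in both halves of the min-max principle: the equations are point evaluations in
  one, energy products with eigenfunctions in the other.\<close>

lemma homogeneous_system:
  fixes c :: "'i \<Rightarrow> 'j \<Rightarrow> real"
  assumes "finite I" "finite J" "card I < card J"
  shows "\<exists>a. (\<exists>j\<in>J. a j \<noteq> 0) \<and> (\<forall>i\<in>I. (\<Sum>j\<in>J. a j * c i j) = 0)"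
  using assms
proof (induction I arbitrary: J c rule: finite_induct)
  case empty
  then obtain j where "j \<in> J" by fastforce
  then show ?case by (intro exI[of _ "\<lambda>_. 1"]) auto
next
  case (insert i I)
  show ?case
  proof (cases "\<forall>j\<in>J. c i j = 0")
    case True
    obtain a where "\<exists>j\<in>J. a j \<noteq> 0" "\<forall>i\<in>I. (\<Sum>j\<in>J. a j * c i j) = 0"
      using insert.IH[of J c] insert.prems insert.hyps by auto
    then show ?thesis using True by (intro exI[of _ a]) auto
  next
    case False
    then obtain p where p: "p \<in> J" "c i p \<noteq> 0" by blast
    define c' where "c' i' j = c i' j - c i j / c i p * c i' p" for i' j
    have "card I < card (J - {p})" using insert.prems insert.hyps p by (simp add: card_Diff_singleton_if)
    then obtain a where a: "\<exists>j\<in>J - {p}. a j \<noteq> 0" "\<forall>i\<in>I. (\<Sum>j\<in>J - {p}. a j * c' i j) = 0"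
      using insert.IH[of "J - {p}" c'] insert.prems by auto
    define s where "s = (\<Sum>j\<in>J-{p}. a j * c i j)"
    define b where "b j = (if j = p then - s / c i p else a j)" for j
    have eq: "(\<Sum>j\<in>J. b j * d j) = - s / c i p * d p + (\<Sum>j\<in>J-{p}. a j * d j)" for d
      using p insert.prems by (subst sum.remove[of J p]) (auto simp: b_def intro!: sum.cong)
    have "(\<Sum>j\<in>J. b j * c i j) = 0" using p by (simp add: eq s_def)
    moreover have "(\<Sum>j\<in>J. b j * c i' j) = 0" if i': "i' \<in> I" for i'
    proof -
      have "0 = (\<Sum>j\<in>J - {p}. a j * c' i' j)" using a i' by simp
      also have "\<dots> = (\<Sum>j\<in>J-{p}. a j * c i' j - (a j * c i j) * (c i' p / c i p))"
        by (intro sum.cong) (auto simp: c'_def algebra_simps)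
      also have "\<dots> = (\<Sum>j\<in>J-{p}. a j * c i' j) - s * (c i' p / c i p)"
        by (simp only: sum_distrib_right sum_subtractf s_def)
      finally show ?thesis by (simp add: eq)
    qed
    ultimately show ?thesis using a(1) by (intro exI[of _ b]) (auto simp: b_def)
  qed
qed

text \<open>The discriminant criterion, including the degenerate case \<open>D = 0\<close>, where
  \<open>t = - (A + 1) / (2 * C)\<close> would give the value -1.\<close>

lemma quadratic_nonneg_imp:
  fixes A C D :: real
  assumes "\<And>t. 0 \<le> A + 2 * t * C + t\<^sup>2 * D" "0 \<le> D"
  shows "C\<^sup>2 \<le> A * D"
proof (cases "D = 0")
  case True
  have "C = 0"
  proof (rule ccontr)
    assume "C \<noteq> 0"
    then show False using assms(1)[of "- (A + 1) / (2 * C)"] True by (simp add: field_simps)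
  qed
  then show ?thesis using True by simp
next
  case False
  have "0 \<le> A + 2 * (- C / D) * C + (- C / D)\<^sup>2 * D" by (rule assms(1))
  also have "\<dots> = A - C\<^sup>2 / D" using False by (simp add: power2_eq_square)
  finally show ?thesis using False assms(2) by (simp add: field_simps)
qed

lemma energy_form_lincomb:
  assumes "f \<in> H10" "g \<in> H10"
  shows "energy_form (\<lambda>x. a * f x + b * g x) (\<lambda>x. a * f x + b * g x) =
    a\<^sup>2 * energy_form f f + 2 * a * b * energy_form f g + b\<^sup>2 * energy_form g g"
proof -
  let ?u = "\<lambda>x. a * f x + b * g x"
  have u: "?u \<in> H10" using assms by (intro H10_add H10_scale)
  have *: "energy_form ?u h = a * energy_form f h + b * energy_form g h" if "h \<in> H10" for h
    using assms that by (simp add: energy_form_add_left energy_form_scale_left H10_scale)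
  have "energy_form ?u ?u = a * energy_form ?u f + b * energy_form ?u g"
    using *[OF u] by (simp add: energy_form_commute)
  also have "\<dots> = a\<^sup>2 * energy_form f f + 2 * a * b * energy_form f g + b\<^sup>2 * energy_form g g"
    using assms by (simp add: * energy_form_commute[of g f] power2_eq_square algebra_simps)
  finally show ?thesis .
qed

lemma energy_form_Cauchy_Schwarz:
  assumes "f \<in> H10" "g \<in> H10"
  shows "(energy_form f g)\<^sup>2 \<le> energy_form f f * energy_form g g"
proof (rule quadratic_nonneg_imp)
  show "0 \<le> energy_form f f + 2 * t * energy_form f g + t\<^sup>2 * energy_form g g" for t
    using energy_form_lincomb[OF assms, of 1 t]
      energy_form_nonneg[OF H10_add[OF H10_scale[OF assms(1), of 1] H10_scale[OF assms(2), of t]]] by simp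
qed (rule energy_form_nonneg[OF assms(2)])

lemma sum_fun_apply_real: "(\<Sum>i\<in>I. f i) x = (\<Sum>i\<in>I. f i x)" for f :: "'i \<Rightarrow> real \<Rightarrow> real"
  by (induction I rule: infinite_finite_induct) auto

context unit_interval_measure
begin

lemma mip_Cauchy_Schwarz:
  assumes f: "bdd_fun f" and g: "bdd_fun g"
  shows "(mip f g)\<^sup>2 \<le> mip f f * mip g g"
proof (rule quadratic_nonneg_imp)
  fix t
  have *: "mip (\<lambda>x. f x + t * g x) h = mip f h + t * mip g h" if "bdd_fun h" for h
    using f g that by (simp add: mip_add_left mip_scale_left bdd_fun_scale)
  have u: "bdd_fun (\<lambda>x. f x + t * g x)" using f g by (intro bdd_fun_add bdd_fun_scale)
  have "0 \<le> mip (\<lambda>x. f x + t * g x) (\<lambda>x. f x + t * g x)" by (rule mip_nonneg)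
  also have "\<dots> = mip (\<lambda>x. f x + t * g x) f + t * mip (\<lambda>x. f x + t * g x) g"
    unfolding *[OF u] by (simp add: mip_commute)
  also have "\<dots> = mip f f + 2 * t * mip f g + t\<^sup>2 * mip g g"
    unfolding *[OF f] *[OF g] by (simp add: mip_commute[of g f] power2_eq_square algebra_simps)
  finally show "0 \<le> mip f f + 2 * t * mip f g + t\<^sup>2 * mip g g" .
qed (rule mip_nonneg)

lemma mip_le_energy: assumes "f \<in> H10" shows "mip f f \<le> measure \<nu> UNIV * energy_form f f"
proof -
  have "\<bar>f x\<bar> \<le> sqrt (energy_form f f)" for x
    using H10_bound[OF assms, of x] by (simp add: real_le_rsqrt)
  from mip_abs_le[OF bdd_fun_H10[OF assms] bdd_fun_H10[OF assms] this this]
  show ?thesis using energy_form_nonneg[OF assms] by (simp add: mult.commute)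
qed

section \<open>Upper bounds for the counting function\<close>

lemma subspace_eigenspace: "fun_vs.subspace (eigenspace \<nu> l)"
proof (rule fun_vs.subspaceI)
  show "0 \<in> eigenspace \<nu> l"
  proof -
    have "bdd_fun (\<lambda>x. 0)" by (auto simp: bdd_fun_def)
    from dom_form_scale[OF green_dom[OF this], of 0] have "(\<lambda>x. 0) \<in> dom_form \<nu>" by simp
    then show ?thesis by (auto simp: eigenspace_def zero_fun_def energy_form_zero_left dom_form_H10)
  qed
next
  fix f g assume fg: "f \<in> eigenspace \<nu> l" "g \<in> eigenspace \<nu> l"
  then have "(\<lambda>x. f x + g x) \<in> dom_form \<nu>" by (intro dom_form_add) (auto simp: eigenspace_def)
  moreover have "energy_form (\<lambda>x. f x + g x) h = l * mip (\<lambda>x. f x + g x) h" if "h \<in> dom_form \<nu>" for h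
    using that fg eigenspace_H10[OF fg(1)] eigenspace_H10[OF fg(2)]
    by (simp add: energy_form_add_left mip_add_left bdd_fun_H10 dom_form_H10 eigenspace_energy algebra_simps)
  ultimately show "f + g \<in> eigenspace \<nu> l"
    by (simp add: eigenspace_def plus_fun_def mip_def)
next
  fix c f assume f: "f \<in> eigenspace \<nu> l"
  then have "(\<lambda>x. c * f x) \<in> dom_form \<nu>" by (intro dom_form_scale) (auto simp: eigenspace_def)
  moreover have "energy_form (\<lambda>x. c * f x) h = l * mip (\<lambda>x. c * f x) h" if "h \<in> dom_form \<nu>" for h
    using that f eigenspace_H10[OF f]
    by (simp add: energy_form_scale_left mip_scale_left dom_form_H10 eigenspace_energy)
  ultimately show "(\<lambda>x. c * f x) \<in> eigenspace \<nu> l"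
    by (simp add: eigenspace_def mip_def)
qed

lemma eigenspace_orthogonal:
  assumes "f \<in> eigenspace \<nu> l" "g \<in> eigenspace \<nu> l'" "l \<noteq> l'"
  shows "energy_form f g = 0" "mip f g = 0"
proof -
  have "energy_form f g = l * mip f g" "energy_form g f = l' * mip g f"
    using assms eigenspace_energy eigenspace_H10 by blast+
  then show "mip f g = 0" "energy_form f g = 0"
    using assms(3) by (auto simp: energy_form_commute[of g] mip_commute[of g])
qed

text \<open>The terms belonging to one eigenvalue are collected in \<open>u l\<close>. Distinct
  eigenspaces are orthogonal for both forms, so both are diagonal in the \<open>u l\<close>. If the
  combination vanishes, each \<open>u l\<close> has energy 0, and independence within the single
  eigenspaces finishes the argument.\<close>

lemma eigen_combination:
  assumes L: "finite L" "\<And>l. l \<in> L \<Longrightarrow> l \<le> x"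
    and B: "\<And>l. l \<in> L \<Longrightarrow> finite (B l)" "\<And>l. l \<in> L \<Longrightarrow> B l \<subseteq> eigenspace \<nu> l"
      "\<And>l. l \<in> L \<Longrightarrow> fun_vs.independent (B l)"
  defines "f \<equiv> \<lambda>a z. \<Sum>(l, b)\<in>Sigma L B. a (l, b) * b z"
  shows "f a \<in> H10" "energy_form (f a) (f a) \<le> x * mip (f a) (f a)"
    "f a = (\<lambda>z. 0) \<Longrightarrow> p \<in> Sigma L B \<Longrightarrow> a p = 0"
proof -
  define u where "u l = (\<lambda>z. \<Sum>b\<in>B l. a (l, b) * b z)" for l
  have fu: "f a = (\<lambda>z. \<Sum>l\<in>L. u l z)"
    unfolding f_def u_def using L B by (subst sum.Sigma[symmetric]) auto
  have ue: "u l \<in> eigenspace \<nu> l" if l: "l \<in> L" for l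
  proof -
    have "(\<Sum>b\<in>B l. (\<lambda>z. a (l, b) * b z)) \<in> eigenspace \<nu> l"
      using B(2)[OF l] fun_vs.subspace_scale[OF subspace_eigenspace]
      by (intro fun_vs.subspace_sum[OF subspace_eigenspace]) blast
    moreover have "(\<Sum>b\<in>B l. (\<lambda>z. a (l, b) * b z)) = u l"
      by (auto simp: fun_eq_iff u_def sum_fun_apply_real)
    ultimately show ?thesis by simp
  qed
  then have uH: "u l \<in> H10" if "l \<in> L" for l using eigenspace_H10 that by blast
  show H: "f a \<in> H10" unfolding fu using uH by (rule H10_sum)
  have e1: "energy_form (u l) (f a) = energy_form (u l) (u l)" "mip (u l) (f a) = mip (u l) (u l)" if l: "l \<in> L" for l
  proof -
    have "energy_form (u l) (f a) = (\<Sum>k\<in>L. energy_form (u l) (u k))"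
      unfolding fu using uH l by (intro energy_form_sum_right) auto
    also have "\<dots> = (\<Sum>k\<in>L. if k = l then energy_form (u l) (u l) else 0)"
      by (intro sum.cong refl) (use eigenspace_orthogonal(1)[OF ue ue] l in auto)
    finally show "energy_form (u l) (f a) = energy_form (u l) (u l)" using l L by simp
    have "mip (f a) (u l) = (\<Sum>k\<in>L. mip (u k) (u l))"
      unfolding fu using uH l by (intro mip_sum_left) (auto intro: bdd_fun_H10)
    also have "\<dots> = (\<Sum>k\<in>L. if k = l then mip (u l) (u l) else 0)"
      by (intro sum.cong refl) (use eigenspace_orthogonal(2)[OF ue ue] l in auto)
    finally show "mip (u l) (f a) = mip (u l) (u l)" using l L by (simp add: mip_commute)
  qed
  have E: "energy_form (f a) (f a) = (\<Sum>l\<in>L. energy_form (u l) (u l))"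
  proof -
    have "energy_form (\<lambda>z. \<Sum>l\<in>L. u l z) (f a) = (\<Sum>l\<in>L. energy_form (u l) (f a))"
      using uH H by (intro energy_form_sum_left) auto
    then show ?thesis using e1 by (simp add: fu[symmetric])
  qed
  have M: "mip (f a) (f a) = (\<Sum>l\<in>L. mip (u l) (u l))"
  proof -
    have "mip (\<lambda>z. \<Sum>l\<in>L. u l z) (f a) = (\<Sum>l\<in>L. mip (u l) (f a))"
      using uH H by (intro mip_sum_left) (auto intro: bdd_fun_H10)
    then show ?thesis using e1 by (simp add: fu[symmetric])
  qed
  have "energy_form (u l) (u l) \<le> x * mip (u l) (u l)" if l: "l \<in> L" for l
    using eigenspace_energy[OF ue[OF l] uH[OF l]] L(2)[OF l] mip_nonneg[of "u l"]
    by (simp add: mult_right_mono)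
  then show "energy_form (f a) (f a) \<le> x * mip (f a) (f a)"
    unfolding E M sum_distrib_left by (intro sum_mono)
  assume z: "f a = (\<lambda>z. 0)" and p: "p \<in> Sigma L B"
  obtain l b where lb: "p = (l, b)" "l \<in> L" "b \<in> B l" using p by auto
  have "energy_form (u l) (u l) = 0"
    using e1(1)[OF lb(2)] energy_form_zero_left[OF uH[OF lb(2)]] unfolding z energy_form_commute[of "u l" "\<lambda>z. 0"] by simp
  then have "u l = (\<lambda>z. 0)" using H10_eq_zero uH lb by blast
  moreover have "(\<Sum>b\<in>B l. (\<lambda>z. a (l, b) * b z)) = u l"
    by (rule ext) (simp add: u_def sum_fun_apply_real)
  ultimately have "(\<Sum>b\<in>B l. (\<lambda>z. a (l, b) * b z)) = 0"
    unfolding zero_fun_def by (rule trans[rotated])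
  then have "fun_vs.dependent (B l)" if "a (l, b) \<noteq> 0"
    unfolding fun_vs.dependent_finite[OF B(1)[OF lb(2)]]
    using that lb(3) by (intro exI[of _ "\<lambda>b. a (l, b)"] conjI bexI[of _ b])
  then have "a (l, b) = 0"
    using B(3)[OF lb(2)] by blast
  then show "a p = 0" using lb by simp
qed

text \<open>With more eigenfunctions than points, a nontrivial combination vanishes on
  \<open>P\<close>. Its energy is then at most \<open>x\<close> times its mass, and also strictly
  larger.\<close>

lemma eigen_family_card_le:
  assumes P: "finite P" "\<And>f. f \<in> H10 \<Longrightarrow> (\<And>p. p \<in> P \<Longrightarrow> f p = 0) \<Longrightarrow> f \<noteq> (\<lambda>x. 0) \<Longrightarrow> x * mip f f < energy_form f f"
    and L: "finite L" "\<And>l. l \<in> L \<Longrightarrow> l \<le> x"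
    and B: "\<And>l. l \<in> L \<Longrightarrow> finite (B l)" "\<And>l. l \<in> L \<Longrightarrow> B l \<subseteq> eigenspace \<nu> l"
      "\<And>l. l \<in> L \<Longrightarrow> fun_vs.independent (B l)"
  shows "card (Sigma L B) \<le> card P"
proof (rule ccontr)
  assume "\<not> ?thesis"
  then obtain a where a: "\<exists>j\<in>Sigma L B. a j \<noteq> 0" "\<forall>p\<in>P. (\<Sum>j\<in>Sigma L B. a j * (snd j) p) = 0"
    using homogeneous_system[of P "Sigma L B" "\<lambda>p j. snd j p"] P L B by (auto simp: not_le)
  let ?f = "\<lambda>z. \<Sum>(l, b)\<in>Sigma L B. a (l, b) * b z"
  have "?f p = 0" if "p \<in> P" for p
    using a(2) that by (auto simp: case_prod_unfold)
  moreover have "?f \<noteq> (\<lambda>x. 0)" using eigen_combination(3)[OF L B, of a] a(1) by blast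
  moreover have "?f \<in> H10" "energy_form ?f ?f \<le> x * mip ?f ?f"
    using eigen_combination(1,2)[OF L B, of a] by auto
  ultimately show False using P(2)[of ?f] by fastforce
qed

definition finite_basis :: "(real \<Rightarrow> real) set \<Rightarrow> (real \<Rightarrow> real) set \<Rightarrow> bool" where
  "finite_basis B V \<longleftrightarrow> finite B \<and> B \<subseteq> V \<and> fun_vs.independent B \<and> V \<subseteq> fun_vs.span B \<and>
     card B = fun_vs.dim V"

text \<open>Finiteness has to come before counting, since an infinite sum or the dimension of an
  infinite-dimensional space would count as 0. An infinite set of eigenvalues, or an infinite basis
  of one eigenspace, would contain \<open>Suc (card P)\<close> elements and violate the same
  bound.\<close>

lemma eigenvalue_count_le_gen:
  assumes P: "finite P" "\<And>f. f \<in> H10 \<Longrightarrow> (\<And>p. p \<in> P \<Longrightarrow> f p = 0) \<Longrightarrow> f \<noteq> (\<lambda>x. 0) \<Longrightarrow> x * mip f f < energy_form f f"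
  shows "finite {l. is_eigenvalue \<nu> l \<and> l \<le> x}"
    "\<And>l. l \<le> x \<Longrightarrow> \<exists>B. finite_basis B (eigenspace \<nu> l)"
    "eigenvalue_count \<nu> x \<le> card P"
proof -
  show fin: "finite {l. is_eigenvalue \<nu> l \<and> l \<le> x}"
  proof (rule ccontr)
    assume "\<not> ?thesis"
    then obtain L where L: "L \<subseteq> {l. is_eigenvalue \<nu> l \<and> l \<le> x}" "finite L" "card L = Suc (card P)"
      using infinite_arbitrarily_large by metis
    then have "\<forall>l\<in>L. \<exists>f. f \<in> eigenspace \<nu> l \<and> f \<noteq> (\<lambda>x. 0)"
      by (auto simp: is_eigenvalue_def)
    then obtain b where b: "\<And>l. l \<in> L \<Longrightarrow> b l \<in> eigenspace \<nu> l \<and> b l \<noteq> (\<lambda>x. 0)" by metis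
    have "card (SIGMA l:L. {b l}) \<le> card P"
    proof (rule eigen_family_card_le[OF P L(2)])
      show "fun_vs.independent {b l}" if "l \<in> L" for l
        using b[OF that] by (auto simp: fun_vs.dependent_single zero_fun_def)
    qed (use L b in auto)
    then show False using L by simp
  qed
  show basis: "\<exists>B. finite_basis B (eigenspace \<nu> l)" if l: "l \<le> x" for l
  proof -
    obtain B where B: "B \<subseteq> eigenspace \<nu> l" "fun_vs.independent B" "eigenspace \<nu> l \<subseteq> fun_vs.span B"
       "card B = fun_vs.dim (eigenspace \<nu> l)" using fun_vs.basis_exists by metis
    have "finite B"
    proof (rule ccontr)
      assume "infinite B"
      then obtain B' where B': "B' \<subseteq> B" "finite B'" "card B' = Suc (card P)"
        using infinite_arbitrarily_large by metis
      have "card (SIGMA k:{l}. B') \<le> card P"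
        using B B' l fun_vs.independent_mono[OF B(2) B'(1)] by (intro eigen_family_card_le[OF P]) auto
      then show False using B' by simp
    qed
    then show ?thesis unfolding finite_basis_def using B by blast
  qed
  obtain B where "\<And>l. l \<le> x \<Longrightarrow> finite_basis (B l) (eigenspace \<nu> l)"
    using basis by metis
  note B = this[unfolded finite_basis_def]
  let ?L = "{l. is_eigenvalue \<nu> l \<and> l \<le> x}"
  have "eigenvalue_count \<nu> x = card (Sigma ?L B)"
    unfolding eigenvalue_count_def using B fin by (subst card_SigmaI) auto
  also have "\<dots> \<le> card P"
    using B fin by (intro eigen_family_card_le[OF P]) auto
  finally show "eigenvalue_count \<nu> x \<le> card P" .
qed

text \<open>On an interval whose left end point is a zero of \<open>f\<close>, the square of
  \<open>f\<close> is at most the length times the energy there. Integration against \<nu> turns the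
  length into mass times length, at most \<open>c\<close>, and the energies of disjoint intervals
  add up to no more than the whole. One zero per interval is imposed, so the number of conditions is
  the number of intervals.\<close>

lemma partition_bound:
  fixes I :: "(real \<times> real) set"
  assumes I: "finite I" "disjoint_family_on (\<lambda>(a, b). {a<..b}) I"
    and ab: "\<And>a b. (a, b) \<in> I \<Longrightarrow> 0 \<le> a \<and> a \<le> b \<and> b \<le> 1 \<and> measure \<nu> {a<..b} * (b - a) \<le> c"
    and cov: "{0<..<1} \<subseteq> (\<Union>(a, b)\<in>I. {a<..b})"
    and f: "f \<in> H10" "\<And>a b. (a, b) \<in> I \<Longrightarrow> f a = 0"
  shows "mip f f \<le> c * energy_form f f"
proof -
  obtain g where g: "h1_grad f g" using f by (auto simp: H10_iff)
  have g2: "integrable lborel (\<lambda>t. (g t)\<^sup>2)" using g by (simp add: h1_grad_def)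
  define J where "J = (\<lambda>p::real \<times> real. {fst p<..snd p})"
  define e where "e p = (LINT t|lborel. indicator (J p) t * (g t)\<^sup>2)" for p
  have e0: "0 \<le> e p" for p unfolding e_def by (rule integral_nonneg_AE) auto
  have Jint: "integrable lborel (\<lambda>t. indicator (J p) t * (g t)\<^sup>2)" for p
    by (rule integrable_indicator_mult[OF _ g2]) (auto simp: J_def)
  have dis: "(\<Sum>p\<in>I. indicator (J p) t :: real) \<le> 1" for t
  proof -
    have "(\<Sum>p\<in>I. indicator (J p) t :: real) = indicator (\<Union>p\<in>I. J p) t"
      using I by (intro indicator_UN_disjoint[symmetric]) (auto simp: J_def case_prod_unfold)
    then show ?thesis by (simp add: indicator_def)
  qed
  have pt: "f x * f x \<le> (\<Sum>p\<in>I. indicator (J p) x * ((snd p - fst p) * e p))" if x: "x \<in> {0<..<1}" for x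
  proof -
    obtain p where p: "p \<in> I" "x \<in> J p" using cov x by (fastforce simp: J_def case_prod_unfold)
    have "(f x - f (fst p))\<^sup>2 \<le> (x - fst p) * e p"
      unfolding e_def J_def using p ab[of "fst p" "snd p"] by (intro h1_grad_local[OF g]) (auto simp: J_def)
    then have "f x * f x \<le> (x - fst p) * e p" using f(2)[of "fst p" "snd p"] p by (simp add: power2_eq_square)
    also have "\<dots> \<le> (snd p - fst p) * e p" using p e0 by (intro mult_right_mono) (auto simp: J_def)
    also have "\<dots> = indicator (J p) x * ((snd p - fst p) * e p)" using p by simp
    also have "\<dots> \<le> (\<Sum>p\<in>I. indicator (J p) x * ((snd p - fst p) * e p))"
      using p I e0 ab by (intro member_le_sum) (auto intro!: mult_nonneg_nonneg)
    finally show ?thesis .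
  qed
  have mI: "integrable \<nu> (\<lambda>x. indicator (J p) x * d)" for p and d :: real
    by (intro integrable_bounded[of _ "\<bar>d\<bar>"]) (auto simp: J_def indicator_def)
  have "mip f f \<le> (\<integral>x. (\<Sum>p\<in>I. indicator (J p) x * ((snd p - fst p) * e p)) \<partial>\<nu>)"
    unfolding mip_def
  proof (rule integral_mono_AE)
    show "AE x in \<nu>. f x * f x \<le> (\<Sum>p\<in>I. indicator (J p) x * ((snd p - fst p) * e p))"
      using AE_unit by eventually_elim (rule pt)
  qed (use mI f bdd_fun_H10[OF f(1)] bdd_fun_mult_integrable in auto)
  also have "\<dots> = (\<Sum>p\<in>I. measure \<nu> (J p) * ((snd p - fst p) * e p))"
    using mI by (subst Bochner_Integration.integral_sum) auto
  also have "\<dots> \<le> (\<Sum>p\<in>I. c * e p)"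
  proof (rule sum_mono)
    fix p assume p: "p \<in> I"
    have "measure \<nu> (J p) * ((snd p - fst p) * e p) = (measure \<nu> (J p) * (snd p - fst p)) * e p" by simp
    also have "\<dots> \<le> c * e p" using ab[of "fst p" "snd p"] p e0 by (intro mult_right_mono) (auto simp: J_def)
    finally show "measure \<nu> (J p) * ((snd p - fst p) * e p) \<le> c * e p" .
  qed
  also have "\<dots> = c * (LINT t|lborel. (\<Sum>p\<in>I. indicator (J p) t * (g t)\<^sup>2))"
    using Jint by (simp add: e_def sum_distrib_left)
  also have "\<dots> \<le> c * (LINT t|lborel. (g t)\<^sup>2)"
  proof (rule mult_left_mono)
    show "(LINT t|lborel. (\<Sum>p\<in>I. indicator (J p) t * (g t)\<^sup>2)) \<le> (LINT t|lborel. (g t)\<^sup>2)"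
      using Jint g2 dis mult_right_mono[OF dis, of "(g t)\<^sup>2" t for t]
      by (intro integral_mono) (auto simp: sum_distrib_right)
    have "I \<noteq> {}" using cov by fastforce
    then obtain a b where "(a, b) \<in> I" by auto
    from ab[OF this] show "0 \<le> c" by (meson diff_ge_0_iff_ge measure_nonneg mult_nonneg_nonneg order_trans)
  qed
  also have "(LINT t|lborel. (g t)\<^sup>2) = energy_form f f" by (simp add: energy_form_eq[OF g g] power2_eq_square)
  finally show ?thesis .
qed

lemma eigenvalue_count_le:
  fixes I :: "(real \<times> real) set"
  assumes I: "finite I" "disjoint_family_on (\<lambda>(a, b). {a<..b}) I"
    and ab: "\<And>a b. (a, b) \<in> I \<Longrightarrow> 0 \<le> a \<and> a \<le> b \<and> b \<le> 1 \<and> measure \<nu> {a<..b} * (b - a) \<le> c"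
    and cov: "{0<..<1} \<subseteq> (\<Union>(a, b)\<in>I. {a<..b})" and c: "c * x < 1" "0 \<le> x"
  shows "finite {l. is_eigenvalue \<nu> l \<and> l \<le> x}"
    "\<And>l. l \<le> x \<Longrightarrow> \<exists>B. finite_basis B (eigenspace \<nu> l)"
    "eigenvalue_count \<nu> x \<le> card I"
proof -
  have 1: "x * mip f f < energy_form f f" if f: "f \<in> H10" "\<And>p. p \<in> fst ` I \<Longrightarrow> f p = 0" "f \<noteq> (\<lambda>x. 0)" for f
  proof -
    have "mip f f \<le> c * energy_form f f"
      using f by (intro partition_bound[OF I ab cov]) force+
    then have "x * mip f f \<le> (c * x) * energy_form f f" using c(2) by (metis mult.assoc mult.commute mult_left_mono)
    also have "\<dots> < 1 * energy_form f f"
      using c(1) energy_form_nonneg[OF f(1)] H10_eq_zero[OF f(1)] f(3) by (intro mult_strict_right_mono) auto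
    finally show ?thesis by simp
  qed
  have fin: "finite (fst ` I)" using I by simp
  note * = eigenvalue_count_le_gen[OF fin 1]
  show "finite {l. is_eigenvalue \<nu> l \<and> l \<le> x}"
    "\<And>l. l \<le> x \<Longrightarrow> \<exists>B. finite_basis B (eigenspace \<nu> l)"
    using * by blast+
  have "eigenvalue_count \<nu> x \<le> card (fst ` I)" using * by blast
  also have "\<dots> \<le> card I" using I by (rule_tac card_image_le)
  finally show "eigenvalue_count \<nu> x \<le> card I" .
qed

end

lemma abs_less_of_power2:
  fixes a b :: real
  assumes "a\<^sup>2 < b\<^sup>2" "0 \<le> b"
  shows "\<bar>a\<bar> < b"
  using power2_less_imp_less[of "\<bar>a\<bar>" b] assms by simp

context unit_interval_measure
begin

section \<open>Lower bounds for the counting function\<close>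

text \<open>The Rayleigh quotient is maximised over \<open>K\<close>. For a normalised maximising sequence \<open>F n\<close> the
  energy of \<open>green (F n) - m F n\<close> tends to 0, and \<open>green\<close> turns the uniform convergence of a subsequence
  (Arzela--Ascoli) into convergence in energy. Hence the limit stays in \<open>K\<close>, without
  any appeal to weak compactness.\<close>

lemma ex_eigenfunction:
  assumes S: "S \<subseteq> H10"
  defines "K \<equiv> {f \<in> H10. \<forall>w\<in>S. energy_form f w = 0}"
  assumes inv: "\<And>f. f \<in> K \<Longrightarrow> green f \<in> K" and pos: "\<exists>f\<in>K. mip f f > 0"
  shows "\<exists>m>0. \<exists>f\<in>K. f \<noteq> (\<lambda>x. 0) \<and> green f = (\<lambda>x. m * f x) \<and> (\<forall>h\<in>K. mip h h \<le> m * energy_form h h)"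
proof -
  have KH: "f \<in> H10" if "f \<in> K" for f using that by (simp add: K_def)
  have Kb: "bdd_fun f" if "f \<in> K" for f using bdd_fun_H10 KH that by blast
  have Kscale: "(\<lambda>x. c * f x) \<in> K" if "f \<in> K" for c f
    using that S by (auto simp: K_def H10_scale energy_form_scale_left)
  have Kdiff: "(\<lambda>x. f x - g x) \<in> K" if "f \<in> K" "g \<in> K" for f g
    using that S by (auto simp: K_def H10_diff energy_form_diff_left)
  define R where "R = {mip f f | f. f \<in> K \<and> energy_form f f = 1}"
  define m where "m = Sup R"
  have Es: "energy_form (\<lambda>x. c * f x) (\<lambda>x. c * f x) = c\<^sup>2 * energy_form f f" if "f \<in> H10" for c f
    using energy_form_lincomb[OF that that, of c 0] by simp
  have Bs: "mip (\<lambda>x. c * f x) (\<lambda>x. c * f x) = c\<^sup>2 * mip f f" for c f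
  proof -
    have "mip f (\<lambda>x. c * f x) = c * mip f f"
      using mip_scale_left[of c f f] mip_commute[of f "\<lambda>x. c * f x"] by linarith
    then show ?thesis by (simp add: mip_scale_left power2_eq_square)
  qed
  have norm1: "mip f f / energy_form f f \<in> R" if f: "f \<in> K" "f \<noteq> (\<lambda>x. 0)" for f
  proof -
    have E: "energy_form f f > 0" using energy_form_nonneg[OF KH[OF f(1)]] H10_eq_zero[OF KH[OF f(1)]] f(2) by force
    let ?c = "1 / sqrt (energy_form f f)"
    have c2: "?c\<^sup>2 = 1 / energy_form f f" using E by (simp add: power_divide)
    show ?thesis unfolding R_def
      using Kscale[OF f(1), of ?c] Es[OF KH[OF f(1)], of ?c] Bs[of ?c f] E
      by (intro CollectI exI[of _ "\<lambda>x. ?c * f x"]) (simp add: c2)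
  qed
  have bdd: "bdd_above R"
    unfolding R_def bdd_above_def using mip_le_energy KH by (intro exI[of _ "measure \<nu> UNIV"]) force
  have le: "mip h h \<le> m * energy_form h h" if h: "h \<in> K" for h
  proof (cases "h = (\<lambda>x. 0)")
    case True then show ?thesis by (simp add: mip_def energy_form_zero_left H10_zero)
  next
    case False
    then have "mip h h / energy_form h h \<le> m" unfolding m_def using norm1[OF h] bdd by (intro cSup_upper) auto
    moreover have "energy_form h h > 0" using energy_form_nonneg[OF KH[OF h]] H10_eq_zero[OF KH[OF h]] False by force
    ultimately show ?thesis by (simp add: field_simps)
  qed
  obtain f1 where f1: "f1 \<in> K" "mip f1 f1 > 0" using pos by blast
  have m0: "m > 0"
    using le[OF f1(1)] f1(2) energy_form_nonneg[OF KH[OF f1(1)]] by (smt (verit) mult_nonneg_nonneg mult_nonpos_nonneg)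
  have "f1 \<noteq> (\<lambda>x. 0)" using f1 by (auto simp: mip_def)
  then have Rne: "R \<noteq> {}" using norm1[OF f1(1)] by auto
  have "\<exists>f. f \<in> K \<and> energy_form f f = 1 \<and> m - 1 / real (Suc n) < mip f f" for n
    using less_cSupD[OF Rne, of "m - 1 / real (Suc n)"] unfolding m_def R_def by auto
  then obtain F where F: "\<And>n. F n \<in> K" "\<And>n. energy_form (F n) (F n) = 1" "\<And>n. m - 1 / real (Suc n) < mip (F n) (F n)"
    by metis
  have Fle: "\<bar>F n x\<bar> \<le> 1" for n x
    using H10_bound[OF KH[OF F(1)], of n x] F(2)[of n] by (simp add: abs_square_le_1)
  have cpt: "compact {0..1::real}" by simp
  obtain \<phi> k where \<phi>: "continuous_on {0..1} \<phi>" "strict_mono (k :: nat \<Rightarrow> nat)"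
    "\<And>e. 0 < e \<Longrightarrow> \<exists>N. \<forall>n x. n \<ge> N \<and> x \<in> {0..1::real} \<longrightarrow> norm (F (k n) x - \<phi> x :: real) < e"
  proof (rule Arzela_Ascoli[OF cpt, of F 1])
    show "norm (F n x) \<le> 1" if "x \<in> {0..1}" for n x using Fle[of n x] by simp
    fix x e :: real assume x: "x \<in> {0..1}" and e: "0 < e"
    \<comment> \<open>Unit energy gives a Hoelder bound with exponent 1/2 common to all
      \<open>F n\<close>, whence \<open>e\<^sup>2\<close> as modulus of continuity.\<close>
    have "norm (F n x - F n y) < e" if y: "y \<in> {0..1} \<and> norm (x - y) < e\<^sup>2" for n y
    proof -
      have "(F n x - F n y)\<^sup>2 < e\<^sup>2"
        using H10_holder[OF KH[OF F(1)], of y x n] x y F(2)[of n] by (auto simp: abs_minus_commute)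
      then show ?thesis using e abs_less_of_power2[of "F n x - F n y" e] by simp
    qed
    then show "\<exists>d. 0 < d \<and> (\<forall>n y. y \<in> {0..1} \<and> norm (x - y) < d \<longrightarrow> norm (F n x - F n y) < e)"
      using e by (intro exI[of _ "e\<^sup>2"]) auto
  qed (use that in blast)
  define f where "f x = (if x \<in> {0..1} then \<phi> x else 0)" for x
  have unif: "\<exists>N. \<forall>n\<ge>N. \<forall>x. \<bar>F (k n) x - f x\<bar> \<le> e" if "e > 0" for e
  proof -
    obtain N where N: "\<forall>n x. n \<ge> N \<and> x \<in> {0..1} \<longrightarrow> norm (F (k n) x - \<phi> x) < e" using \<phi>(3)[OF \<open>e > 0\<close>] by blast
    have "\<bar>F (k n) x - f x\<bar> \<le> e" if "n \<ge> N" for n x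
      using N[rule_format, of n x] that \<open>e > 0\<close> KH[OF F(1)[of "k n"]] by (cases "x \<in> {0..1}") (auto simp: f_def H10_iff)
    then show ?thesis by blast
  qed
  have fle: "\<bar>f x\<bar> \<le> 2" for x
  proof -
    obtain N where "\<forall>n\<ge>N. \<forall>x. \<bar>F (k n) x - f x\<bar> \<le> 1" using unif[of 1] by auto
    then have "\<bar>F (k N) x - f x\<bar> \<le> 1" by blast
    then show ?thesis using Fle[of "k N" x] by linarith
  qed
  have fb: "bdd_fun f"
  proof -
    have "continuous_on {0..1} f" using \<phi>(1) by (rule continuous_on_cong[THEN iffD1, rotated 2]) (auto simp: f_def)
    then have "f \<in> borel_measurable borel" by (rule measurable_zero_outside) (auto simp: f_def)
    moreover have "\<forall>x. x \<notin> {0..1} \<longrightarrow> f x = 0" by (simp add: f_def)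
    ultimately show ?thesis using fle unfolding bdd_fun_def by blast
  qed
  have gf: "green f \<in> H10" using green_H10[OF fb] .
  define M where "M = measure \<nu> UNIV"
  have M0: "M \<ge> 0" by (simp add: M_def)
  have mk: "m - 1 / real (Suc n) < mip (F (k n)) (F (k n))" for n
  proof -
    have "1 / real (Suc (k n)) \<le> 1 / real (Suc n)" using seq_suble[OF \<phi>(2), of n] by (simp add: frac_le)
    then show ?thesis using F(3)[of "k n"] by linarith
  qed
  have mle: "mip (F n) (F n) \<le> m" for n using le[OF F(1), of n] F(2) by simp
  \<comment> \<open>The function is \<open>green (f - F)\<close> plus \<open>green F - m F\<close>,
    and the parallelogram law bounds its energy by twice the sum of theirs. The first is controlled
    by the uniform distance \<open>e\<close>, the second by the distance of \<open>F\<close> from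
    the maximum.\<close>
  have small: "energy_form (\<lambda>x. green f x - m * F (k n) x) (\<lambda>x. green f x - m * F (k n) x) \<le> 2 * (e * M * (e * M)) * 2 + 4 * (m * (1 / real (Suc n)))"
    if e: "\<And>x. \<bar>F (k n) x - f x\<bar> \<le> e" for n e
  proof -
    let ?F = "F (k n)"
    note FK = F(1)[of "k n"]
    let ?u = "\<lambda>x. f x - ?F x"
    have ub: "bdd_fun ?u" using fb Kb[OF FK] by (rule bdd_fun_diff)
    have ue: "\<And>x. \<bar>?u x\<bar> \<le> e" using e by (simp add: abs_minus_commute)
    have gF: "green ?F \<in> H10" using green_H10[OF Kb[OF FK]] .
    have gu: "green ?u \<in> H10" using green_H10[OF ub] .
    have E1: "energy_form (green ?u) (green ?u) \<le> e * M * (e * M)"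
    proof -
      have "energy_form (green ?u) (green ?u) = mip ?u (green ?u)" by (rule energy_green[OF ub gu])
      also have "\<dots> \<le> e * (e * M) * M"
        using mip_abs_le[OF ub bdd_fun_H10[OF gu] ue, of "e * M"] green_abs_le[OF ub ue] unfolding M_def by fastforce
      finally show ?thesis by (simp add: mult_ac)
    qed
    let ?d = "\<lambda>x. 1 * green ?F x + (- m) * ?F x"
    have dH: "?d \<in> H10" using gF KH[OF FK] by (intro H10_add H10_scale)
    \<comment> \<open>Write T for this energy, which is \<open>mip F (green F)\<close>.
      Cauchy--Schwarz and the maximality of \<open>m\<close>, applied both to \<open>F\<close> and
      to \<open>green F\<close> in \<open>K\<close>, give T^2 <= m^2 T.\<close>
    have ET: "energy_form (green ?F) (green ?F) \<le> m\<^sup>2"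
    proof -
      let ?T = "energy_form (green ?F) (green ?F)"
      have "?T = mip ?F (green ?F)" by (rule energy_green[OF Kb[OF FK] gF])
      then have "?T\<^sup>2 \<le> mip ?F ?F * mip (green ?F) (green ?F)"
        using mip_Cauchy_Schwarz[OF Kb[OF FK] Kb[OF inv[OF FK]]] by simp
      also have "\<dots> \<le> m * (m * ?T)"
        using mle le[OF inv[OF FK]] m0 mip_nonneg by (intro mult_mono) auto
      finally have "?T * ?T \<le> m\<^sup>2 * ?T" by (simp add: power2_eq_square mult.assoc)
      then show ?thesis using energy_form_nonneg[OF gF] m0
        by (cases "?T = 0") (auto simp: mult_le_cancel_right)
    qed
    have "energy_form ?d ?d = energy_form (green ?F) (green ?F) - 2 * m * mip ?F ?F + m\<^sup>2"
      using energy_form_lincomb[OF gF KH[OF FK], of 1 "- m"] energy_green[OF Kb[OF FK] KH[OF FK]] F(2) by simp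
    also have "\<dots> \<le> 2 * (m * (1 / real (Suc n)))"
    proof -
      have "m * (m - mip ?F ?F) \<le> m * (1 / real (Suc n))" using mk[of n] m0 by (intro mult_left_mono) auto
      moreover have "T - 2 * m * B + m\<^sup>2 \<le> 2 * r" if "T \<le> m\<^sup>2" "m * (m - B) \<le> r" for T B r :: real
        using that by (simp add: power2_eq_square algebra_simps)
      ultimately show ?thesis using ET by blast
    qed
    finally have E2: "energy_form ?d ?d \<le> 2 * (m * (1 / real (Suc n)))" .
    have "(\<lambda>x. green f x - m * ?F x) = (\<lambda>x. 1 * green ?u x + 1 * ?d x)"
      using green_diff[OF fb Kb[OF FK]] by (auto simp: fun_eq_iff)
    then have sq: "energy_form (\<lambda>x. green f x - m * ?F x) (\<lambda>x. green f x - m * ?F x) =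
        energy_form (green ?u) (green ?u) + 2 * energy_form (green ?u) ?d + energy_form ?d ?d"
      using energy_form_lincomb[OF gu dH, of 1 1] by simp
    have "0 \<le> energy_form (\<lambda>x. 1 * green ?u x + (- 1) * ?d x) (\<lambda>x. 1 * green ?u x + (- 1) * ?d x)"
      by (intro energy_form_nonneg H10_add H10_scale gu dH)
    then have pos: "0 \<le> energy_form (green ?u) (green ?u) - 2 * energy_form (green ?u) ?d + energy_form ?d ?d"
      unfolding energy_form_lincomb[OF gu dH] by simp
    have "X \<le> 2 * c * 2 + 4 * r" if "X = A + 2 * B + D" "0 \<le> A - 2 * B + D" "A \<le> c" "D \<le> 2 * r" "0 \<le> c"
      for X A B D c r :: real
      using that by linarith
    from this[OF sq pos E1 E2] show ?thesis by simp
  qed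
  have lim0: "\<exists>N. \<forall>n\<ge>N. energy_form (\<lambda>x. green f x - m * F (k n) x) (\<lambda>x. green f x - m * F (k n) x) < \<epsilon>" if "\<epsilon> > 0" for \<epsilon>
  proof -
    define e where "e = sqrt (\<epsilon> / 16) / (M + 1)"
    have e0: "e > 0" using that M0 by (simp add: e_def)
    have "e * M \<le> sqrt (\<epsilon> / 16)"
      using that M0 by (simp add: e_def divide_simps mult_left_mono)
    then have "(e * M)\<^sup>2 \<le> (sqrt (\<epsilon> / 16))\<^sup>2" using e0 M0 by (intro power_mono) auto
    then have eM: "e * M * (e * M) \<le> \<epsilon> / 16" using that by (simp add: power2_eq_square)
    obtain N1 where N1: "\<forall>n\<ge>N1. \<forall>x. \<bar>F (k n) x - f x\<bar> \<le> e" using unif[OF e0] by blast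
    obtain N2 where N2: "real N2 > 8 * m / \<epsilon>" using reals_Archimedean2 by blast
    have "energy_form (\<lambda>x. green f x - m * F (k n) x) (\<lambda>x. green f x - m * F (k n) x) < \<epsilon>" if n: "n \<ge> max N1 N2" for n
    proof -
      have "8 * m / \<epsilon> < real (Suc n)" using N2 n by simp
      then have "4 * (m * (1 / real (Suc n))) < \<epsilon> / 2" using \<open>\<epsilon> > 0\<close> by (simp add: field_simps)
      then show ?thesis using small[of n e] N1 n eM \<open>\<epsilon> > 0\<close> by force
    qed
    then show ?thesis by blast
  qed
  have hH: "(\<lambda>x. green f x - m * F (k n) x) \<in> H10" for n
    using gf KH[OF F(1)] by (intro H10_diff H10_scale)
  have gfx: "green f x = m * f x" for x
  proof (rule ccontr)
    assume ne: "green f x \<noteq> m * f x"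
    define d where "d = \<bar>green f x - m * f x\<bar>"
    have d0: "d > 0" using ne by (simp add: d_def)
    obtain N1 where N1: "\<forall>n\<ge>N1. energy_form (\<lambda>x. green f x - m * F (k n) x) (\<lambda>x. green f x - m * F (k n) x) < (d/2)\<^sup>2"
      using lim0[of "(d/2)\<^sup>2"] d0 by auto
    obtain N2 where N2: "\<forall>n\<ge>N2. \<forall>x. \<bar>F (k n) x - f x\<bar> \<le> d / (2 * m)" using unif[of "d / (2*m)"] d0 m0 by auto
    define n where "n = max N1 N2"
    have "(green f x - m * F (k n) x)\<^sup>2 < (d/2)\<^sup>2"
      using H10_bound[OF hH[of n], of x] N1 by (metis (no_types, lifting) le_less_trans max.cobounded1 n_def)
    then have 1: "\<bar>green f x - m * F (k n) x\<bar> < d/2" using d0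
      by (intro abs_less_of_power2) auto
    have "\<bar>F (k n) x - f x\<bar> \<le> d / (2 * m)" using N2 by (simp add: n_def)
    then have "m * \<bar>F (k n) x - f x\<bar> \<le> d / 2" using m0 by (simp add: field_simps)
    then have "\<bar>m * F (k n) x - m * f x\<bar> \<le> d / 2" using m0 by (simp add: abs_mult right_diff_distrib[symmetric])
    moreover have "d \<le> \<bar>green f x - m * F (k n) x\<bar> + \<bar>m * F (k n) x - m * f x\<bar>"
      using abs_triangle_ineq[of "green f x - m * F (k n) x" "m * F (k n) x - m * f x"] by (simp add: d_def)
    ultimately show False using 1 by linarith
  qed
  have feq: "f = (\<lambda>x. (1/m) * green f x)" using gfx m0 by (auto simp: fun_eq_iff)
  have fH: "f \<in> H10" by (subst feq) (intro H10_scale gf)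
  \<comment> \<open>As \<open>F (k N)\<close> is orthogonal to \<open>w\<close>, the energy product
    of \<open>w\<close> with \<open>green f - m F (k N)\<close> equals
    \<open>m * energy_form f w\<close> for every N. The energy of that function tends to 0, so
    Cauchy--Schwarz leaves only the value 0.\<close>
  have fw: "energy_form f w = 0" if w: "w \<in> S" for w
  proof (rule ccontr)
    assume ne: "energy_form f w \<noteq> 0"
    have wH: "w \<in> H10" using w S by blast
    have Ew: "energy_form w w > 0"
      using ne energy_form_Cauchy_Schwarz[OF fH wH] energy_form_nonneg[OF wH] by (cases "energy_form w w = 0") auto
    define d where "d = (m * energy_form f w)\<^sup>2 / energy_form w w"
    have "d > 0" using Ew ne m0 by (simp add: d_def)
    then obtain N where "energy_form (\<lambda>x. green f x - m * F (k N) x) (\<lambda>x. green f x - m * F (k N) x) < d" using lim0 by blast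
    then have "energy_form (\<lambda>x. green f x - m * F (k N) x) (\<lambda>x. green f x - m * F (k N) x) * energy_form w w < (m * energy_form f w)\<^sup>2"
      using Ew by (simp add: d_def field_simps)
    moreover have "energy_form (\<lambda>x. green f x - m * F (k N) x) w = m * energy_form f w"
    proof -
      have "(\<lambda>x. green f x - m * F (k N) x) = (\<lambda>x. m * f x - m * F (k N) x)" using gfx by simp
      then show ?thesis
        using F(1)[of "k N"] w wH fH KH[OF F(1)]
        by (simp add: energy_form_diff_left energy_form_scale_left H10_scale K_def)
    qed
    ultimately show False using energy_form_Cauchy_Schwarz[OF hH[of N] wH] by simp
  qed
  have fK: "f \<in> K" using fH fw by (simp add: K_def)
  \<comment> \<open>Otherwise \<open>F (k n)\<close> would be uniformly small and its
    \<open>mip\<close> at most \<open>m / 2\<close>, against the convergence of \<open>mip\<close>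
    to \<open>m > 0\<close>.\<close>
  have "f \<noteq> (\<lambda>x. 0)"
  proof
    assume z: "f = (\<lambda>x. 0)"
    obtain N1 where N1: "\<forall>n\<ge>N1. \<forall>x. \<bar>F (k n) x - f x\<bar> \<le> m / (2 * (M + 1))" using unif[of "m / (2 * (M+1))"] m0 M0 by auto
    obtain N2 where N2: "real N2 > 2 / m" using reals_Archimedean2 by blast
    define n where "n = max N1 N2"
    have "\<bar>F (k n) x\<bar> \<le> m / (2 * (M + 1))" for x using N1 z by (simp add: n_def)
    then have "\<bar>mip (F (k n)) (F (k n))\<bar> \<le> m / (2 * (M + 1)) * 1 * M"
      unfolding M_def by (intro mip_abs_le Kb F Fle)
    also have "\<dots> \<le> m / 2" using M0 m0 by (simp add: field_simps)
    finally have "mip (F (k n)) (F (k n)) \<le> m / 2" by simp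
    moreover have "1 / real (Suc n) \<le> m / 2"
    proof -
      have "2 / m < real (Suc n)" using N2 by (simp add: n_def)
      then show ?thesis using m0 by (simp add: field_simps)
    qed
    ultimately show False using mk[of n] by linarith
  qed
  then show ?thesis using fK gfx m0 le by (intro exI[of _ m] conjI bexI[of _ f]) auto
qed

text \<open>Equal pieces of length 1/n with n larger than \<open>x\<close> times the total mass.
  This crude partition serves to know, before the lower bound is proved, that only finitely many
  eigenvalues lie below \<open>x\<close> and that their eigenspaces are finite-dimensional.\<close>

lemma ex_uniform_partition:
  assumes "0 \<le> x"
  shows "\<exists>I c. finite I \<and> disjoint_family_on (\<lambda>(a, b). {a<..b}) I \<and>
    (\<forall>a b. (a, b) \<in> I \<longrightarrow> 0 \<le> a \<and> a \<le> b \<and> b \<le> 1 \<and> measure \<nu> {a<..b} * (b - a) \<le> c) \<and>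
    {0<..<1} \<subseteq> (\<Union>(a, b)\<in>I. {a<..b}) \<and> c * x < (1::real)"
proof -
  obtain n :: nat where n: "real n > measure \<nu> UNIV * x" using reals_Archimedean2 by blast
  then have n0: "n > 0" using assms by (smt (verit) measure_nonneg mult_nonneg_nonneg of_nat_0_less_iff)
  define J where "J k = (real k / real n, (real k + 1) / real n)" for k
  define I where "I = J ` {..<n}"
  have bd: "0 \<le> real k / real n \<and> real k / real n \<le> (real k + 1) / real n \<and> (real k + 1) / real n \<le> 1 \<and>
      measure \<nu> {real k / real n<..(real k + 1) / real n} * ((real k + 1) / real n - real k / real n) \<le> measure \<nu> UNIV * (1 / real n)"
    if "k < n" for k
  proof -
    have e: "(real k + 1) / real n - real k / real n = 1 / real n" using n0 by (simp add: field_simps)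
    have "measure \<nu> {real k / real n<..(real k + 1) / real n} \<le> measure \<nu> UNIV"
      by (intro finite_measure_mono) auto
    then have "measure \<nu> {real k / real n<..(real k + 1) / real n} * (1 / real n) \<le> measure \<nu> UNIV * (1 / real n)"
      by (intro mult_right_mono) auto
    then show ?thesis unfolding e using that n0 by (auto simp: divide_simps)
  qed
  have dis: "{fst (J i)<..snd (J i)} \<inter> {fst (J k)<..snd (J k)} = {}" if "i < k" for i k
  proof -
    have "(real i + 1) / real n \<le> real k / real n" using that by (intro divide_right_mono) auto
    then show ?thesis by (auto simp: J_def)
  qed
  show ?thesis
  proof (intro exI[of _ I] exI[of _ "measure \<nu> UNIV * (1 / real n)"] conjI allI impI)
    show "finite I" by (simp add: I_def)
    show "disjoint_family_on (\<lambda>(a, b). {a<..b}) I"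
      unfolding disjoint_family_on_def I_def
    proof (intro ballI impI)
      fix p q assume "p \<in> J ` {..<n}" "q \<in> J ` {..<n}" "p \<noteq> q"
      then obtain i k where ik: "p = J i" "q = J k" "i \<noteq> k" by blast
      then have "{fst p<..snd p} \<inter> {fst q<..snd q} = {}"
        using dis[of i k] dis[of k i] by (cases i k rule: linorder_cases) auto
      then show "(case p of (a, b) \<Rightarrow> {a<..b}) \<inter> (case q of (a, b) \<Rightarrow> {a<..b}) = {}"
        by (simp add: case_prod_unfold)
    qed
    show "{0<..<1} \<subseteq> (\<Union>(a, b)\<in>I. {a<..b})"
    proof
      fix x :: real assume x: "x \<in> {0<..<1}"
      define k where "k = nat (\<lceil>x * real n\<rceil> - 1)"
      have pos: "0 < x * real n" "x * real n < real n" using x n0 by auto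
      then have "1 \<le> \<lceil>x * real n\<rceil>" by linarith
      then have k: "real k = real_of_int \<lceil>x * real n\<rceil> - 1" by (simp add: k_def)
      have "real k < x * real n" "x * real n \<le> real k + 1" unfolding k by linarith+
      then have "x \<in> {fst (J k)<..snd (J k)}" using n0 by (auto simp: J_def field_simps)
      moreover have "k < n" using \<open>real k < x * real n\<close> pos by linarith
      ultimately show "x \<in> (\<Union>(a, b)\<in>I. {a<..b})" unfolding I_def by (auto simp: case_prod_unfold)
    qed
    show "measure \<nu> UNIV * (1 / real n) * x < 1" using n n0 by (simp add: field_simps)
  qed (use bd in \<open>auto simp: I_def J_def\<close>)
qed

text \<open>If the count were smaller than \<open>card J\<close>, some nontrivial \<open>f\<close>
  in the span would be energy-orthogonal to all eigenfunctions for eigenvalues up to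
  \<open>x\<close>. Maximising the Rayleigh quotient over the orthogonal complement \<open>K\<close>
  produces an eigenfunction in \<open>K\<close>; since \<open>f\<close> competes, its eigenvalue
  \<open>1 / m\<close> is at most \<open>x\<close>. It is thus orthogonal to itself.\<close>

lemma eigenvalue_count_ge:
  fixes v :: "'j \<Rightarrow> real \<Rightarrow> real"
  assumes J: "finite J" and v: "\<And>j. j \<in> J \<Longrightarrow> v j \<in> H10" and x: "x > 0"
    and le: "\<And>a. energy_form (\<lambda>z. \<Sum>j\<in>J. a j * v j z) (\<lambda>z. \<Sum>j\<in>J. a j * v j z) \<le>
       x * mip (\<lambda>z. \<Sum>j\<in>J. a j * v j z) (\<lambda>z. \<Sum>j\<in>J. a j * v j z)"
    and pos: "\<And>a. \<exists>j\<in>J. a j \<noteq> 0 \<Longrightarrow> mip (\<lambda>z. \<Sum>j\<in>J. a j * v j z) (\<lambda>z. \<Sum>j\<in>J. a j * v j z) > 0"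
  shows "card J \<le> eigenvalue_count \<nu> x"
proof (rule ccontr)
  assume less: "\<not> card J \<le> eigenvalue_count \<nu> x"
  obtain I c where I: "finite I" "disjoint_family_on (\<lambda>(a, b). {a<..b}) I"
    "\<And>a b. (a, b) \<in> I \<Longrightarrow> 0 \<le> a \<and> a \<le> b \<and> b \<le> 1 \<and> measure \<nu> {a<..b} * (b - a) \<le> c"
    "{0<..<1} \<subseteq> (\<Union>(a, b)\<in>I. {a<..b})" "c * x < (1::real)"
    using ex_uniform_partition[of x] x by auto
  note fin = eigenvalue_count_le(1)[OF I] and bas = eigenvalue_count_le(2)[OF I]
  define L where "L = {l. is_eigenvalue \<nu> l \<and> l \<le> x}"
  have fL: "finite L" using fin x by (simp add: L_def)
  obtain B where "\<And>l. l \<le> x \<Longrightarrow> finite_basis (B l) (eigenspace \<nu> l)"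
    using bas x by (metis less_imp_le)
  note B = this[unfolded finite_basis_def]
  have "eigenvalue_count \<nu> x = card (Sigma L B)"
    unfolding eigenvalue_count_def using B fL by (subst card_SigmaI) (auto simp: L_def)
  moreover have fS: "finite (Sigma L B)" using fL B by (intro finite_SigmaI) (auto simp: L_def)
  ultimately obtain a where a: "\<exists>j\<in>J. a j \<noteq> 0" "\<forall>p\<in>Sigma L B. (\<Sum>j\<in>J. a j * energy_form (v j) (snd p)) = 0"
    using homogeneous_system[OF fS J, of "\<lambda>p j. energy_form (v j) (snd p)"] less by auto
  define f where "f = (\<lambda>z. \<Sum>j\<in>J. a j * v j z)"
  have fH: "f \<in> H10" unfolding f_def using v by (intro H10_sum H10_scale) auto
  have fb0: "energy_form f b = 0" if "l \<in> L" "b \<in> B l" for l b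
  proof -
    have bH: "b \<in> H10" using that B[of l] eigenspace_H10 by (auto simp: L_def)
    have "energy_form f b = (\<Sum>j\<in>J. energy_form (\<lambda>z. a j * v j z) b)"
      unfolding f_def using v bH by (intro energy_form_sum_left) (auto intro: H10_scale)
    also have "\<dots> = (\<Sum>j\<in>J. a j * energy_form (v j) b)"
      using v bH by (intro sum.cong) (auto simp: energy_form_scale_left)
    finally show ?thesis using a(2) that by force
  qed
  define S where "S = (\<Union>l\<in>L. eigenspace \<nu> l)"
  define K where "K = {f \<in> H10. \<forall>w\<in>S. energy_form f w = 0}"
  have SH: "S \<subseteq> H10" by (auto simp: S_def eigenspace_H10)
  have fK: "f \<in> K"
  proof -
    have "energy_form f w = 0" if l: "l \<in> L" and w: "w \<in> eigenspace \<nu> l" for l w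
    proof -
      have "w \<in> fun_vs.span (B l)" using B[of l] l w by (auto simp: L_def)
      then have "w \<in> H10 \<and> energy_form f w = 0"
      proof (induction rule: fun_vs.span_induct_alt)
        case base then show ?case using H10_zero energy_form_zero_left[OF fH] by (simp add: zero_fun_def energy_form_commute)
      next
        case (step c b y)
        then have bH: "b \<in> H10" using B[of l] l eigenspace_H10 by (auto simp: L_def)
        have "energy_form (\<lambda>x. c * b x + y x) f = c * energy_form b f + energy_form y f"
          using bH step fH by (simp add: energy_form_add_left energy_form_scale_left H10_scale)
        then show ?case using step fb0[OF l, of b] bH by (simp add: plus_fun_def H10_add H10_scale energy_form_commute)
      qed
      then show ?thesis by simp
    qed
    then show ?thesis using fH by (auto simp: K_def S_def)
  qed
  have inv: "green h \<in> K" if h: "h \<in> K" for h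
  proof -
    have hb: "bdd_fun h" using h bdd_fun_H10 by (simp add: K_def)
    have "energy_form (green h) w = 0" if w: "w \<in> S" for w
    proof -
      obtain l where l: "l \<in> L" "w \<in> eigenspace \<nu> l" using w by (auto simp: S_def)
      have wH: "w \<in> H10" using w SH by auto
      have "energy_form w h = l * mip w h" using h eigenspace_energy[OF l(2)] by (simp add: K_def)
      moreover have "energy_form h w = 0" using h w unfolding K_def by blast
      ultimately have "l * mip w h = 0" using energy_form_commute[of w h] by linarith
      \<comment> \<open>The value 0 is no eigenvalue, because the energy is definite.\<close>
      moreover have "mip w h = 0" if "l = 0"
      proof -
        have "energy_form w w = 0" using eigenspace_energy[OF l(2) wH] that by simp
        then have "w = (\<lambda>x. 0)" using H10_eq_zero[OF wH] by simp
        then show ?thesis by (simp add: mip_def)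
      qed
      ultimately show ?thesis using energy_green[OF hb wH] by (auto simp: mip_commute)
    qed
    then show ?thesis using green_H10[OF hb] by (simp add: K_def)
  qed
  have fpos: "mip f f > 0" unfolding f_def using pos a(1) by blast
  obtain m h where m: "m > 0" "h \<in> K" "h \<noteq> (\<lambda>x. 0)" "green h = (\<lambda>x. m * h x)" "\<forall>h\<in>K. mip h h \<le> m * energy_form h h"
    using ex_eigenfunction[OF SH, folded K_def] inv fK fpos by blast
  have hH: "h \<in> H10" using m by (simp add: K_def)
  have E: "energy_form f f > 0"
    using m(1,5) fK fpos by (smt (verit, best) mult_nonneg_nonpos)
  have "energy_form f f \<le> x * (m * energy_form f f)"
    using le[of a, folded f_def] m(5) fK x by (smt (verit, best) mult_left_mono)
  then have "1 / m \<le> x" using E m(1) by (simp add: field_simps)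
  moreover have "h \<in> eigenspace \<nu> (1 / m)"
  proof -
    have h: "h = (\<lambda>x. (1/m) * green h x)" using m by (simp add: fun_eq_iff)
    have "h \<in> dom_form \<nu>" by (subst h) (intro dom_form_scale green_dom bdd_fun_H10 hH)
    moreover have "energy_form h g = (1 / m) * mip h g" if "g \<in> dom_form \<nu>" for g
    proof -
      have "energy_form h g = energy_form (\<lambda>x. (1/m) * green h x) g" using h by simp
      also have "\<dots> = (1 / m) * energy_form (green h) g"
        using that by (intro energy_form_scale_left green_H10 bdd_fun_H10 hH) (simp add: dom_form_H10)
      also have "energy_form (green h) g = mip h g"
        using that by (intro energy_green bdd_fun_H10 hH) (simp add: dom_form_H10)
      finally show ?thesis .
    qed
    ultimately show ?thesis by (simp add: eigenspace_def mip_def)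
  qed
  ultimately have "h \<in> S" using m(3) by (auto simp: S_def L_def is_eigenvalue_def)
  then have "energy_form h h = 0" using m(2) by (simp add: K_def)
  then show False using H10_eq_zero[OF hH] m(3) by simp
qed

end

lemma integrable_indicator_Ioc: "integrable lborel (indicat_real {a<..b::real})"
  by (cases "a \<le> b") auto

context unit_interval_measure
begin

section \<open>Tent functions\<close>

text \<open>The graph is a trapezoid: it climbs with slope 2^n over the left neighbour of
  \<open>dyadic n k\<close>, stays at 1 on \<open>dyadic n k\<close> and descends over the right
  neighbour. The plateau is what makes the lower estimate in L2(\<nu>) immediate.\<close>

definition tent_grad :: "nat \<Rightarrow> nat \<Rightarrow> real \<Rightarrow> real" where
  "tent_grad n k t = 2 ^ n * (indicator {(real k - 1) / 2 ^ n <.. real k / 2 ^ n} t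
     - indicator {(real k + 1) / 2 ^ n <.. (real k + 2) / 2 ^ n} t)"

definition tent :: "nat \<Rightarrow> nat \<Rightarrow> real \<Rightarrow> real" where
  "tent n k x = (if x \<in> {0..1} then LINT t|lborel. indicator {..x} t * tent_grad n k t else 0)"

lemma tent_eq:
  assumes "x \<in> {0..1}"
  shows "tent n k x = max 0 (min 1 (2 ^ n * x - (real k - 1))) - max 0 (min 1 (2 ^ n * x - (real k + 1)))"
proof -
  have l: "(LINT t|lborel. indicat_real {..x} t * indicator {c<..d} t) = max 0 (min d x - c)" if "c \<le> d" for c d
  proof -
    have "(\<lambda>t. indicat_real {..x} t * indicator {c<..d} t) = indicator {c<..min d x}"
      by (auto simp: indicator_def fun_eq_iff)
    then show ?thesis by (cases "c \<le> min d x") auto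
  qed
  have i: "integrable lborel (\<lambda>t. indicat_real {..x} t * indicator {c<..d} t)" for c d
    by (rule integrable_indicator_mult) (auto intro!: integrable_indicator_Ioc)
  have m: "2 ^ n * max 0 (min ((c + 1) / 2 ^ n) x - c / 2 ^ n) = max 0 (min 1 (2 ^ n * x - c))" for c :: real
    by (auto simp: max_def min_def field_simps)
  have "tent n k x = 2 ^ n * (LINT t|lborel. indicat_real {..x} t * indicator {(real k - 1) / 2 ^ n <.. real k / 2 ^ n} t
     - indicat_real {..x} t * indicator {(real k + 1) / 2 ^ n <.. (real k + 2) / 2 ^ n} t)"
    using assms unfolding tent_def tent_grad_def
    by (simp flip: integral_mult_right_zero add: algebra_simps)
  also have "\<dots> = 2 ^ n * (max 0 (min (real k / 2 ^ n) x - (real k - 1) / 2 ^ n)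
      - max 0 (min ((real k + 2) / 2 ^ n) x - (real k + 1) / 2 ^ n))"
    using i by (subst Bochner_Integration.integral_diff) (simp_all add: l divide_right_mono)
  also have "\<dots> = max 0 (min 1 (2 ^ n * x - (real k - 1))) - max 0 (min 1 (2 ^ n * x - (real k + 1)))"
    using m[of "real k - 1"] m[of "real k + 1"] by (simp add: right_diff_distrib add.commute)
  finally show ?thesis .
qed

text \<open>The conditions on \<open>k\<close> keep both neighbouring intervals inside [0,1]; they
  exclude just the first and the last interval of the level.\<close>

lemma h1_grad_tent:
  assumes "1 \<le> k" "k + 2 \<le> 2 ^ n"
  shows "h1_grad (tent n k) (tent_grad n k)"
proof -
  have r: "real k + 2 \<le> 2 ^ n" using assms(2) by (metis of_nat_add of_nat_le_iff of_nat_numeral of_nat_power)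
  then have e: "(real k + 2) / 2 ^ n \<le> 1" "real k / 2 ^ n \<le> 1" using assms(2) by (simp_all add: divide_le_eq)
  have e0: "0 \<le> (real k - 1) / 2 ^ n" "0 \<le> (real k + 1) / 2 ^ n" using assms(1) by simp_all
  have ind0: "indicat_real {c<..d} t = 0" if "0 \<le> c" "d \<le> 1" "t \<notin> {0..1}" for c d t :: real
    using that by (auto simp: indicator_def)
  have z: "tent_grad n k t = 0" if "t \<notin> {0..1}" for t
    unfolding tent_grad_def using ind0[OF e0(1) e(2) that] ind0[OF e0(2) e(1) that] by simp
  have m: "tent_grad n k \<in> borel_measurable lborel" unfolding tent_grad_def by measurable
  have "integrable lborel (\<lambda>x. (tent_grad n k x)\<^sup>2)"
  proof (rule Bochner_Integration.integrable_bound[where f="\<lambda>x. (2 ^ n)\<^sup>2 * indicat_real {0..1} x"])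
    have "(tent_grad n k x)\<^sup>2 \<le> (2 ^ n)\<^sup>2" for x
      unfolding tent_grad_def by (auto simp: indicator_def power_mult_distrib)
    then show "AE x in lborel. norm ((tent_grad n k x)\<^sup>2) \<le> norm ((2 ^ n)\<^sup>2 * indicat_real {0..1} x)"
      using z by (intro AE_I2) (auto simp: indicator_def)
  qed (use m in auto)
  then show ?thesis using m z by (auto simp: h1_grad_def tent_def)
qed

lemma tent_H10:
  assumes "1 \<le> k" "k + 2 \<le> 2 ^ n"
  shows "tent n k \<in> H10"
proof -
  have r: "real k + 2 \<le> 2 ^ n" using assms(2) by (metis of_nat_add of_nat_le_iff of_nat_numeral of_nat_power)
  have "tent n k 0 = 0" "tent n k 1 = 0" using assms(1) r by (auto simp: tent_eq)
  then show ?thesis using h1_grad_tent[OF assms] by (auto simp: H10_iff tent_def)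
qed

lemma tent_dyadic:
  assumes "x \<in> dyadic n i" "x \<in> {0..1}" "i = k \<or> i + 3 \<le> k \<or> k + 3 \<le> i"
  shows "tent n k x = (if i = k then 1 else 0)"
proof -
  have "real i < 2 ^ n * x" "2 ^ n * x \<le> real i + 1"
    using assms(1) by (auto simp: dyadic_def field_simps)
  then show ?thesis using assms(2,3) by (auto simp: tent_eq)
qed

text \<open>Each tent occupies three adjacent intervals, so indices at distance at least 3 give a
  diagonal energy. Two flanks of length 2^(-n) with squared slope 4^n contribute
  \<open>2 * 2 ^ n\<close> each time. A combination equals its coefficient \<open>a j\<close> on
  \<open>dyadic n j\<close>, and \<open>big\<close> compares the two forms term by term.\<close>

lemma eigenvalue_count_ge_sparse:
  assumes J: "\<And>k. k \<in> J \<Longrightarrow> 1 \<le> k \<and> k + 2 \<le> 2 ^ n" and sep: "\<And>i k. i \<in> J \<Longrightarrow> k \<in> J \<Longrightarrow> i < k \<Longrightarrow> i + 3 \<le> k"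
    and x: "x > 0" and big: "\<And>k. k \<in> J \<Longrightarrow> 2 * 2 ^ n \<le> x * measure \<nu> (dyadic n k)"
  shows "card J \<le> eigenvalue_count \<nu> x"
proof (rule eigenvalue_count_ge[where v="tent n"])
  show fin: "finite J" by (rule finite_subset[of _ "{..2 ^ n}"]) (use J in force)+
  show tH: "tent n k \<in> H10" if "k \<in> J" for k using J[OF that] tent_H10 by blast
  show "x > 0" by fact
  fix a :: "nat \<Rightarrow> real"
  let ?f = "\<lambda>z. \<Sum>j\<in>J. a j * tent n j z"
  have g: "h1_grad ?f (\<lambda>z. \<Sum>j\<in>J. a j * tent_grad n j z)"
    using J by (intro h1_grad_sum h1_grad_scale h1_grad_tent) auto
  have fH: "?f \<in> H10" using tH by (intro H10_sum H10_scale)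
  have sepJ: "i = k \<or> i + 3 \<le> k \<or> k + 3 \<le> i" if "i \<in> J" "k \<in> J" for i k
    using sep[of i k] sep[of k i] that by (cases i k rule: linorder_cases) auto
  have gi: "(LINT t|lborel. tent_grad n i t * tent_grad n k t) = (if i = k then 2 * 2 ^ n else 0)" if ik: "i \<in> J" "k \<in> J" for i k
  proof (cases "i = k")
    case True
    have "tent_grad n k t * tent_grad n k t = 4 ^ n * (indicator {(real k - 1) / 2 ^ n <.. real k / 2 ^ n} t
       + indicator {(real k + 1) / 2 ^ n <.. (real k + 2) / 2 ^ n} t)" for t
    proof -
      have "real k / 2 ^ n \<le> (real k + 1) / 2 ^ n" by (intro divide_right_mono) auto
      then have "indicat_real {(real k - 1) / 2 ^ n <.. real k / 2 ^ n} t * indicator {(real k + 1) / 2 ^ n <.. (real k + 2) / 2 ^ n} t = 0"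
        by (auto simp: indicator_def)
      moreover have "(2::real) ^ n * 2 ^ n = 4 ^ n" by (simp flip: power_mult_distrib)
      moreover have "(c * (u - v)) * (c * (u - v)) = d * (u + v)" if "u * v = 0" "c * c = d" "u * u = u" "v * v = v" for c d u v :: real
      proof -
        have "(c * (u - v)) * (c * (u - v)) = (c * c) * (u * u - 2 * (u * v) + v * v)" by (simp add: algebra_simps)
        then show ?thesis using that by simp
      qed
      ultimately show ?thesis unfolding tent_grad_def by (simp add: indicator_def)
    qed
    moreover have "(LINT t|lborel. 4 ^ n * (indicat_real {(real k - 1) / 2 ^ n <.. real k / 2 ^ n} t
       + indicator {(real k + 1) / 2 ^ n <.. (real k + 2) / 2 ^ n} t)) = 4 ^ n * (real k / 2 ^ n - (real k - 1) / 2 ^ n + ((real k + 2) / 2 ^ n - (real k + 1) / 2 ^ n))"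
      by (subst integral_mult_right_zero, subst Bochner_Integration.integral_add)
        (auto intro!: integrable_indicator_Ioc simp: divide_right_mono)
    moreover have "4 ^ n * (real k / 2 ^ n - (real k - 1) / 2 ^ n + ((real k + 2) / 2 ^ n - (real k + 1) / 2 ^ n)) = 2 * 2 ^ n"
    proof -
      have "(4::real) ^ n = 2 ^ n * 2 ^ n" by (simp flip: power_mult_distrib)
      then show ?thesis by (simp add: diff_divide_distrib add_divide_distrib algebra_simps)
    qed
    ultimately show ?thesis using True by simp
  next
    case False
    have "tent_grad n i t * tent_grad n k t = 0" for t
    proof -
      have mono: "c / 2 ^ n \<le> d / 2 ^ n" if "c \<le> d" for c d :: real using that by (intro divide_right_mono) auto
      have sup: "tent_grad n j t = 0 \<or> t \<in> {(real j - 1) / 2 ^ n <.. (real j + 2) / 2 ^ n}" for j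
        unfolding tent_grad_def using mono[of "real j" "real j + 2"] mono[of "real j - 1" "real j + 1"] by (auto simp: indicator_def)
      have "(real i + 2) / 2 ^ n \<le> (real k - 1) / 2 ^ n \<or> (real k + 2) / 2 ^ n \<le> (real i - 1) / 2 ^ n"
        using sepJ[OF ik] False mono[of "real i + 2" "real k - 1"] mono[of "real k + 2" "real i - 1"] by force
      then show ?thesis using sup[of i] sup[of k] by auto
    qed
    then have "(\<lambda>t. tent_grad n i t * tent_grad n k t) = (\<lambda>t. 0)" by (rule ext)
    then show ?thesis using False by simp
  qed
  have E: "energy_form ?f ?f = (\<Sum>j\<in>J. (a j)\<^sup>2 * (2 * 2 ^ n))"
  proof -
    have "energy_form ?f ?f = (\<Sum>i\<in>J. energy_form (\<lambda>z. a i * tent n i z) ?f)"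
      using tH fH by (intro energy_form_sum_left H10_scale)
    also have "\<dots> = (\<Sum>i\<in>J. \<Sum>k\<in>J. energy_form (\<lambda>z. a i * tent n i z) (\<lambda>z. a k * tent n k z))"
      using tH by (intro sum.cong refl energy_form_sum_right H10_scale)
    also have "\<dots> = (\<Sum>i\<in>J. \<Sum>k\<in>J. if i = k then (a i)\<^sup>2 * (2 * 2 ^ n) else 0)"
    proof (intro sum.cong refl)
      fix i k assume ik: "i \<in> J" "k \<in> J"
      have "energy_form (\<lambda>z. a i * tent n i z) (\<lambda>z. a k * tent n k z) = (LINT t|lborel. (a i * a k) * (tent_grad n i t * tent_grad n k t))"
      proof -
        have "h1_grad (\<lambda>z. a j * tent n j z) (\<lambda>t. a j * tent_grad n j t)" if "j \<in> J" for j
          using J[OF that] by (intro h1_grad_scale h1_grad_tent) auto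
        from energy_form_eq[OF this[OF ik(1)] this[OF ik(2)]]
        show ?thesis by (simp only: mult.assoc mult.left_commute)
      qed
      also have "\<dots> = a i * a k * (if i = k then 2 * 2 ^ n else 0)"
        by (simp only: integral_mult_right_zero gi[OF ik])
      finally show "energy_form (\<lambda>z. a i * tent n i z) (\<lambda>z. a k * tent n k z) = (if i = k then (a i)\<^sup>2 * (2 * 2 ^ n) else 0)"
        by (simp add: power2_eq_square)
    qed
    also have "\<dots> = (\<Sum>j\<in>J. (a j)\<^sup>2 * (2 * 2 ^ n))" using fin by (simp add: sum.delta)
    finally show ?thesis .
  qed
  have mI: "integrable \<nu> (\<lambda>z. indicator (dyadic n j) z * d)" for j and d :: real
    by (intro integrable_bounded[of _ "\<bar>d\<bar>"]) (auto simp: dyadic_def indicator_def)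
  have B: "(\<Sum>j\<in>J. measure \<nu> (dyadic n j) * (a j)\<^sup>2) \<le> mip ?f ?f"
  proof -
    have "(\<Sum>j\<in>J. measure \<nu> (dyadic n j) * (a j)\<^sup>2) = (\<integral>z. (\<Sum>j\<in>J. indicator (dyadic n j) z * (a j)\<^sup>2) \<partial>\<nu>)"
      using mI by (subst Bochner_Integration.integral_sum) auto
    also have "\<dots> \<le> mip ?f ?f"
      unfolding mip_def
    proof (rule integral_mono_AE)
      show "AE z in \<nu>. (\<Sum>j\<in>J. indicator (dyadic n j) z * (a j)\<^sup>2) \<le> ?f z * ?f z"
        using AE_unit
      proof eventually_elim
        case (elim z)
        show ?case
        proof (cases "\<exists>i\<in>J. z \<in> dyadic n i")
          case True
          then obtain i where i: "i \<in> J" "z \<in> dyadic n i" by blast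
          have t: "tent n k z = (if i = k then 1 else 0)" if "k \<in> J" for k
            using tent_dyadic[OF i(2) _ sepJ[OF i(1) that]] elim by auto
          have "?f z = (\<Sum>j\<in>J. if i = j then a i else 0)" using t by (intro sum.cong) auto
          then have f: "?f z = a i" using fin i by simp
          have d: "z \<notin> dyadic n k" if "k \<in> J" "k \<noteq> i" for k
          proof
            assume k: "z \<in> dyadic n k"
            have "tent n k z = 1" using tent_dyadic[OF k, of k] elim by auto
            then show False using t[OF that(1)] that(2) by simp
          qed
          have "(\<Sum>j\<in>J. indicator (dyadic n j) z * (a j)\<^sup>2) = (\<Sum>j\<in>J. if i = j then (a i)\<^sup>2 else 0)"
            using d i by (intro sum.cong) (auto simp: indicator_def)
          then show ?thesis using f fin i by (simp add: power2_eq_square)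
        next
          case False
          then have "(\<Sum>j\<in>J. indicator (dyadic n j) z * (a j)\<^sup>2) = 0" by (intro sum.neutral) (auto simp: indicator_def)
          then show ?thesis by simp
        qed
      qed
    qed (use mI bdd_fun_mult_integrable[OF bdd_fun_H10[OF fH] bdd_fun_H10[OF fH]] in auto)
    finally show ?thesis .
  qed
  have "energy_form ?f ?f \<le> x * (\<Sum>j\<in>J. measure \<nu> (dyadic n j) * (a j)\<^sup>2)"
    unfolding E sum_distrib_left
  proof (rule sum_mono)
    fix j assume "j \<in> J"
    from mult_left_mono[OF big[OF this], of "(a j)\<^sup>2"]
    show "(a j)\<^sup>2 * (2 * 2 ^ n) \<le> x * (measure \<nu> (dyadic n j) * (a j)\<^sup>2)" by (simp add: mult_ac)
  qed
  also have "\<dots> \<le> x * mip ?f ?f" using B x by simp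
  finally show "energy_form ?f ?f \<le> x * mip ?f ?f" .
  assume "\<exists>j\<in>J. a j \<noteq> 0"
  then obtain j where j: "j \<in> J" "a j \<noteq> 0" by blast
  have "x * measure \<nu> (dyadic n j) > 0" using big[OF j(1)] by (smt (verit) zero_less_power)
  then have "0 < measure \<nu> (dyadic n j)" using x by (simp add: zero_less_mult_iff)
  then have "0 < measure \<nu> (dyadic n j) * (a j)\<^sup>2" using j by simp
  also have "\<dots> \<le> (\<Sum>j\<in>J. measure \<nu> (dyadic n j) * (a j)\<^sup>2)"
    using fin j by (intro member_le_sum) auto
  finally show "mip ?f ?f > 0" using B by linarith
qed

text \<open>The residue classes modulo 3 are separated families, which explains the factor 3; the
  summand 2 pays for the two boundary intervals that carry no tent.\<close>

lemma eigenvalue_count_ge_dyadic: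
  assumes x: "x > 0"
  shows "card {k. k < 2 ^ n \<and> 2 * 2 ^ n \<le> x * measure \<nu> (dyadic n k)} \<le> 3 * eigenvalue_count \<nu> x + 2"
proof -
  let ?A = "{k. k < 2 ^ n \<and> 2 * 2 ^ n \<le> x * measure \<nu> (dyadic n k)}"
  let ?J = "\<lambda>r. {k \<in> ?A. 1 \<le> k \<and> k + 2 \<le> 2 ^ n \<and> k mod 3 = r}"
  have c: "card (?J r) \<le> eigenvalue_count \<nu> x" for r
  proof (rule eigenvalue_count_ge_sparse[OF _ _ x])
    fix i k assume "i \<in> ?J r" "k \<in> ?J r" "i < k"
    then have "i mod 3 = k mod 3" "i < k" by auto
    then show "i + 3 \<le> k" by presburger
  qed auto
  have "?A \<subseteq> {0, 2 ^ n - 1} \<union> (?J 0 \<union> ?J 1 \<union> ?J 2)"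
  proof
    fix k assume k: "k \<in> ?A"
    have "k mod 3 = 0 \<or> k mod 3 = 1 \<or> k mod 3 = 2" by presburger
    moreover have "k = 0 \<or> k = 2 ^ n - 1 \<or> (1 \<le> k \<and> k + 2 \<le> 2 ^ n)" using k by auto
    ultimately show "k \<in> {0, 2 ^ n - 1} \<union> (?J 0 \<union> ?J 1 \<union> ?J 2)" using k by auto
  qed
  then have "card ?A \<le> card ({0, 2 ^ n - 1} \<union> (?J 0 \<union> ?J 1 \<union> ?J 2))"
    by (intro card_mono) auto
  also have "\<dots> \<le> card {0, 2 ^ n - 1::nat} + (card (?J 0) + card (?J 1) + card (?J 2))"
    by (meson card_Un_le le_trans add_mono order_refl)
  also have "\<dots> \<le> 2 + (eigenvalue_count \<nu> x + eigenvalue_count \<nu> x + eigenvalue_count \<nu> x)"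
    using c by (intro add_mono) (auto simp: card_insert_if)
  finally show ?thesis by simp
qed

end

section \<open>The \<open>L\<^sup>q\<close>-spectrum\<close>

lemma dyadic_less_iff: "x \<in> dyadic n k \<longleftrightarrow> real k < 2 ^ n * x \<and> 2 ^ n * x \<le> real k + 1"
  by (auto simp: dyadic_def field_simps)

lemma dyadic_eqI: "x \<in> dyadic n i \<Longrightarrow> x \<in> dyadic n j \<Longrightarrow> i = j"
  unfolding dyadic_less_iff by linarith

lemma dyadic_nonempty: "(real k + 1) / 2 ^ n \<in> dyadic n k"
  by (simp add: dyadic_def divide_strict_right_mono)

lemma inj_dyadic: "inj (dyadic n)"
  by (rule injI) (metis dyadic_eqI dyadic_nonempty)

lemma dyadic_borel [measurable, simp]: "dyadic n k \<in> sets borel"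
  by (simp add: dyadic_def)

lemma ex_dyadic:
  assumes "x \<in> {0<..1}"
  shows "\<exists>k<2 ^ n. x \<in> dyadic n k"
proof -
  define k where "k = nat (\<lceil>2 ^ n * x\<rceil> - 1)"
  have pos: "0 < 2 ^ n * x" "2 ^ n * x \<le> 2 ^ n" using assms by auto
  then have "1 \<le> \<lceil>2 ^ n * x\<rceil>" by linarith
  then have k: "real k = real_of_int \<lceil>2 ^ n * x\<rceil> - 1" by (simp add: k_def)
  have "real k < 2 ^ n * x" "2 ^ n * x \<le> real k + 1" unfolding k by linarith+
  moreover have "k < 2 ^ n"
    using \<open>real k < 2 ^ n * x\<close> pos by (metis of_nat_less_iff of_nat_numeral of_nat_power order_less_le_trans)
  ultimately show ?thesis by (auto simp: dyadic_less_iff)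
qed

lemma dyadic_Suc: "x \<in> dyadic (Suc n) k \<Longrightarrow> x \<in> dyadic n (k div 2)"
proof -
  assume x: "x \<in> dyadic (Suc n) k"
  have "k = 2 * (k div 2) \<or> k = 2 * (k div 2) + 1" by presburger
  then have "real k = 2 * real (k div 2) \<or> real k = 2 * real (k div 2) + 1" by (metis of_nat_1 of_nat_add of_nat_mult of_nat_numeral)
  then show ?thesis using x by (auto simp: dyadic_less_iff)
qed

lemma limsup_less_iff_eventually:
  fixes f :: "nat \<Rightarrow> real"
  shows "limsup (\<lambda>n. ereal (f n)) < ereal x \<Longrightarrow> eventually (\<lambda>n. f n < x) sequentially"
  using Limsup_lessD by fastforce

context unit_interval_measure
begin

definition mass :: "nat \<Rightarrow> nat \<Rightarrow> real" where "mass n k = measure \<nu> (dyadic n k)"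
definition total :: real where "total = measure \<nu> UNIV"
definition pos_idx :: "nat \<Rightarrow> nat set" where "pos_idx n = {k. k < 2 ^ n \<and> mass n k > 0}"
definition psum :: "nat \<Rightarrow> real \<Rightarrow> real" where "psum n q = (\<Sum>k\<in>pos_idx n. mass n k powr q)"

lemma total_pos: "total > 0"
proof -
  have "measure \<nu> {0<..<1} \<noteq> 0" using nonzero by (simp add: emeasure_eq_measure)
  then have "0 < measure \<nu> {0<..<1}" by (simp add: zero_less_measure_iff)
  also have "\<dots> \<le> total" unfolding total_def by (intro finite_measure_mono) auto
  finally show ?thesis .
qed

lemma mass_nonneg [simp]: "mass n k \<ge> 0" by (simp add: mass_def)

lemma mass_le_total: "mass n k \<le> total"
  unfolding mass_def total_def by (intro finite_measure_mono) auto

lemma finite_pos_idx [simp]: "finite (pos_idx n)" by (simp add: pos_idx_def)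

lemma card_pos_idx: "card (pos_idx n) \<le> 2 ^ n"
proof -
  have "card (pos_idx n) \<le> card {..<2 ^ n::nat}" by (intro card_mono) (auto simp: pos_idx_def)
  then show ?thesis by simp
qed

lemma sum_mass: "(\<Sum>k<2 ^ n. mass n k) = total"
proof -
  have "(\<Sum>k<2 ^ n. mass n k) = measure \<nu> (\<Union>k<2 ^ n. dyadic n k)"
    unfolding mass_def
    by (intro finite_measure_finite_Union[symmetric]) (auto simp: disjoint_family_on_def dest: dyadic_eqI)
  also have "\<dots> = total"
    unfolding total_def
  proof (rule finite_measure_eq_AE)
    show "AE x in \<nu>. (x \<in> (\<Union>k<2 ^ n. dyadic n k)) = (x \<in> UNIV)"
      using AE_unit
    proof eventually_elim
      case (elim x)
      then show ?case using ex_dyadic[of x n] by auto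
    qed
  qed auto
  finally show ?thesis .
qed

lemma sum_pos_idx: "(\<Sum>k\<in>pos_idx n. mass n k) = total"
proof -
  have "(\<Sum>k\<in>pos_idx n. mass n k) = (\<Sum>k<2 ^ n. mass n k)"
    by (rule sum.mono_neutral_left) (auto simp: pos_idx_def less_le)
  then show ?thesis by (simp add: sum_mass)
qed

lemma pos_idx_nonempty: "pos_idx n \<noteq> {}"
  using sum_pos_idx[of n] total_pos by auto

lemma psum_pos: "psum n q > 0"
  unfolding psum_def using pos_idx_nonempty by (intro sum_pos) (auto simp: pos_idx_def)

lemma psum_neq_0 [simp]: "psum n q \<noteq> 0"
  using psum_pos[of n q] by simp

lemma beta_n_psum: "beta_n \<nu> n q = ln (psum n q) / (real n * ln 2)"
proof -
  have "(\<Sum>C\<in>dyadic_pos \<nu> n. measure \<nu> C powr q) = psum n q"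
  proof -
    have "dyadic_pos \<nu> n = dyadic n ` pos_idx n" by (auto simp: dyadic_pos_def pos_idx_def mass_def)
    then show ?thesis
      using inj_on_subset[OF inj_dyadic, of "pos_idx n" n] by (simp add: sum.reindex psum_def mass_def)
  qed
  then show ?thesis by (simp add: beta_n_def ln_realpow)
qed

lemma psum_beta_n: assumes "n \<ge> 1" shows "psum n q = 2 powr (real n * beta_n \<nu> n q)"
proof -
  have "ln (psum n q) = real n * beta_n \<nu> n q * ln 2" using assms by (simp add: beta_n_psum)
  then show ?thesis using psum_pos[of n q] by (metis exp_ln mult.commute powr_def zero_neq_numeral)
qed

lemma beta_n_0: "beta_n \<nu> n 0 = ln (real (card (pos_idx n))) / (real n * ln 2)"
proof -
  have "psum n 0 = real (card (pos_idx n))" unfolding psum_def by (simp add: pos_idx_def)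
  then show ?thesis by (simp add: beta_n_psum)
qed

lemma beta_n_1: "beta_n \<nu> n 1 = ln total / (real n * ln 2)"
proof -
  have "psum n 1 = total" unfolding psum_def using sum_pos_idx by (simp add: pos_idx_def)
  then show ?thesis by (simp add: beta_n_psum)
qed

text \<open>Hoelder's inequality, that is, log-convexity in the exponent, by Young's inequality for
  the two families of weights normalised to sum 1.\<close>

lemma psum_convex:
  assumes t: "0 \<le> t" "t \<le> 1"
  shows "psum n ((1 - t) * a + t * b) \<le> psum n a powr (1 - t) * psum n b powr t"
proof -
  have Za: "psum n a > 0" and Zb: "psum n b > 0" by (rule psum_pos)+
  have pw: "mass n k powr ((1 - t) * a + t * b) \<le> (psum n a powr (1 - t) * psum n b powr t) *
      ((1 - t) * (mass n k powr a / psum n a) + t * (mass n k powr b / psum n b))" if k: "k \<in> pos_idx n" for k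
  proof -
    have m: "mass n k > 0" using k by (simp add: pos_idx_def)
    have "(mass n k powr a / psum n a) powr (1 - t) * (mass n k powr b / psum n b) powr t \<le>
       (1 - t) * (mass n k powr a / psum n a) + t * (mass n k powr b / psum n b)"
      using t m Za Zb by (intro Youngs_inequality_0) auto
    moreover have "(mass n k powr a / psum n a) powr (1 - t) * (mass n k powr b / psum n b) powr t =
       mass n k powr ((1 - t) * a + t * b) / (psum n a powr (1 - t) * psum n b powr t)"
      using m Za Zb by (simp add: powr_divide powr_powr powr_add mult.commute)
    ultimately show ?thesis using Za Zb by (simp add: pos_divide_le_eq mult.commute)
  qed
  have "psum n ((1 - t) * a + t * b) \<le> (\<Sum>k\<in>pos_idx n. (psum n a powr (1 - t) * psum n b powr t) *
      ((1 - t) * (mass n k powr a / psum n a) + t * (mass n k powr b / psum n b)))"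
    unfolding psum_def[of n "(1 - t) * a + t * b"] by (intro sum_mono pw)
  also have "\<dots> = (psum n a powr (1 - t) * psum n b powr t) *
     ((1 - t) * (psum n a / psum n a) + t * (psum n b / psum n b))"
    unfolding psum_def by (simp only: sum_distrib_left[symmetric] sum.distrib sum_divide_distrib[symmetric])
  also have "\<dots> = psum n a powr (1 - t) * psum n b powr t" using Za Zb by simp
  finally show ?thesis .
qed

lemma beta_n_convex:
  assumes t: "0 \<le> t" "t \<le> 1"
  shows "beta_n \<nu> n ((1 - t) * a + t * b) \<le> (1 - t) * beta_n \<nu> n a + t * beta_n \<nu> n b"
proof (cases "n = 0")
  case False
  have Z: "psum n a > 0" "psum n b > 0" by (rule psum_pos)+
  have "ln (psum n ((1 - t) * a + t * b)) \<le> ln (psum n a powr (1 - t) * psum n b powr t)"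
    using psum_convex[OF t] psum_pos by (subst ln_le_cancel_iff) (use Z in auto)
  also have "\<dots> = (1 - t) * ln (psum n a) + t * ln (psum n b)"
    using Z by (simp add: ln_mult ln_powr)
  finally have "ln (psum n ((1 - t) * a + t * b)) / (real n * ln 2) \<le> ((1 - t) * ln (psum n a) + t * ln (psum n b)) / (real n * ln 2)"
    by (intro divide_right_mono) auto
  then show ?thesis by (simp add: beta_n_psum add_divide_distrib)
qed (simp add: beta_n_psum)

text \<open>A bound for the rate at which \<open>beta_n\<close> can increase in the exponent, caused
  by intervals of mass above 1. It is 0 if the total mass is at most 1.\<close>

definition slope_err :: "nat \<Rightarrow> real" where "slope_err n = ln (max total 1) / (real n * ln 2)"

lemma slope_err_nonneg: "slope_err n \<ge> 0" by (simp add: slope_err_def)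

lemma slope_err_tendsto: "slope_err \<longlonglongrightarrow> 0"
  unfolding slope_err_def by real_asymp

lemma slope_err_le: "slope_err n \<le> ln (max total 1) / ln 2"
proof (cases "n = 0")
  case False
  then have "ln (max total 1) / (real n * ln 2) \<le> ln (max total 1) / (1 * ln 2)"
    by (intro divide_left_mono mult_right_mono) auto
  then show ?thesis by (simp add: slope_err_def)
qed (simp add: slope_err_def)

lemma beta_n_mono:
  assumes "q \<le> q'"
  shows "beta_n \<nu> n q' \<le> beta_n \<nu> n q + (q' - q) * slope_err n"
proof (cases "n = 0")
  case False
  let ?T = "max total 1"
  have "psum n q' \<le> (\<Sum>k\<in>pos_idx n. mass n k powr q * ?T powr (q' - q))"
    unfolding psum_def
  proof (rule sum_mono)
    fix k assume "k \<in> pos_idx n"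
    have "mass n k powr q' = mass n k powr q * mass n k powr (q' - q)" by (simp add: powr_add[symmetric])
    also have "\<dots> \<le> mass n k powr q * ?T powr (q' - q)"
      using assms mass_le_total[of n k] by (intro mult_left_mono powr_mono2) auto
    finally show "mass n k powr q' \<le> mass n k powr q * ?T powr (q' - q)" .
  qed
  also have "\<dots> = psum n q * ?T powr (q' - q)" by (simp add: psum_def sum_distrib_right)
  finally have "ln (psum n q') \<le> ln (psum n q * ?T powr (q' - q))"
    using psum_pos by (subst ln_le_cancel_iff) auto
  also have "\<dots> = ln (psum n q) + (q' - q) * ln ?T"
    using psum_pos[of n q] by (subst ln_mult) (auto simp: ln_powr)
  finally have "ln (psum n q') / (real n * ln 2) \<le> (ln (psum n q) + (q' - q) * ln ?T) / (real n * ln 2)"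
    by (intro divide_right_mono) auto
  then show ?thesis by (simp add: beta_n_psum slope_err_def add_divide_distrib)
qed (simp add: beta_n_psum slope_err_def)

lemma beta_n_0_bounds: "0 \<le> beta_n \<nu> n 0" "beta_n \<nu> n 0 \<le> 1"
proof -
  have c: "card (pos_idx n) \<ge> 1" using pos_idx_nonempty[of n] by (simp add: Suc_leI card_gt_0_iff)
  then show "0 \<le> beta_n \<nu> n 0" by (simp add: beta_n_0)
  have "real (card (pos_idx n)) \<le> 2 ^ n"
    using card_pos_idx[of n] by (metis of_nat_le_iff of_nat_numeral of_nat_power)
  then have "ln (real (card (pos_idx n))) \<le> ln (2 ^ n)"
    using c by (subst ln_le_cancel_iff) auto
  then have l: "ln (real (card (pos_idx n))) \<le> real n * ln 2" by (simp add: ln_realpow)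
  then show "beta_n \<nu> n 0 \<le> 1" by (cases "n = 0") (auto simp: beta_n_0 divide_le_eq)
qed

lemma beta_n_upper: "q \<ge> 0 \<Longrightarrow> beta_n \<nu> n q \<le> 1 + q * (ln (max total 1) / ln 2)"
  using beta_n_mono[of 0 q n] beta_n_0_bounds(2)[of n] mult_left_mono[OF slope_err_le[of n], of q] by simp

text \<open>Some interval carries at least the average mass \<open>total / 2 ^ n\<close>, and its
  power alone bounds the sum from below. Together with \<open>beta_n_upper\<close> this is a bound
  uniform in \<open>n\<close>, hence \<open>beta\<close> is finite for nonnegative
  exponents.\<close>

lemma beta_n_lower:
  assumes "q \<ge> 0"
  shows "beta_n \<nu> n q \<ge> - q * (1 + \<bar>ln total\<bar> / ln 2)"
proof (cases "n = 0")
  case False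
  have "\<exists>k\<in>pos_idx n. total / 2 ^ n \<le> mass n k"
  proof (rule ccontr)
    assume "\<not> ?thesis"
    then have "(\<Sum>k\<in>pos_idx n. mass n k) < (\<Sum>k\<in>pos_idx n. total / 2 ^ n)"
      using pos_idx_nonempty by (intro sum_strict_mono) (auto simp: not_le)
    also have "\<dots> \<le> total"
    proof -
      have "real (card (pos_idx n)) \<le> 2 ^ n" using card_pos_idx[of n] by (metis of_nat_le_iff of_nat_numeral of_nat_power)
      then show ?thesis using total_pos by (simp add: field_simps)
    qed
    finally show False by (simp add: sum_pos_idx)
  qed
  then obtain k where k: "k \<in> pos_idx n" "total / 2 ^ n \<le> mass n k" by blast
  have "(total / 2 ^ n) powr q \<le> mass n k powr q" using k total_pos assms by (intro powr_mono2) auto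
  also have "\<dots> \<le> psum n q" unfolding psum_def using k by (intro member_le_sum) auto
  finally have "ln ((total / 2 ^ n) powr q) \<le> ln (psum n q)"
    using psum_pos total_pos by (subst ln_le_cancel_iff) auto
  then have "q * (ln total - real n * ln 2) \<le> ln (psum n q)"
    using total_pos by (simp add: ln_powr ln_div ln_realpow)
  moreover have "- q * (1 + \<bar>ln total\<bar> / ln 2) * (real n * ln 2) \<le> q * (ln total - real n * ln 2)"
  proof -
    have "- (1 + \<bar>ln total\<bar> / ln 2) * (real n * ln 2) = - real n * ln 2 - \<bar>ln total\<bar> * real n"
      by (simp add: field_simps)
    also have "\<dots> \<le> ln total - real n * ln 2"
    proof -
      have "\<bar>ln total\<bar> * 1 \<le> \<bar>ln total\<bar> * real n" using False by (intro mult_left_mono) auto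
      then show ?thesis by linarith
    qed
    finally have "q * (- (1 + \<bar>ln total\<bar> / ln 2) * (real n * ln 2)) \<le> q * (ln total - real n * ln 2)"
      using assms by (rule mult_left_mono)
    then show ?thesis by (simp only: mult_minus_left mult_minus_right mult.assoc)
  qed
  ultimately have "- q * (1 + \<bar>ln total\<bar> / ln 2) * (real n * ln 2) \<le> ln (psum n q)" by linarith
  then show ?thesis using False by (simp add: beta_n_psum le_divide_eq)
qed (use assms in \<open>simp add: beta_n_psum\<close>)

text \<open>\<open>beta \<nu> q\<close> is finite for \<open>q \<ge> 0\<close>, but not in general for negative \<open>q\<close>.\<close>

definition bet :: "real \<Rightarrow> real" where "bet q = real_of_ereal (beta \<nu> q)"

lemma beta_bet: assumes "q \<ge> 0" shows "beta \<nu> q = ereal (bet q)"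
proof -
  have "beta \<nu> q \<le> ereal (1 + q * (ln (max total 1) / ln 2))"
    unfolding beta_def using beta_n_upper[OF assms] by (intro Limsup_bounded) (auto intro: always_eventually)
  moreover have "ereal (- q * (1 + \<bar>ln total\<bar> / ln 2)) \<le> beta \<nu> q"
    unfolding beta_def using beta_n_lower[OF assms]
    by (intro le_Limsup) (auto intro: always_eventually)
  ultimately have "\<bar>beta \<nu> q\<bar> \<noteq> \<infinity>" by auto
  then show ?thesis by (simp add: bet_def ereal_real')
qed

lemma bet_less: assumes "q \<ge> 0" "bet q < x" shows "eventually (\<lambda>n. beta_n \<nu> n q < x) sequentially"
proof -
  have "limsup (\<lambda>n. ereal (beta_n \<nu> n q)) < ereal x" using assms beta_bet[of q] by (simp add: beta_def)
  then show ?thesis by (rule limsup_less_iff_eventually)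
qed

lemma bet_leI: assumes "q \<ge> 0" "eventually (\<lambda>n. beta_n \<nu> n q \<le> x) sequentially" shows "bet q \<le> x"
proof -
  have "limsup (\<lambda>n. ereal (beta_n \<nu> n q)) \<le> ereal x" using assms(2) by (intro Limsup_bounded) auto
  then show ?thesis using assms(1) beta_bet[of q] by (simp add: beta_def)
qed

lemma bet_geI: assumes "q \<ge> 0" "\<exists>\<^sub>F n in sequentially. x \<le> beta_n \<nu> n q" shows "x \<le> bet q"
proof (rule ccontr)
  assume "\<not> x \<le> bet q"
  then have "eventually (\<lambda>n. beta_n \<nu> n q < x) sequentially" using assms(1) by (intro bet_less) auto
  then show False using assms(2) by (simp add: frequently_def not_le)
qed

lemma bet_convex:
  assumes "0 \<le> a" "0 \<le> b" "0 \<le> t" "t \<le> 1"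
  shows "bet ((1 - t) * a + t * b) \<le> (1 - t) * bet a + t * bet b"
proof (rule field_le_epsilon)
  fix e :: real assume "e > 0"
  have "eventually (\<lambda>n. beta_n \<nu> n a < bet a + e) sequentially" "eventually (\<lambda>n. beta_n \<nu> n b < bet b + e) sequentially"
    using assms \<open>e > 0\<close> by (auto intro!: bet_less)
  then have "eventually (\<lambda>n. beta_n \<nu> n ((1 - t) * a + t * b) \<le> (1 - t) * bet a + t * bet b + e) sequentially"
  proof eventually_elim
    case (elim n)
    have "beta_n \<nu> n ((1 - t) * a + t * b) \<le> (1 - t) * beta_n \<nu> n a + t * beta_n \<nu> n b"
      using beta_n_convex assms by blast
    also have "\<dots> \<le> (1 - t) * (bet a + e) + t * (bet b + e)"
      using elim assms by (intro add_mono mult_left_mono) auto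
    finally show ?case by (simp add: algebra_simps)
  qed
  then show "bet ((1 - t) * a + t * b) \<le> (1 - t) * bet a + t * bet b + e"
    using assms by (intro bet_leI) auto
qed

lemma bet_convex_on: "convex_on {0..} bet"
  by (intro convex_onI) (auto intro!: bet_convex)

lemma bet_antimono: assumes "0 \<le> q" "q \<le> q'" shows "bet q' \<le> bet q"
proof (rule field_le_epsilon)
  fix e :: real assume "e > 0"
  have "(\<lambda>n. (q' - q) * slope_err n) \<longlonglongrightarrow> (q' - q) * 0" by (intro tendsto_mult slope_err_tendsto tendsto_const)
  then have "eventually (\<lambda>n. (q' - q) * slope_err n < e / 2) sequentially"
    using \<open>e > 0\<close> by (intro order_tendstoD(2)) auto
  moreover have "eventually (\<lambda>n. beta_n \<nu> n q < bet q + e / 2) sequentially"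
    using assms \<open>e > 0\<close> by (intro bet_less) auto
  ultimately have "eventually (\<lambda>n. beta_n \<nu> n q' \<le> bet q + e) sequentially"
  proof eventually_elim
    case (elim n)
    then show ?case using beta_n_mono[OF assms(2), of n] by linarith
  qed
  then show "bet q' \<le> bet q + e" using assms by (intro bet_leI) auto
qed

lemma beta_n_1_tendsto: "(\<lambda>n. beta_n \<nu> n 1) \<longlonglongrightarrow> 0"
  unfolding beta_n_1 by real_asymp

lemma bet_1: "bet 1 = 0"
proof -
  have "beta \<nu> 1 = ereal 0"
    unfolding beta_def by (rule lim_imp_Limsup) (use beta_n_1_tendsto in \<open>auto intro: tendsto_ereal\<close>)
  then show ?thesis by (simp add: bet_def)
qed

lemma bet_nonneg: "0 \<le> q \<Longrightarrow> q \<le> 1 \<Longrightarrow> 0 \<le> bet q"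
  using bet_antimono[of q 1] bet_1 by simp

lemma bet_isCont: assumes "q > 0" shows "isCont bet q"
proof -
  have "continuous_on {0<..} bet"
    using bet_convex_on by (intro convex_on_continuous) (auto intro: convex_on_subset)
  then show ?thesis using assms by (simp add: continuous_on_eq_continuous_at)
qed

section \<open>The fixed points\<close>

lemma slope_err_less_1: "eventually (\<lambda>n. slope_err n < 1) sequentially"
  using slope_err_tendsto by (rule order_tendstoD) simp

lemma beta_n_isCont: "isCont (beta_n \<nu> n) q"
proof -
  have "isCont (psum n) q" unfolding psum_def by (intro continuous_intros) (auto simp: pos_idx_def)
  moreover have "psum n q \<noteq> 0" using psum_pos[of n q] by simp
  moreover have "beta_n \<nu> n = (\<lambda>q. ln (psum n q) / (real n * ln 2))" by (rule ext) (rule beta_n_psum)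
  ultimately show ?thesis
    by (cases "n = 0") (auto intro!: continuous_intros)
qed

text \<open>Once \<open>slope_err n < 1\<close>, the function \<open>beta_n q - q\<close> is
  strictly decreasing. It is nonnegative at 0 because some interval has positive mass, and
  eventually negative at 1; its unique zero is what the definite description picks.\<close>

lemma eventually_q_n:
  "eventually (\<lambda>n. 0 \<le> q_n \<nu> n \<and> q_n \<nu> n \<le> 1 \<and> beta_n \<nu> n (q_n \<nu> n) = q_n \<nu> n) sequentially"
proof -
  have "eventually (\<lambda>n. beta_n \<nu> n 1 < 1) sequentially"
    using beta_n_1_tendsto by (rule order_tendstoD) simp
  with slope_err_less_1 show ?thesis
  proof eventually_elim
    case (elim n)
    have dec: "beta_n \<nu> n q' - q' < beta_n \<nu> n q - q" if "q < q'" for q q'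
    proof -
      have "(q' - q) * slope_err n < (q' - q) * 1" using that elim by (intro mult_strict_left_mono) auto
      then show ?thesis using beta_n_mono[OF less_imp_le[OF that], of n] by argo
    qed
    have "\<exists>q\<ge>0. q \<le> 1 \<and> beta_n \<nu> n q - q = 0"
      using beta_n_0_bounds(1)[of n] elim beta_n_isCont
      by (intro IVT2) (auto intro!: continuous_intros)
    then obtain q where q: "q \<ge> 0" "q \<le> 1" "beta_n \<nu> n q = q" by auto
    have "q_n \<nu> n = q"
      unfolding q_n_def
    proof (rule the_equality)
      fix r assume "0 \<le> r \<and> beta_n \<nu> n r = r"
      then show "r = q" using dec[of r q] dec[of q r] q by (cases r q rule: linorder_cases) auto
    qed (use q in auto)
    then show ?case using q by simp
  qed
qed

abbreviation q0 :: real where "q0 \<equiv> q_upper \<nu>"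

lemma limsup_q_n: "limsup (\<lambda>n. ereal (q_n \<nu> n)) = ereal q0" and q0_bounds: "0 \<le> q0" "q0 \<le> 1"
proof -
  have "limsup (\<lambda>n. ereal (q_n \<nu> n)) \<le> 1"
    using eventually_q_n by (intro Limsup_bounded) (auto elim: eventually_mono)
  moreover have "0 \<le> limsup (\<lambda>n. ereal (q_n \<nu> n))"
    using eventually_q_n by (intro le_Limsup) (auto elim: eventually_mono)
  ultimately show l: "limsup (\<lambda>n. ereal (q_n \<nu> n)) = ereal q0"
    unfolding q_upper_def by (intro ereal_real'[symmetric]) auto
  show "0 \<le> q0" "q0 \<le> 1"
    using \<open>limsup (\<lambda>n. ereal (q_n \<nu> n)) \<le> 1\<close> \<open>0 \<le> limsup (\<lambda>n. ereal (q_n \<nu> n))\<close> unfolding l by auto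
qed

text \<open>From \<open>q_n\<close> to \<open>q\<close> the value of \<open>beta_n\<close> rises by
  less than \<open>r\<close>, while \<open>q\<close> itself exceeds \<open>q_n\<close> by more than
  \<open>2 * r\<close>. The gap does not depend on \<open>n\<close>, and this makes the sums over
  all levels geometric.\<close>

lemma beta_n_minus_q:
  assumes "q > q0"
  shows "\<exists>r>0. eventually (\<lambda>n. beta_n \<nu> n q - q < - r) sequentially"
proof -
  define r where "r = (q - q0) / 4"
  have r: "r > 0" "q0 < q - 2 * r" using assms unfolding r_def by argo+
  have "eventually (\<lambda>n. q_n \<nu> n < q - 2 * r) sequentially"
    using limsup_q_n r by (intro limsup_less_iff_eventually) auto
  moreover have "eventually (\<lambda>n. q * slope_err n < r) sequentially"
  proof -
    have "(\<lambda>n. q * slope_err n) \<longlonglongrightarrow> q * 0" by (intro tendsto_mult slope_err_tendsto tendsto_const)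
    then show ?thesis using r by (intro order_tendstoD(2)) auto
  qed
  ultimately have "eventually (\<lambda>n. beta_n \<nu> n q - q < - r) sequentially"
    using eventually_q_n
  proof eventually_elim
    case (elim n)
    have "beta_n \<nu> n q \<le> beta_n \<nu> n (q_n \<nu> n) + (q - q_n \<nu> n) * slope_err n"
      using elim r by (intro beta_n_mono) auto
    also have "(q - q_n \<nu> n) * slope_err n \<le> q * slope_err n"
      using elim slope_err_nonneg by (intro mult_right_mono) auto
    finally show ?case using elim by linarith
  qed
  then show ?thesis using r by blast
qed

lemma bet_less_q: assumes "q > q0" shows "bet q < q"
proof -
  obtain r where r: "r > 0" "eventually (\<lambda>n. beta_n \<nu> n q - q < - r) sequentially"
    using beta_n_minus_q[OF assms] by blast
  have "bet q \<le> q - r"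
    using r q0_bounds assms by (intro bet_leI) (auto elim: eventually_mono)
  then show ?thesis using r by simp
qed

text \<open>For infinitely many n the fixed point is close to \<open>q0\<close> and to the right of
  \<open>q\<close>; there \<open>beta_n q\<close> is at least the fixed point up to the monotonicity
  error. Infinitely many n are enough for an upper limit.\<close>

lemma bet_ge_q0: assumes "0 \<le> q" "q < q0" shows "q0 \<le> bet q"
proof (rule field_le_epsilon)
  fix e :: real assume "e > 0"
  define d where "d = min (e / 2) (q0 - q)"
  have d: "d > 0" using \<open>e > 0\<close> assms by (simp add: d_def)
  have d': "d \<le> e / 2" "d \<le> q0 - q"
    unfolding d_def by (rule min.cobounded1, rule min.cobounded2)
  have "\<exists>\<^sub>F n in sequentially. q0 - d < q_n \<nu> n"
  proof (rule ccontr)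
    assume "\<not> ?thesis"
    then have "eventually (\<lambda>n. ereal (q_n \<nu> n) \<le> ereal (q0 - d)) sequentially"
      by (simp add: frequently_def not_less)
    then have "ereal q0 \<le> ereal (q0 - d)" unfolding limsup_q_n[symmetric] by (rule Limsup_bounded)
    then show False using d by simp
  qed
  moreover have "eventually (\<lambda>n. slope_err n < e / 2) sequentially"
    using slope_err_tendsto \<open>e > 0\<close> by (intro order_tendstoD(2)) auto
  ultimately have "\<exists>\<^sub>F n in sequentially. q0 - e \<le> beta_n \<nu> n q"
  proof (rule frequently_rev_mp[OF frequently_eventually_frequently[OF frequently_eventually_frequently[OF _ _] eventually_q_n]])
    show "\<forall>\<^sub>F n in sequentially. (q0 - d < q_n \<nu> n \<and> slope_err n < e / 2) \<and> 0 \<le> q_n \<nu> n \<and> q_n \<nu> n \<le> 1 \<and> beta_n \<nu> n (q_n \<nu> n) = q_n \<nu> n \<longrightarrow> q0 - e \<le> beta_n \<nu> n q"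
    proof (intro always_eventually allI impI)
      fix n assume n: "(q0 - d < q_n \<nu> n \<and> slope_err n < e / 2) \<and> 0 \<le> q_n \<nu> n \<and> q_n \<nu> n \<le> 1 \<and> beta_n \<nu> n (q_n \<nu> n) = q_n \<nu> n"
      have "beta_n \<nu> n (q_n \<nu> n) \<le> beta_n \<nu> n q + (q_n \<nu> n - q) * slope_err n"
        using n d d' by (intro beta_n_mono) auto
      also have "(q_n \<nu> n - q) * slope_err n \<le> 1 * slope_err n"
        using n assms slope_err_nonneg by (intro mult_right_mono) auto
      finally show "q0 - e \<le> beta_n \<nu> n q" using n d d' by linarith
    qed
  qed
  then have "q0 - e \<le> bet q" using assms by (intro bet_geI) auto
  then show "q0 \<le> bet q + e" by simp
qed

text \<open>Continuity carries the inequalities on either side over to the point itself. It is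
  available for \<open>q0 > 0\<close>, an interior point of the half-line on which
  \<open>bet\<close> is convex.\<close>

lemma bet_q0: assumes "q0 > 0" shows "bet q0 = q0"
proof (rule antisym)
  have c: "isCont bet q0" using assms by (rule bet_isCont)
  have "(bet \<longlongrightarrow> bet q0) (at_right q0)" using c by (simp add: isCont_def filterlim_at_split)
  moreover have "((\<lambda>q. q) \<longlongrightarrow> q0) (at_right q0)" by simp
  moreover have "eventually (\<lambda>q. bet q \<le> q) (at_right q0)"
    by (simp add: eventually_at_filter bet_less_q less_imp_le)
  ultimately show "bet q0 \<le> q0"
    using tendsto_le[of "at_right q0" "\<lambda>q. q" q0 bet "bet q0"] by simp
  have "(bet \<longlongrightarrow> bet q0) (at_left q0)" using c by (simp add: isCont_def filterlim_at_split)
  moreover have "eventually (\<lambda>q. q0 \<le> bet q) (at_left q0)"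
    using eventually_at_left_field[of "\<lambda>q. q0 \<le> bet q" q0] bet_ge_q0 assms
    by (metis less_imp_le)
  ultimately show "q0 \<le> bet q0" by (rule tendsto_lowerbound) simp
qed

end

section \<open>The spectral dimension\<close>

lemma sum_Un_le:
  fixes f :: "'a \<Rightarrow> real"
  assumes "finite A" "finite B" "\<And>x. 0 \<le> f x"
  shows "sum f (A \<union> B) \<le> sum f A + sum f B"
  using sum.union_inter[OF assms(1,2), of f] sum_nonneg[of "A \<inter> B" f] assms(3) by simp

lemma dyadic_ancestor: "x \<in> dyadic (m + d) k \<Longrightarrow> x \<in> dyadic m (k div 2 ^ d)"
proof (induction d arbitrary: k)
  case (Suc d)
  then have "x \<in> dyadic (m + d) (k div 2)" using dyadic_Suc[of x "m + d" k] by simp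
  from Suc.IH[OF this] show ?case by (simp add: div_mult2_eq)
qed simp

context unit_interval_measure
begin

section \<open>Upper bound of the spectral dimension\<close>

text \<open>\<open>mass n k / 2 ^ n\<close> is mass times length: the bad intervals are those too
  large for the constant \<open>c\<close> in \<open>partition_bound\<close>.\<close>

definition bad :: "real \<Rightarrow> nat \<Rightarrow> nat set" where
  "bad c n = {k. k < 2 ^ n \<and> c < mass n k / 2 ^ n}"

lemma finite_bad [simp]: "finite (bad c n)" by (simp add: bad_def)

text \<open>The partition consists of the maximal dyadic intervals that are not bad; each of them is either
  \<open>dyadic 0 0\<close> or one of the two halves of a bad interval.\<close>

lemma eigenvalue_count_le_bad:
  assumes c: "0 < c" "c * x < 1" and x: "0 \<le> x" and N: "\<And>n. n \<ge> N \<Longrightarrow> bad c n = {}"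
  shows "eigenvalue_count \<nu> x \<le> 1 + 2 * (\<Sum>n<N. card (bad c n))"
proof -
  define I where "I = {(n, k). n \<le> N \<and> k < 2 ^ n \<and> k \<notin> bad c n \<and> (\<forall>m<n. k div 2 ^ (n - m) \<in> bad c m)}"
  define J where "J = (\<lambda>(n, k). (real k / 2 ^ n, (real k + 1) / 2 ^ n :: real))"
  have J: "(case J p of (a, b) \<Rightarrow> {a<..b}) = dyadic (fst p) (snd p)" for p
    by (simp add: J_def dyadic_def case_prod_unfold)
  have lt: False if "x \<in> dyadic n k" "x \<in> dyadic n' k'" "(n, k) \<in> I" "(n', k') \<in> I" "n < n'" for n k n' k' x
  proof -
    have "x \<in> dyadic (n + (n' - n)) k'" using that by simp
    from dyadic_ancestor[OF this] have "k = k' div 2 ^ (n' - n)" using that dyadic_eqI by blast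
    then show False using that by (auto simp: I_def)
  qed
  have uniq: "p = p'" if "x \<in> dyadic (fst p) (snd p)" "x \<in> dyadic (fst p') (snd p')" "p \<in> I" "p' \<in> I" for p p' x
  proof -
    obtain n k n' k' where pp: "p = (n, k)" "p' = (n', k')" by (cases p, cases p') auto
    have "\<not> n < n'" "\<not> n' < n" using lt[of x n k n' k'] lt[of x n' k' n k] that by (auto simp: pp)
    then show ?thesis using that dyadic_eqI[of x n k k'] by (auto simp: pp)
  qed
  have fI: "finite I"
    by (rule finite_subset[of _ "SIGMA n:{..N}. {..<2 ^ n}"]) (auto simp: I_def)
  have "eigenvalue_count \<nu> x \<le> card (J ` I)"
  proof (rule eigenvalue_count_le(3)[of _ c])
    show "finite (J ` I)" using fI by simp
    show "disjoint_family_on (\<lambda>(a, b). {a<..b}) (J ` I)"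
      unfolding disjoint_family_on_def using uniq by (auto simp: J disjoint_iff) (metis fst_conv snd_conv)+
    fix a b assume "(a, b) \<in> J ` I"
    then obtain n k where nk: "(n, k) \<in> I" "a = real k / 2 ^ n" "b = (real k + 1) / 2 ^ n" by (auto simp: J_def)
    have "real k + 1 \<le> 2 ^ n"
      using nk(1) by (auto simp: I_def) (metis Suc_leI of_nat_Suc of_nat_le_iff of_nat_numeral of_nat_power add.commute)
    moreover have "b - a = 1 / 2 ^ n" by (simp add: nk diff_divide_distrib[symmetric])
    moreover have "measure \<nu> {a<..b} = mass n k" by (simp add: mass_def dyadic_def nk)
    moreover have "mass n k / 2 ^ n \<le> c" using nk(1) by (auto simp: I_def bad_def)
    ultimately show "0 \<le> a \<and> a \<le> b \<and> b \<le> 1 \<and> measure \<nu> {a<..b} * (b - a) \<le> c"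
      by (simp add: nk divide_right_mono divide_le_eq)
  next
    show "{0<..<1} \<subseteq> (\<Union>(a, b)\<in>J ` I. {a<..b})"
    proof
      fix x :: real assume x: "x \<in> {0<..<1}"
      have "\<forall>n. \<exists>k<2 ^ n. x \<in> dyadic n k" using ex_dyadic[of x] x by simp
      then obtain i where i: "\<And>n. i n < 2 ^ n" "\<And>n. x \<in> dyadic n (i n)" by metis
      define n where "n = (LEAST n. i n \<notin> bad c n)"
      have ex: "i N \<notin> bad c N" using N[of N] by simp
      have n: "i n \<notin> bad c n" "n \<le> N"
        unfolding n_def using LeastI[of "\<lambda>n. i n \<notin> bad c n", OF ex] Least_le[of "\<lambda>n. i n \<notin> bad c n", OF ex] .
      have "i n div 2 ^ (n - m) \<in> bad c m" if "m < n" for m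
      proof -
        have "x \<in> dyadic (m + (n - m)) (i n)" using i that by simp
        from dyadic_ancestor[OF this] have "i n div 2 ^ (n - m) = i m" using i dyadic_eqI by blast
        moreover have "i m \<in> bad c m" using that not_less_Least[of m "\<lambda>n. i n \<notin> bad c n"] by (auto simp: n_def)
        ultimately show ?thesis by simp
      qed
      then have "(n, i n) \<in> I" using n i by (simp add: I_def)
      then have "J (n, i n) \<in> J ` I" by (rule imageI)
      then show "x \<in> (\<Union>(a, b)\<in>J ` I. {a<..b})"
        using i(2)[of n] J[of "(n, i n)"] by (metis UN_iff fst_conv snd_conv)
    qed
  qed (use c x in auto)
  also have "\<dots> \<le> card I" using fI by (rule card_image_le)
  also have "\<dots> \<le> card (insert (0, 0) (\<Union>n<N. {Suc n} \<times> ((\<lambda>j. 2 * j) ` bad c n \<union> (\<lambda>j. 2 * j + 1) ` bad c n)))"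
  proof (rule card_mono)
    show "I \<subseteq> insert (0, 0) (\<Union>n<N. {Suc n} \<times> ((\<lambda>j. 2 * j) ` bad c n \<union> (\<lambda>j. 2 * j + 1) ` bad c n))"
    proof
      fix p assume p: "p \<in> I"
      obtain n k where nk: "p = (n, k)" by (cases p)
      show "p \<in> insert (0, 0) (\<Union>n<N. {Suc n} \<times> ((\<lambda>j. 2 * j) ` bad c n \<union> (\<lambda>j. 2 * j + 1) ` bad c n))"
      proof (cases n)
        case 0 then show ?thesis using p nk by (auto simp: I_def)
      next
        case (Suc m)
        then have b: "k div 2 \<in> bad c m" "m < N" using p nk by (auto simp: I_def dest: spec[of _ m])
        have "k = 2 * (k div 2) \<or> k = 2 * (k div 2) + 1" by presburger
        then have "k \<in> (\<lambda>j. 2 * j) ` bad c m \<union> (\<lambda>j. 2 * j + 1) ` bad c m" using b(1) by blast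
        then show ?thesis using b(2) nk Suc by blast
      qed
    qed
  qed simp
  also have "\<dots> \<le> 1 + card (\<Union>n<N. {Suc n} \<times> ((\<lambda>j. 2 * j) ` bad c n \<union> (\<lambda>j. 2 * j + 1) ` bad c n))"
    using card_insert_le_m1[of "1 + card (\<Union>n<N. {Suc n} \<times> ((\<lambda>j. 2 * j) ` bad c n \<union> (\<lambda>j. 2 * j + 1) ` bad c n))"] by simp
  also have "card (\<Union>n<N. {Suc n} \<times> ((\<lambda>j. 2 * j) ` bad c n \<union> (\<lambda>j. 2 * j + 1) ` bad c n)) \<le>
     (\<Sum>n<N. card ({Suc n} \<times> ((\<lambda>j. 2 * j) ` bad c n \<union> (\<lambda>j. 2 * j + 1) ` bad c n)))"
    by (rule card_UN_le) simp
  also have "\<dots> \<le> (\<Sum>n<N. 2 * card (bad c n))"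
  proof (rule sum_mono)
    fix n
    have "card ((\<lambda>j. 2 * j) ` bad c n \<union> (\<lambda>j. 2 * j + 1) ` bad c n) \<le> card (bad c n) + card (bad c n)"
      by (rule order_trans[OF card_Un_le]) (intro add_mono card_image_le finite_bad)
    then show "card ({Suc n} \<times> ((\<lambda>j. 2 * j) ` bad c n \<union> (\<lambda>j. 2 * j + 1) ` bad c n)) \<le> 2 * card (bad c n)"
      by (simp add: card_cartesian_product)
  qed
  finally show ?thesis by (simp add: sum_distrib_left)
qed

text \<open>Markov's inequality with exponent \<open>q\<close>: on a bad interval
  \<open>2 * x * mass n k / 2 ^ n\<close> exceeds 1.\<close>

lemma card_bad_le:
  assumes x: "x > 0" and q: "q \<ge> 0"
  shows "real (card (bad (1 / (2 * x)) n)) \<le> (2 * x) powr q * (psum n q * 2 powr (- (real n * q)))"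
proof -
  let ?b = "bad (1 / (2 * x)) n"
  have sub: "?b \<subseteq> pos_idx n"
  proof
    fix k assume "k \<in> ?b"
    then have k: "k < 2 ^ n" "1 / (2 * x) < mass n k / 2 ^ n" by (auto simp: bad_def)
    have "0 < 1 / (2 * x)" using x by simp
    then have "0 < mass n k / 2 ^ n" using k(2) by linarith
    then show "k \<in> pos_idx n" using k(1) by (simp add: pos_idx_def zero_less_divide_iff)
  qed
  have "real (card ?b) = (\<Sum>k\<in>?b. 1)" by simp
  also have "\<dots> \<le> (\<Sum>k\<in>?b. (2 * x * mass n k / 2 ^ n) powr q)"
  proof (rule sum_mono)
    fix k assume "k \<in> ?b"
    then have "1 \<le> 2 * x * mass n k / 2 ^ n" using x by (simp add: bad_def field_simps)
    then show "1 \<le> (2 * x * mass n k / 2 ^ n) powr q" using q by (simp add: ge_one_powr_ge_zero)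
  qed
  also have "\<dots> \<le> (\<Sum>k\<in>pos_idx n. (2 * x * mass n k / 2 ^ n) powr q)"
    using sub by (intro sum_mono2) auto
  also have "\<dots> = (\<Sum>k\<in>pos_idx n. (2 * x) powr q * 2 powr (- (real n * q)) * mass n k powr q)"
  proof (rule sum.cong)
    fix k assume "k \<in> pos_idx n"
    have "(2 ^ n) powr q = (2::real) powr (real n * q)" by (simp add: powr_realpow[symmetric] powr_powr)
    then show "(2 * x * mass n k / 2 ^ n) powr q = (2 * x) powr q * 2 powr (- (real n * q)) * mass n k powr q"
      using x by (simp add: powr_mult powr_divide powr_minus_divide)
  qed simp
  also have "\<dots> = (2 * x) powr q * (psum n q * 2 powr (- (real n * q)))"
    by (simp add: psum_def sum_distrib_left sum_distrib_right mult_ac)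
  finally show ?thesis .
qed

lemma summable_psum:
  assumes "q > q0"
  shows "summable (\<lambda>n. psum n q * 2 powr (- (real n * q)))"
proof -
  obtain r where r: "r > 0" "eventually (\<lambda>n. beta_n \<nu> n q - q < - r) sequentially"
    using beta_n_minus_q[OF assms] by blast
  show ?thesis
  proof (rule summable_comparison_test_ev)
    show "\<forall>\<^sub>F n in sequentially. norm (psum n q * 2 powr (- (real n * q))) \<le> (2 powr (- r)) ^ n"
      using r(2) eventually_ge_at_top[of 1]
    proof eventually_elim
      case (elim n)
      have "psum n q * 2 powr (- (real n * q)) = 2 powr (real n * (beta_n \<nu> n q - q))"
        unfolding psum_beta_n[OF elim(2)] by (simp add: powr_add[symmetric] algebra_simps)
      also have "\<dots> \<le> 2 powr (real n * (- r))" using elim by (intro powr_mono mult_left_mono) auto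
      also have "\<dots> = (2 powr (- r)) ^ n" by (simp add: powr_powr powr_realpow[symmetric] mult.commute)
      finally show ?case using psum_pos[of n q] by simp
    qed
    have "2 powr (- r) < 2 powr 0" using r by (intro powr_less_mono) auto
    then show "summable (\<lambda>n. (2 powr (- r)) ^ n)" by (intro summable_geometric) simp
  qed
qed

text \<open>The Markov bounds are summed over all levels, and summability makes the constant
  independent of \<open>x\<close>. The threshold \<open>1 / (2 * x)\<close> leaves room for the
  strict inequality \<open>c * x < 1\<close>; levels with \<open>2 ^ n > 2 * x * total\<close> have
  no bad intervals.\<close>

lemma eigenvalue_count_upper:
  assumes "q > q0"
  shows "\<exists>K\<ge>1. \<forall>x\<ge>1. real (eigenvalue_count \<nu> x) \<le> K * x powr q"
proof -
  define w where "w n = psum n q * 2 powr (- (real n * q))" for n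
  have q: "q \<ge> 0" using assms q0_bounds by simp
  have w: "summable w" using summable_psum[OF assms] by (simp add: w_def[abs_def])
  have w0: "w n \<ge> 0" for n using psum_pos[of n q] by (simp add: w_def)
  define S where "S = suminf w"
  have S: "S \<ge> 0" unfolding S_def using w w0 by (intro suminf_nonneg)
  have "real (eigenvalue_count \<nu> x) \<le> (1 + 2 * 2 powr q * S) * x powr q" if x: "x \<ge> 1" for x
  proof -
    obtain N :: nat where N: "2 * x * total < 2 ^ N" using real_arch_pow[of 2 "2 * x * total"] by auto
    have bad: "bad (1 / (2 * x)) n = {}" if "n \<ge> N" for n
    proof -
      have "(2::real) ^ N \<le> 2 ^ n" using that by (rule power_increasing) simp
      then have "2 * x * total < 2 ^ n" using N by linarith
      then have "total / 2 ^ n < 1 / (2 * x)" using x by (simp add: field_simps)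
      moreover have "mass n k / 2 ^ n \<le> total / 2 ^ n" for k by (intro divide_right_mono mass_le_total) simp
      ultimately have "mass n k / 2 ^ n < 1 / (2 * x)" for k by (meson le_less_trans)
      then show ?thesis by (auto simp: bad_def) (meson less_asym)
    qed
    have "real (eigenvalue_count \<nu> x) \<le> real (1 + 2 * (\<Sum>n<N. card (bad (1 / (2 * x)) n)))"
      using x by (intro of_nat_mono eigenvalue_count_le_bad bad) (auto simp: field_simps)
    also have "\<dots> = 1 + 2 * (\<Sum>n<N. real (card (bad (1 / (2 * x)) n)))" by simp
    also have "\<dots> \<le> 1 + 2 * (\<Sum>n<N. (2 * x) powr q * w n)"
      using card_bad_le[of x q] x q by (intro add_left_mono mult_left_mono sum_mono) (auto simp: w_def)
    also have "\<dots> = 1 + 2 * ((2 * x) powr q * (\<Sum>n<N. w n))" by (simp add: sum_distrib_left)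
    also have "\<dots> \<le> 1 * x powr q + 2 * ((2 * x) powr q * S)"
    proof -
      have "(\<Sum>n<N. w n) \<le> S" unfolding S_def using w w0 by (intro sum_le_suminf) auto
      moreover have "1 \<le> x powr q" using x q by (simp add: ge_one_powr_ge_zero)
      ultimately show ?thesis by (intro add_mono mult_left_mono) auto
    qed
    also have "\<dots> = (1 + 2 * 2 powr q * S) * x powr q" using x by (simp add: powr_mult algebra_simps)
    finally show ?thesis .
  qed
  moreover have "1 \<le> 1 + 2 * 2 powr q * S" using S by simp
  ultimately show ?thesis by blast
qed

lemma s_upper_le: "s_upper \<nu> \<le> ereal q0"
proof (rule ereal_le_epsilon2)
  fix e :: real assume e: "e > 0"
  define q where "q = q0 + e"
  obtain K where K: "K \<ge> 1" "\<And>x. x \<ge> 1 \<Longrightarrow> real (eigenvalue_count \<nu> x) \<le> K * x powr q"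
    using eigenvalue_count_upper[of q] e by (auto simp: q_def)
  have q0: "q \<ge> 0" using q0_bounds e by (simp add: q_def)
  have "s_upper \<nu> \<le> Limsup at_top (\<lambda>x. ereal (ln K / ln x + q))"
    unfolding s_upper_def
  proof (rule Limsup_mono)
    show "\<forall>\<^sub>F x in at_top. ereal (ln (real (eigenvalue_count \<nu> x)) / ln x) \<le> ereal (ln K / ln x + q)"
      using eventually_gt_at_top[of "1::real"]
    proof eventually_elim
      case (elim x)
      have "ln (real (eigenvalue_count \<nu> x)) \<le> ln (K * x powr q)"
      proof (cases "eigenvalue_count \<nu> x = 0")
        case True
        have "1 * 1 \<le> K * x powr q" using K(1) elim q0 by (intro mult_mono) (auto simp: ge_one_powr_ge_zero)
        then show ?thesis using True by simp
      next
        case False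
        then show ?thesis using K(1) K(2)[of x] elim by (subst ln_le_cancel_iff) auto
      qed
      also have "\<dots> = ln K + q * ln x" using K(1) elim by (simp add: ln_mult ln_powr)
      finally have "ln (real (eigenvalue_count \<nu> x)) / ln x \<le> (ln K + q * ln x) / ln x"
        using elim by (intro divide_right_mono) auto
      then show ?case using elim by (simp add: add_divide_distrib)
    qed
  qed
  also have "\<dots> = ereal q"
  proof (rule lim_imp_Limsup)
    have "((\<lambda>x. ln K / ln x + q) \<longlongrightarrow> q) at_top" by real_asymp
    then show "((\<lambda>x. ereal (ln K / ln x + q)) \<longlongrightarrow> ereal q) at_top" by (rule tendsto_ereal)
  qed simp
  finally show "s_upper \<nu> \<le> ereal q0 + ereal e" by (simp add: q_def)
qed

lemma s_lower_nonneg: "0 \<le> s_lower \<nu>"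
  unfolding s_lower_def
proof (rule Liminf_bounded)
  show "\<forall>\<^sub>F x in at_top. 0 \<le> ereal (ln (real (eigenvalue_count \<nu> x)) / ln x)"
    using eventually_gt_at_top[of "1::real"]
  proof eventually_elim
    case (elim x)
    have "0 \<le> ln (real (eigenvalue_count \<nu> x))" by (cases "eigenvalue_count \<nu> x = 0") auto
    then show ?case using elim by simp
  qed
qed

lemma s_lower_le_s_upper: "s_lower \<nu> \<le> s_upper \<nu>"
  unfolding s_lower_def s_upper_def by (rule Liminf_le_Limsup) simp

section \<open>Lower bound of the spectral dimension\<close>

text \<open>An interval of level n and mass at least 2^(-na) is admissible for tents as soon as x/2
  >= 2^(n(1+a)). Given x, the largest such n lies within 1 of log2(x/2)/(1+a), and what is lost is a
  constant in the logarithm.\<close>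

lemma s_lower_ge_count:
  assumes a: "a \<ge> 0" and F: "F > 0"
    and ev: "eventually (\<lambda>n. 2 powr (real n * F) \<le> real (card {k. k < 2 ^ n \<and> 2 powr (- (real n * a)) \<le> mass n k})) sequentially"
  shows "ereal (F / (1 + a)) \<le> s_lower \<nu>"
proof -
  obtain n0 where n0: "\<And>n. n \<ge> n0 \<Longrightarrow> 2 powr (real n * F) \<le> real (card {k. k < 2 ^ n \<and> 2 powr (- (real n * a)) \<le> mass n k})"
    using ev by (auto simp: eventually_sequentially)
  obtain n1 :: nat where n1: "real n1 > 2 / F" using reals_Archimedean2 by blast
  \<comment> \<open>\<open>F * ln 2\<close> is the loss from rounding the level down.
    \<open>ln 6\<close> comes from solving \<open>2 powr (n * F) \<le> 3 * N + 2\<close> for N: the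
    left side exceeds 4 because \<open>n1 > 2 / F\<close>, so the summand 2 costs at most half of
    it.\<close>
  define c where "c = F * ln 2 + ln 6"
  have "ereal (F / (1 + a)) = Liminf at_top (\<lambda>x. ereal ((F / (1 + a) * ln (x / 2) - c) / ln x))"
  proof (rule lim_imp_Liminf[symmetric])
    have "((\<lambda>x. (b * ln (x / 2) - c) / ln x) \<longlongrightarrow> b) at_top" for b :: real by real_asymp
    then show "((\<lambda>x. ereal ((F / (1 + a) * ln (x / 2) - c) / ln x)) \<longlongrightarrow> ereal (F / (1 + a))) at_top"
      by (rule tendsto_ereal)
  qed simp
  also have "\<dots> \<le> s_lower \<nu>"
    unfolding s_lower_def
  proof (rule Liminf_mono)
    have "filterlim (\<lambda>x. log 2 (x / 2) / (1 + a)) at_top at_top"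
      using a by real_asymp
    then have "eventually (\<lambda>x. real (n0 + n1 + 1) \<le> log 2 (x / 2) / (1 + a)) at_top"
      by (simp add: filterlim_at_top)
    then show "\<forall>\<^sub>F x in at_top. ereal ((F / (1 + a) * ln (x / 2) - c) / ln x) \<le> ereal (ln (real (eigenvalue_count \<nu> x)) / ln x)"
      using eventually_gt_at_top[of "2::real"]
    proof eventually_elim
      case (elim x)
      define y where "y = log 2 (x / 2) / (1 + a)"
      define n where "n = nat \<lfloor>y\<rfloor>"
      have y: "real (n0 + n1 + 1) \<le> y" using elim by (simp add: y_def)
      then have "y \<ge> 0" by (meson of_nat_0_le_iff order_trans)
      then have n: "real n \<le> y" "y < real n + 1" unfolding n_def by linarith+
      then have "real (n0 + n1) < real n + 0" using y by simp
      then have nn: "n \<ge> n0" "n \<ge> n1" by linarith+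
      have big: "2 powr (real n * (1 + a)) \<le> x / 2"
      proof -
        have "real n * (1 + a) \<le> log 2 (x / 2)" using n(1) a by (simp add: y_def field_simps)
        then have "2 powr (real n * (1 + a)) \<le> 2 powr (log 2 (x / 2))" by (intro powr_mono) auto
        then show ?thesis using elim by simp
      qed
      have "{k. k < 2 ^ n \<and> 2 powr (- (real n * a)) \<le> mass n k} \<subseteq>
          {k. k < 2 ^ n \<and> 2 * 2 ^ n \<le> x * measure \<nu> (dyadic n k)}"
      proof safe
        fix k assume k: "k < 2 ^ n" "2 powr (- (real n * a)) \<le> mass n k"
        have "2 * 2 ^ n = 2 * 2 powr (real n * (1 + a)) * 2 powr (- (real n * a))"
          by (simp add: mult.assoc powr_add[symmetric] powr_realpow[symmetric] algebra_simps)
        also have "\<dots> \<le> x * mass n k" using big k(2) elim by (intro mult_mono) auto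
        finally show "2 * 2 ^ n \<le> x * measure \<nu> (dyadic n k)" by (simp add: mass_def)
      qed
      then have "card {k. k < 2 ^ n \<and> 2 powr (- (real n * a)) \<le> mass n k} \<le>
          card {k. k < 2 ^ n \<and> 2 * 2 ^ n \<le> x * measure \<nu> (dyadic n k)}" by (intro card_mono) auto
      also have "\<dots> \<le> 3 * eigenvalue_count \<nu> x + 2" using elim by (intro eigenvalue_count_ge_dyadic) simp
      finally have "real (card {k. k < 2 ^ n \<and> 2 powr (- (real n * a)) \<le> mass n k}) \<le> 3 * real (eigenvalue_count \<nu> x) + 2"
        by linarith
      then have cnt: "2 powr (real n * F) \<le> 3 * real (eigenvalue_count \<nu> x) + 2" using n0[OF nn(1)] by linarith
      have "2 / F < real n" using n1 nn(2) by linarith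
      then have "2 < real n * F" using F by (simp add: field_simps)
      then have "2 powr 2 < (2::real) powr (real n * F)" by (intro powr_less_mono) auto
      then have four: "4 < (2::real) powr (real n * F)" by simp
      then have N: "2 powr (real n * F) / 6 \<le> real (eigenvalue_count \<nu> x)" using cnt by argo
      have "F / (1 + a) * ln (x / 2) - c = F * ln 2 * y - c"
        by (simp add: y_def log_def)
      also have "\<dots> \<le> F * ln 2 * (real n + 1) - c" using n(2) F by (intro diff_right_mono mult_left_mono) auto
      also have "\<dots> = real n * F * ln 2 - ln 6" by (simp add: c_def algebra_simps)
      also have "\<dots> = ln (2 powr (real n * F) / 6)" by (simp add: ln_div ln_powr)
      also have "\<dots> \<le> ln (real (eigenvalue_count \<nu> x))" using N four by (subst ln_le_cancel_iff) auto
      finally show ?case using elim by (simp add: divide_right_mono)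
    qed
  qed
  finally show ?thesis .
qed

text \<open>Tilting the exponent by \<open>h\<close> in either direction shows that intervals of mass outside
  \<open>2 powr (- n (a + e))\<close> to \<open>2 powr (- n (a - e))\<close> contribute negligibly to the sum with exponent \<open>q\<close>.\<close>

lemma large_deviation:
  assumes q: "0 \<le> q - h" "h > 0" and e: "e > 0"
    and b: "\<And>g. g > 0 \<Longrightarrow> eventually (\<lambda>n. b - g < beta_n \<nu> n q) sequentially"
    and lo: "bet (q - h) < b + (a + e) * h" and hi: "bet (q + h) < b - (a - e) * h"
  shows "eventually (\<lambda>n. 2 powr (real n * (b + (a - e) * q - e)) \<le>
     real (card {k. k < 2 ^ n \<and> 2 powr (- (real n * (a + e))) \<le> mass n k})) sequentially"
proof -
  \<comment> \<open>A common slack: the tails \<open>L\<close> and \<open>H\<close> contribute at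
    most \<open>2 powr (n * (b - 3 * g))\<close> each, against a total of at least
    \<open>2 powr (n * (b - g))\<close>. Once \<open>n * g > 1\<close>, the factors 4 and 2 below
    are absorbed. The bound \<open>g \<le> e / 2\<close> limits the final loss in the exponent to
    \<open>e\<close>.\<close>
  define g where "g = min (e / 2) (min ((b + (a + e) * h - bet (q - h)) / 4) ((b - (a - e) * h - bet (q + h)) / 4))"
  have g0: "g > 0" using e lo hi by (simp add: g_def)
  have ge: "g \<le> e / 2" by (simp add: g_def)
  have "g \<le> (b + (a + e) * h - bet (q - h)) / 4" "g \<le> (b - (a - e) * h - bet (q + h)) / 4"
    unfolding g_def by (meson min.cobounded1 min.cobounded2 order_trans)+
  then have glo: "bet (q - h) < b + (a + e) * h - 3 * g" and ghi: "bet (q + h) < b - (a - e) * h - 3 * g"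
    using g0 by argo+
  have q0': "q \<ge> 0" "q + h \<ge> 0" using q by linarith+
  obtain n0 :: nat where n0: "real n0 > 1 / g" using reals_Archimedean2 by blast
  show ?thesis
    using b[OF g0] bet_less[OF q(1) glo] bet_less[OF q0'(2) ghi] eventually_ge_at_top[of "max 1 n0"]
  proof eventually_elim
    case (elim n)
    have n: "n \<ge> 1" "1 < real n * g"
    proof -
      show "n \<ge> 1" using elim by simp
      have "1 / g < real n" using elim n0 by simp
      then show "1 < real n * g" using g0 by (simp add: field_simps)
    qed
    define L where "L = {k \<in> pos_idx n. mass n k < 2 powr (- (real n * (a + e)))}"
    define H where "H = {k \<in> pos_idx n. 2 powr (- (real n * (a - e))) < mass n k}"
    define M where "M = {k \<in> pos_idx n. 2 powr (- (real n * (a + e))) \<le> mass n k \<and> mass n k \<le> 2 powr (- (real n * (a - e)))}"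
    have fin: "finite L" "finite H" "finite M" by (auto simp: L_def H_def M_def)
    have "psum n q \<le> (\<Sum>k\<in>L \<union> H \<union> M. mass n k powr q)"
      unfolding psum_def by (intro sum_mono2) (use fin in \<open>auto simp: L_def H_def M_def\<close>)
    also have "\<dots> \<le> (\<Sum>k\<in>L. mass n k powr q) + (\<Sum>k\<in>H. mass n k powr q) + (\<Sum>k\<in>M. mass n k powr q)"
      using sum_Un_le[of "L \<union> H" M "\<lambda>k. mass n k powr q"] sum_Un_le[of L H "\<lambda>k. mass n k powr q"] fin by simp
    finally have split: "psum n q \<le> (\<Sum>k\<in>L. mass n k powr q) + (\<Sum>k\<in>H. mass n k powr q) + (\<Sum>k\<in>M. mass n k powr q)" .
    have Lsum: "(\<Sum>k\<in>L. mass n k powr q) \<le> 2 powr (real n * (b - 3 * g))"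
    proof -
      have "(\<Sum>k\<in>L. mass n k powr q) \<le> (\<Sum>k\<in>L. mass n k powr (q - h) * 2 powr (- (real n * (a + e) * h)))"
      proof (rule sum_mono)
        fix k assume k: "k \<in> L"
        have "mass n k powr q = mass n k powr (q - h) * mass n k powr h" by (simp add: powr_add[symmetric])
        also have "mass n k powr h \<le> (2 powr (- (real n * (a + e)))) powr h"
          using k q by (intro powr_mono2) (auto simp: L_def)
        finally show "mass n k powr q \<le> mass n k powr (q - h) * 2 powr (- (real n * (a + e) * h))"
          by (simp add: powr_powr mult_left_mono)
      qed
      also have "\<dots> = (\<Sum>k\<in>L. mass n k powr (q - h)) * 2 powr (- (real n * (a + e) * h))" by (simp add: sum_distrib_right)
      also have "\<dots> \<le> psum n (q - h) * 2 powr (- (real n * (a + e) * h))"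
        unfolding psum_def by (intro mult_right_mono sum_mono2) (auto simp: L_def)
      also have "\<dots> = 2 powr (real n * (beta_n \<nu> n (q - h) - (a + e) * h))"
        unfolding psum_beta_n[OF n(1)] by (simp add: powr_add[symmetric] algebra_simps)
      also have "\<dots> \<le> 2 powr (real n * (b - 3 * g))" using elim by (intro powr_mono mult_left_mono) auto
      finally show ?thesis .
    qed
    have Hsum: "(\<Sum>k\<in>H. mass n k powr q) \<le> 2 powr (real n * (b - 3 * g))"
    proof -
      have "(\<Sum>k\<in>H. mass n k powr q) \<le> (\<Sum>k\<in>H. mass n k powr (q + h) * 2 powr (real n * (a - e) * h))"
      proof (rule sum_mono)
        fix k assume k: "k \<in> H"
        then have m: "mass n k > 0" by (simp add: H_def pos_idx_def)
        have "mass n k powr q = mass n k powr (q + h) * mass n k powr (- h)" by (simp add: powr_add[symmetric])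
        also have "mass n k powr (- h) \<le> (2 powr (- (real n * (a - e)))) powr (- h)"
          using k q by (intro powr_mono2') (auto simp: H_def)
        finally show "mass n k powr q \<le> mass n k powr (q + h) * 2 powr (real n * (a - e) * h)"
          by (simp add: powr_powr mult_left_mono)
      qed
      also have "\<dots> = (\<Sum>k\<in>H. mass n k powr (q + h)) * 2 powr (real n * (a - e) * h)" by (simp add: sum_distrib_right)
      also have "\<dots> \<le> psum n (q + h) * 2 powr (real n * (a - e) * h)"
        unfolding psum_def by (intro mult_right_mono sum_mono2) (auto simp: H_def)
      also have "\<dots> = 2 powr (real n * (beta_n \<nu> n (q + h) + (a - e) * h))"
        unfolding psum_beta_n[OF n(1)] by (simp add: powr_add[symmetric] algebra_simps)
      also have "\<dots> \<le> 2 powr (real n * (b - 3 * g))" using elim by (intro powr_mono mult_left_mono) auto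
      finally show ?thesis .
    qed
    have Msum: "(\<Sum>k\<in>M. mass n k powr q) \<le> real (card M) * 2 powr (- (real n * (a - e) * q))"
    proof -
      have "(\<Sum>k\<in>M. mass n k powr q) \<le> (\<Sum>k\<in>M. (2 powr (- (real n * (a - e)))) powr q)"
        using q0' by (intro sum_mono powr_mono2) (auto simp: M_def)
      then show ?thesis by (simp add: powr_powr)
    qed
    have Z: "2 powr (real n * (b - g)) \<le> psum n q"
      unfolding psum_beta_n[OF n(1)] using elim by (intro powr_mono mult_left_mono) auto
    have small: "4 * 2 powr (real n * (b - 3 * g)) \<le> 2 powr (real n * (b - g))"
    proof -
      have "4 * 2 powr (real n * (b - 3 * g)) = 2 powr (2 + real n * (b - 3 * g))" by (simp add: powr_add)
      also have "\<dots> \<le> 2 powr (real n * (b - g))" using n(2) by (intro powr_mono) (argo, simp)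
      finally show ?thesis .
    qed
    have half: "2 * 2 powr (real n * (b - 2 * g)) \<le> 2 powr (real n * (b - g))"
    proof -
      have "2 * 2 powr (real n * (b - 2 * g)) = 2 powr (1 + real n * (b - 2 * g))" by (simp add: powr_add)
      also have "\<dots> \<le> 2 powr (real n * (b - g))" using n(2) by (intro powr_mono) (argo, simp)
      finally show ?thesis .
    qed
    have "2 powr (real n * (b - 2 * g)) \<le> real (card M) * 2 powr (- (real n * (a - e) * q))"
      using split Lsum Hsum Msum Z small half by linarith
    then have "2 powr (real n * (b - 2 * g)) * 2 powr (real n * (a - e) * q) \<le>
        real (card M) * 2 powr (- (real n * (a - e) * q)) * 2 powr (real n * (a - e) * q)"
      by (rule mult_right_mono) simp
    then have "2 powr (real n * (b - 2 * g) + real n * (a - e) * q) \<le> real (card M)"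
      by (simp add: mult.assoc powr_add[symmetric])
    moreover have "2 powr (real n * (b + (a - e) * q - e)) \<le> 2 powr (real n * (b - 2 * g) + real n * (a - e) * q)"
    proof (rule powr_mono)
      have "real n * (b + (a - e) * q - e) \<le> real n * (b - 2 * g + (a - e) * q)" using ge by (intro mult_left_mono) auto
      then show "real n * (b + (a - e) * q - e) \<le> real n * (b - 2 * g) + real n * (a - e) * q" by (simp add: algebra_simps)
    qed simp
    moreover have "card M \<le> card {k. k < 2 ^ n \<and> 2 powr (- (real n * (a + e))) \<le> mass n k}"
      by (intro card_mono) (auto simp: M_def pos_idx_def)
    ultimately show ?case by linarith
  qed
qed

text \<open>The count of the large deviation estimate gives the exponent (b + (a - e) q - e)/(1 + a
  + e). As \<open>q \<le> b\<close>, the numerator is at least q (1 + a) - e q - e, which is where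
  \<open>q - 3 * e\<close> comes from. If the numerator is not positive, then
  \<open>q \<le> 3 * e\<close> and nonnegativity of the counting exponent suffices.\<close>

lemma s_lower_ge_LD:
  assumes q: "0 \<le> q - h" "h > 0" "q \<le> 1" and e: "e > 0" and a: "a \<ge> 0"
    and b: "beta_lower \<nu> q = ereal b" "q \<le> b"
    and lo: "bet (q - h) < b + (a + e) * h" and hi: "bet (q + h) < b - (a - e) * h"
  shows "ereal (q - 3 * e) \<le> s_lower \<nu>"
proof (cases "b + (a - e) * q - e > 0")
  case True
  have bb: "eventually (\<lambda>n. b - g < beta_n \<nu> n q) sequentially" if "g > 0" for g
  proof -
    have "ereal (b - g) < liminf (\<lambda>n. ereal (beta_n \<nu> n q))" using b(1) that by (simp add: beta_lower_def)
    from less_LiminfD[OF this] show ?thesis by simp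
  qed
  have "ereal ((b + (a - e) * q - e) / (1 + (a + e))) \<le> s_lower \<nu>"
    using a e True by (intro s_lower_ge_count large_deviation[OF q(1,2) e bb lo hi]) auto
  moreover have "q - 3 * e \<le> (b + (a - e) * q - e) / (1 + (a + e))"
  proof -
    have "(q - 3 * e) * (1 + (a + e)) \<le> b + (a - e) * q - e"
    proof -
      have "0 \<le> 3 * e * a + 3 * (e * e)" "2 * (e * q) \<le> 2 * (e * 1)"
        using a e q by (auto intro!: mult_left_mono)
      then show ?thesis using b(2) by (simp add: algebra_simps)
    qed
    then show ?thesis using a e by (simp add: pos_le_divide_eq)
  qed
  ultimately show ?thesis by (meson ereal_less_eq(3) order_trans)
next
  case False
  have "q - 3 * e \<le> 0"
  proof -
    have "e * q \<le> e * 1" "0 \<le> a * q" using q e a by (auto intro!: mult_left_mono)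
    then show ?thesis using False b(2) e by argo
  qed
  then have "ereal (q - 3 * e) \<le> 0" by (simp add: zero_ereal_def)
  then show ?thesis using s_lower_nonneg by (rule order_trans)
qed

lemma bet_three:
  assumes "0 \<le> x" "x < y" "y < z"
  shows "(z - x) * bet y \<le> (z - y) * bet x + (y - x) * bet z"
proof -
  define t where "t = (y - x) / (z - x)"
  have t: "0 \<le> t" "t \<le> 1" using assms by (auto simp: t_def divide_le_eq)
  have t1: "(z - x) * t = y - x" using assms by (simp add: t_def)
  then have t2: "(z - x) * (1 - t) = z - y" by argo
  have y: "(1 - t) * x + t * z = y" using t1 by argo
  have "bet y \<le> (1 - t) * bet x + t * bet z"
    using bet_convex[of x z t] assms t unfolding y by simp
  then have "(z - x) * bet y \<le> (z - x) * ((1 - t) * bet x + t * bet z)"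
    using assms by (intro mult_left_mono) auto
  also have "\<dots> = ((z - x) * (1 - t)) * bet x + ((z - x) * t) * bet z" by (simp only: distrib_left mult.assoc)
  finally show ?thesis unfolding t1 t2 .
qed

text \<open>Replaces the almost everywhere differentiability of convex functions: the second differences
  over an equidistant partition telescope.\<close>

lemma ex_almost_affine:
  assumes "0 < u" "u < v" "e > 0"
  shows "\<exists>q h. h > 0 \<and> u \<le> q - h \<and> q + h \<le> v \<and> bet (q - h) + bet (q + h) - 2 * bet q < 2 * e * h"
proof -
  \<comment> \<open>By convexity on [0, u + h], \<open>bet\<close> falls at a rate of at most
    \<open>K\<close> to the right of \<open>u\<close>. Second differences all at least
    \<open>2 * e * h\<close> would have to add up to no more than \<open>K * h\<close>, and
    \<open>N\<close> is too large for that.\<close>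
  define K where "K = (bet 0 - bet u) / u"
  obtain N :: nat where N: "real N > K / (2 * e)" using reals_Archimedean2 by blast
  define h where "h = (v - u) / real (N + 2)"
  have h: "h > 0" using assms by (simp add: h_def)
  define t where "t i = u + real i * h" for i :: nat
  have tN: "t (N + 2) = v" by (simp add: t_def h_def)
  show ?thesis
  proof (rule ccontr)
    assume "\<not> ?thesis"
    then have no: "2 * e * h \<le> bet (q - h) + bet (q + h) - 2 * bet q" if "u \<le> q - h" "q + h \<le> v" for q
      using h that by (meson not_less)
    have "2 * e * h \<le> bet (t i) + bet (t (i + 2)) - 2 * bet (t (i + 1))" if "i \<le> N" for i
    proof -
      have "real (i + 2) * h \<le> real (N + 2) * h" using that h by (intro mult_right_mono) auto
      then have "t (i + 1) + h \<le> v" unfolding tN[symmetric] by (simp add: t_def algebra_simps)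
      moreover have "0 \<le> real i * h" using h by simp
      ultimately have "2 * e * h \<le> bet (t (i + 1) - h) + bet (t (i + 1) + h) - 2 * bet (t (i + 1))"
        by (intro no) (auto simp: t_def algebra_simps)
      moreover have "t (i + 1) - h = t i" "t (i + 1) + h = t (i + 2)" by (simp_all add: t_def algebra_simps)
      ultimately show ?thesis by simp
    qed
    then have "(\<Sum>i\<le>N. 2 * e * h) \<le> (\<Sum>i\<le>N. bet (t i) + bet (t (i + 2)) - 2 * bet (t (i + 1)))"
      by (intro sum_mono) auto
    also have "\<dots> = (bet (t 0) - bet (t 1)) - (bet (t (N + 1)) - bet (t (N + 2)))"
      by (induction N) (simp_all add: numeral_2_eq_2)
    also have "\<dots> \<le> bet (t 0) - bet (t 1)"
      using bet_antimono[of "t (N + 1)" "t (N + 2)"] assms h by (simp add: t_def)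
    also have "\<dots> \<le> h * K"
    proof -
      have "(u + h - 0) * bet u \<le> (u + h - u) * bet 0 + (u - 0) * bet (u + h)"
        using assms h by (intro bet_three) auto
      then have "u * (bet u - bet (u + h)) \<le> h * (bet 0 - bet u)" by (simp add: algebra_simps)
      then show ?thesis using assms by (simp add: K_def t_def field_simps)
    qed
    finally have "h * (real (N + 1) * (2 * e)) \<le> h * K" by (simp add: algebra_simps)
    then have "real (N + 1) * (2 * e) \<le> K" using h by simp
    moreover have "K < real N * (2 * e)" using N assms by (simp add: field_simps)
    ultimately show False using assms by (simp add: algebra_simps)
  qed
qed

text \<open>Both alternatives supply an exponent at which upper and lower limit agree,
  \<open>bet q \<ge> q\<close> holds and the graph is nearly straight. In the first it is found
  close to the left of \<open>q0\<close> by \<open>ex_almost_affine\<close>; in the second it is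
  \<open>q0\<close> itself with the slope given by the derivative.\<close>

lemma s_lower_ge:
  assumes "Lq_regular \<nu>"
  shows "ereal q0 \<le> s_lower \<nu>"
proof (cases "q0 = 0")
  case True then show ?thesis using s_lower_nonneg by (simp add: zero_ereal_def)
next
  case False
  then have q0: "q0 > 0" using q0_bounds by simp
  from assms consider (a) "\<exists>\<epsilon>>0. \<forall>q\<in>{q0 - \<epsilon> <..< q0}. beta \<nu> q = beta_lower \<nu> q"
    | (b) "beta \<nu> q0 = beta_lower \<nu> q0" "ereal_differentiable_at (beta \<nu>) q0"
    by (auto simp: Lq_regular_def)
  then show ?thesis
  proof cases
    case a
    then obtain \<epsilon> where \<epsilon>: "\<epsilon> > 0" "\<And>q. q0 - \<epsilon> < q \<Longrightarrow> q < q0 \<Longrightarrow> beta \<nu> q = beta_lower \<nu> q" by auto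
    have main: "ereal (u - 3 * e) \<le> s_lower \<nu>" if u: "0 < u" "q0 - \<epsilon> < u" "u < q0" and e: "e > 0" for u e
    proof -
      define v where "v = (u + q0) / 2"
      have v: "u < v" "v < q0" using u by (auto simp: v_def)
      obtain q h where qh: "h > 0" "u \<le> q - h" "q + h \<le> v" "bet (q - h) + bet (q + h) - 2 * bet q < 2 * e * h"
        using ex_almost_affine[OF u(1) v(1) e] by blast
      \<comment> \<open>The symmetric difference quotient, with the sign changed. The second
        difference is less than \<open>2 * e * h\<close>, so both one-sided increments stay within
        \<open>e * h\<close> of the line with slope \<open>- al\<close>.\<close>
      define al where "al = (bet (q - h) - bet (q + h)) / (2 * h)"
      have al: "al * h = (bet (q - h) - bet (q + h)) / 2" using qh by (simp add: al_def)
      have "bet (q + h) \<le> bet (q - h)" using qh u by (intro bet_antimono) auto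
      then have al0: "al \<ge> 0" using qh by (simp add: al_def)
      have q: "q < q0" "q0 - \<epsilon> < q" "0 \<le> q" using qh v u by linarith+
      have "beta_lower \<nu> q = ereal (bet q)" using \<epsilon>(2)[OF q(2,1)] beta_bet[OF q(3)] by simp
      moreover have "q \<le> bet q" using bet_ge_q0[OF q(3,1)] q by simp
      moreover have "bet (q - h) < bet q + (al + e) * h" using qh al by argo
      moreover have "bet (q + h) < bet q - (al - e) * h" using qh al by argo
      ultimately have "ereal (q - 3 * e) \<le> s_lower \<nu>"
        using qh u q q0_bounds e al0 by (intro s_lower_ge_LD[of q h e al "bet q"]) auto
      moreover have "u \<le> q" using qh by linarith
      ultimately show ?thesis by (meson diff_right_mono ereal_less_eq(3) order_trans)
    qed
    show ?thesis
    proof (rule ereal_le_epsilon2)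
      fix e :: real assume e: "e > 0"
      define u where "u = max (q0 / 2) (max (q0 - \<epsilon> / 2) (q0 - e / 2))"
      have "ereal (u - 3 * (e / 6)) \<le> s_lower \<nu>"
        using q0 \<epsilon> e by (intro main) (auto simp: u_def less_max_iff_disj)
      moreover have "q0 - e \<le> u - 3 * (e / 6)" 
      proof -
        have "q0 - e / 2 \<le> u" by (simp only: u_def le_max_iff_disj order_refl simp_thms)
        then show ?thesis by argo
      qed
      ultimately have "ereal (q0 - e) \<le> s_lower \<nu>" by (meson ereal_less_eq(3) order_trans)
      then show "ereal q0 \<le> s_lower \<nu> + ereal e"
        by (cases "s_lower \<nu>") auto
    qed
  next
    case b
    have "bet differentiable (at q0)" using b(2) by (simp add: ereal_differentiable_at_def bet_def[abs_def])
    then obtain D where D: "(bet has_real_derivative D) (at q0)" by (auto simp: real_differentiable_def)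
    have lowb: "beta_lower \<nu> q0 = ereal q0" using b(1) beta_bet[of q0] bet_q0[OF q0] q0 by simp
    have main: "ereal (q0 - 3 * e) \<le> s_lower \<nu>" if e: "e > 0" for e
    proof -
      have "((\<lambda>h. (bet (q0 + h) - bet q0) / h) \<longlongrightarrow> D) (at 0)" using D by (simp add: DERIV_def)
      then have "eventually (\<lambda>h. dist ((bet (q0 + h) - bet q0) / h) D < e) (at 0)"
        using e by (rule tendstoD)
      then obtain d where d: "d > 0" "\<And>h. h \<noteq> 0 \<Longrightarrow> \<bar>h\<bar> < d \<Longrightarrow> \<bar>(bet (q0 + h) - bet q0) / h - D\<bar> < e"
        by (auto simp: eventually_at dist_real_def)
      define h where "h = min (d / 2) q0"
      have h: "h > 0" "h \<le> q0" "h < d" using d q0 by (auto simp: h_def min_def)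
      have 1: "\<bar>(bet (q0 + h) - bet q0) / h - D\<bar> < e" using d(2)[of h] h by simp
      have 2: "\<bar>(bet (q0 - h) - bet q0) / (- h) - D\<bar> < e" using d(2)[of "- h"] h by simp
      have hi: "bet (q0 + h) < q0 + (D + e) * h"
      proof -
        have "(bet (q0 + h) - bet q0) / h < D + e" using 1 by linarith
        then show ?thesis using h bet_q0[OF q0] by (simp add: field_simps)
      qed
      have lo: "bet (q0 - h) < q0 + (e - D) * h"
      proof -
        have "- ((bet (q0 - h) - bet q0) / h) > D - e" using 2 by simp
        then have "(bet (q0 - h) - bet q0) / h < e - D" by linarith
        then show ?thesis using h bet_q0[OF q0] by (simp add: field_simps)
      qed
      have D0: "D \<le> 0"
      proof (rule ccontr)
        assume "\<not> D \<le> 0"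
        then have "D > 0" by simp
        then obtain d where d: "d > 0" "\<And>h. 0 < h \<Longrightarrow> h < d \<Longrightarrow> bet q0 < bet (q0 + h)"
          using has_real_derivative_pos_inc_right[OF D] by auto
        have "bet q0 < bet (q0 + d / 2)" using d by simp
        moreover have "bet (q0 + d / 2) \<le> bet q0" using d(1) q0 by (intro bet_antimono) auto
        ultimately show False by linarith
      qed
      show ?thesis
        using h q0_bounds e D0 lowb hi lo
        by (intro s_lower_ge_LD[of q0 h e "- D" q0]) (auto simp: algebra_simps)
    qed
    show ?thesis
    proof (rule ereal_le_epsilon2)
      fix e :: real assume "e > 0"
      then have "ereal (q0 - 3 * (e / 3)) \<le> s_lower \<nu>" by (intro main) simp
      then show "ereal q0 \<le> s_lower \<nu> + ereal e"
        by (cases "s_lower \<nu>") auto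
    qed
  qed
qed

theorem spectral_dim_eq:
  assumes "Lq_regular \<nu>"
  shows "s_lower \<nu> = ereal q0" "s_upper \<nu> = ereal q0"
  using s_lower_ge[OF assms] s_upper_le s_lower_le_s_upper by (auto intro: antisym)

end

section \<open>Hausdorff and packing measures\<close>

lemma suminf_prod_decode:
  fixes f :: "nat \<Rightarrow> nat \<Rightarrow> ennreal"
  shows "(\<Sum>m. f (fst (prod_decode m)) (snd (prod_decode m))) = (\<Sum>i. \<Sum>j. f i j)"
proof -
  have "(\<Sum>m. f (fst (prod_decode m)) (snd (prod_decode m))) = (\<integral>\<^sup>+m. case_prod f (prod_decode m) \<partial>count_space UNIV)"
    by (simp add: nn_integral_count_space_nat case_prod_unfold)
  also have "\<dots> = (\<integral>\<^sup>+p. case_prod f p \<partial>count_space UNIV)"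
    using bij_prod_decode by (rule nn_integral_bij_count_space)
  also have "\<dots> = (\<integral>\<^sup>+i. \<integral>\<^sup>+j. f i j \<partial>count_space UNIV \<partial>count_space UNIV)"
    using nn_integral_fst_count_space[of "case_prod f"] by simp
  finally show ?thesis by (simp add: nn_integral_count_space_nat)
qed

lemma hausdorff_premeasure_mono: "A \<subseteq> B \<Longrightarrow> hausdorff_premeasure s \<delta> A \<le> hausdorff_premeasure s \<delta> B"
  unfolding hausdorff_premeasure_def by (intro INF_superset_mono) auto

lemma hausdorff_measure_mono: "A \<subseteq> B \<Longrightarrow> hausdorff_measure s A \<le> hausdorff_measure s B"
  unfolding hausdorff_measure_def by (intro SUP_mono) (use hausdorff_premeasure_mono in blast)

text \<open>Nearly optimal covers of the pieces, with errors e/2^(i+1), are joined into one sequence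
  by the pairing function.\<close>

lemma hausdorff_premeasure_UN:
  "hausdorff_premeasure s \<delta> (\<Union>i::nat. E i) \<le> (\<Sum>i. hausdorff_premeasure s \<delta> (E i))"
proof (rule ennreal_le_epsilon)
  fix e :: real assume fin: "(\<Sum>i. hausdorff_premeasure s \<delta> (E i)) < top" and e: "0 < e"
  define d where "d i = ennreal (e * (1 / 2) ^ Suc i)" for i
  have "\<exists>U. (\<forall>j. bounded (U j) \<and> diameter (U j) \<le> \<delta>) \<and> E i \<subseteq> (\<Union>j::nat. U j) \<and>
      (\<Sum>j. diam_pow s (U j)) \<le> hausdorff_premeasure s \<delta> (E i) + d i" for i
  proof -
    have "hausdorff_premeasure s \<delta> (E i) < top"
      using fin by (rule ennreal_suminf_lessD)
    moreover have "0 < d i" using e by (simp add: d_def)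
    ultimately have "hausdorff_premeasure s \<delta> (E i) < hausdorff_premeasure s \<delta> (E i) + d i"
      using e by (cases "hausdorff_premeasure s \<delta> (E i)")
        (auto simp: d_def ennreal_plus[symmetric] ennreal_less_iff simp del: ennreal_plus)
    then have "\<exists>U\<in>{U :: nat \<Rightarrow> real set. (\<forall>i. bounded (U i) \<and> diameter (U i) \<le> \<delta>) \<and> E i \<subseteq> (\<Union>i. U i)}.
        (\<Sum>i. diam_pow s (U i)) < hausdorff_premeasure s \<delta> (E i) + d i"
      by (subst (asm) (1) hausdorff_premeasure_def) (simp only: INF_less_iff)
    then show ?thesis by (auto intro: less_imp_le)
  qed
  then obtain U where U: "\<And>i j. bounded (U i j)" "\<And>i j. diameter (U i j) \<le> \<delta>" "\<And>i. E i \<subseteq> (\<Union>j::nat. U i j)"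
      "\<And>i. (\<Sum>j. diam_pow s (U i j)) \<le> hausdorff_premeasure s \<delta> (E i) + d i" by metis
  define W where "W m = U (fst (prod_decode m)) (snd (prod_decode m))" for m
  have "(\<Union>i. E i) \<subseteq> (\<Union>m. W m)"
  proof
    fix x assume "x \<in> (\<Union>i. E i)"
    then obtain i j where "x \<in> U i j" using U(3) by blast
    then have "x \<in> W (prod_encode (i, j))" by (simp add: W_def)
    then show "x \<in> (\<Union>m. W m)" by blast
  qed
  then have "hausdorff_premeasure s \<delta> (\<Union>i. E i) \<le> (\<Sum>m. diam_pow s (W m))"
    unfolding hausdorff_premeasure_def using U(1,2) by (intro INF_lower) (auto simp: W_def)
  also have "\<dots> = (\<Sum>i. \<Sum>j. diam_pow s (U i j))" unfolding W_def by (rule suminf_prod_decode)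
  also have "\<dots> \<le> (\<Sum>i. hausdorff_premeasure s \<delta> (E i) + d i)" using U(4) by (intro suminf_le) auto
  also have "\<dots> = (\<Sum>i. hausdorff_premeasure s \<delta> (E i)) + (\<Sum>i. d i)" by (rule suminf_add[symmetric]) auto
  also have "(\<Sum>i. d i) = ennreal e"
  proof -
    have "(\<lambda>i. e * (1 / 2) ^ Suc i) sums (e * 1)" by (intro sums_mult power_half_series)
    then show ?thesis unfolding d_def using e by (intro suminf_ennreal_eq) auto
  qed
  finally show "hausdorff_premeasure s \<delta> (\<Union>i. E i) \<le> (\<Sum>i. hausdorff_premeasure s \<delta> (E i)) + ennreal e" .
qed

lemma hausdorff_premeasure_le_measure: "\<delta> > 0 \<Longrightarrow> hausdorff_premeasure s \<delta> E \<le> hausdorff_measure s E"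
  unfolding hausdorff_measure_def by (intro SUP_upper) auto

lemma hausdorff_measure_UN: "hausdorff_measure s (\<Union>i::nat. E i) \<le> (\<Sum>i. hausdorff_measure s (E i))"
  unfolding hausdorff_measure_def[of s "\<Union>i. E i"]
proof (rule SUP_least)
  fix \<delta> :: real assume d: "\<delta> \<in> {0<..}"
  have "hausdorff_premeasure s \<delta> (\<Union>i. E i) \<le> (\<Sum>i. hausdorff_premeasure s \<delta> (E i))"
    by (rule hausdorff_premeasure_UN)
  also have "\<dots> \<le> (\<Sum>i. hausdorff_measure s (E i))"
    using d by (intro suminf_le hausdorff_premeasure_le_measure) auto
  finally show "hausdorff_premeasure s \<delta> (\<Union>i. E i) \<le> (\<Sum>i. hausdorff_measure s (E i))" .
qed

text \<open>The premeasure is defined by sequences. A finite cover is continued by empty sets, which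
  cost nothing even for \<open>s = 0\<close> by the convention in \<open>diam_pow\<close>.\<close>

lemma hausdorff_premeasure_finite_cover:
  assumes "finite I" "\<And>i. i \<in> I \<Longrightarrow> bounded (U i)" "\<And>i. i \<in> I \<Longrightarrow> diameter (U i) \<le> \<delta>" "E \<subseteq> (\<Union>i\<in>I. U i)" "\<delta> \<ge> 0"
  shows "hausdorff_premeasure s \<delta> E \<le> (\<Sum>i\<in>I. diam_pow s (U i))"
proof -
  obtain h where h: "bij_betw h {0..<card I} I" using ex_bij_betw_nat_finite[OF assms(1)] by blast
  define V where "V m = (if m < card I then U (h m) else {})" for m
  have hI: "h m \<in> I" if "m < card I" for m using h that by (auto simp: bij_betw_def)
  have "E \<subseteq> (\<Union>m. V m)"
  proof
    fix x assume "x \<in> E"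
    then obtain i where "i \<in> I" "x \<in> U i" using assms(4) by blast
    moreover obtain m where "m < card I" "h m = i"
      using h \<open>i \<in> I\<close> by (metis atLeastLessThan_iff bij_betw_def imageE)
    ultimately show "x \<in> (\<Union>m. V m)" by (auto simp: V_def)
  qed
  then have "hausdorff_premeasure s \<delta> E \<le> (\<Sum>m. diam_pow s (V m))"
    unfolding hausdorff_premeasure_def using assms hI by (intro INF_lower) (auto simp: V_def)
  also have "\<dots> = (\<Sum>m<card I. diam_pow s (V m))"
    by (rule suminf_finite) (auto simp: V_def diam_pow_def)
  also have "\<dots> = (\<Sum>m\<in>{0..<card I}. diam_pow s (U (h m)))"
    by (rule sum.cong) (auto simp: V_def)
  also have "\<dots> = (\<Sum>i\<in>I. diam_pow s (U i))" by (rule sum.reindex_bij_betw[OF h])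
  finally show ?thesis .
qed

lemma diam_pow_cball_scale:
  assumes "r > 0" "s \<ge> 0"
  shows "ennreal (2 powr (- s)) * diam_pow s (cball (x::real) (2 * r)) = diam_pow s (cball y r)"
proof -
  have ne: "cball x (2 * r) \<noteq> {}" "cball y r \<noteq> {}" using assms by auto
  show ?thesis
  proof (cases "s = 0")
    case False
    have "2 powr (- s) * (4 * r) powr s = (2 * r) powr s"
    proof -
      have "(4 * r) powr s = 2 powr s * (2 * r) powr s" using assms by (simp add: powr_mult[symmetric])
      then show ?thesis by (simp add: mult.assoc[symmetric] powr_add[symmetric])
    qed
    then show ?thesis using assms False ne by (simp add: diam_pow_def ennreal_mult[symmetric])
  qed (use ne in \<open>simp add: diam_pow_def\<close>)
qed

lemma diam_pow_cball_pos: "r > 0 \<Longrightarrow> diam_pow s (cball (x::real) r) > 0"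
  by (auto simp: diam_pow_def)

text \<open>For a maximal set \<open>C\<close> of points of \<open>B\<close> at mutual distance
  above 2r, the balls of radius r form a packing and those of radius 2r a cover. Passing from one
  radius to the other costs the factor \<open>2 powr (- s)\<close>.\<close>

lemma hausdorff_le_packing:
  assumes s: "s \<ge> 0"
  shows "ennreal (2 powr (- s)) * hausdorff_measure s B \<le> packing_premeasure s B"
  unfolding packing_premeasure_def
proof (rule INF_greatest)
  fix \<delta>' :: real assume d': "\<delta>' \<in> {0<..}"
  let ?S = "SUP F\<in>packings \<delta>' B. \<Sum>\<^sub>\<infinity>(x, r)\<in>F. diam_pow s (cball x r)"
  have "ennreal (2 powr (- s)) * hausdorff_premeasure s \<delta> B \<le> ?S" if d: "\<delta> > 0" for \<delta>
  proof (cases "?S = top")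
    case True show ?thesis unfolding True by (rule top_greatest)
  next
    case False
    \<comment> \<open>The covering balls have diameter \<open>4 * r\<close>, at most \<delta>; the
      packing balls have radius \<open>r\<close>, at most \<delta>'.\<close>
    define r where "r = min (\<delta> / 4) \<delta>'"
    have r: "r > 0" "4 * r \<le> \<delta>" "r \<le> \<delta>'" using d d' by (auto simp: r_def min_def)
    define sep where "sep C \<longleftrightarrow> finite C \<and> C \<subseteq> B \<and> (\<forall>x\<in>C. \<forall>y\<in>C. x \<noteq> y \<longrightarrow> \<bar>x - y\<bar> > 2 * r)" for C
    have cS: "of_nat (card C) * diam_pow s (cball 0 r) \<le> ?S" if C: "sep C" for C
    proof -
      have "(\<lambda>x. (x, r)) ` C \<in> packings \<delta>' B"
        unfolding packings_def
      proof (intro CollectI conjI)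
        show "\<forall>(x, r)\<in>(\<lambda>x. (x, r)) ` C. x \<in> B \<and> 0 < r \<and> r \<le> \<delta>'" using C r by (auto simp: sep_def)
        show "disjoint_family_on (\<lambda>(x, r). cball x r) ((\<lambda>x. (x, r)) ` C)"
          using C by (force simp: disjoint_family_on_def sep_def dist_real_def)
      qed
      then have "(\<Sum>\<^sub>\<infinity>(x, r)\<in>(\<lambda>x. (x, r)) ` C. diam_pow s (cball x r)) \<le> ?S" by (rule SUP_upper)
      moreover have "(\<Sum>\<^sub>\<infinity>(x, r)\<in>(\<lambda>x. (x, r)) ` C. diam_pow s (cball x r)) = (\<Sum>x\<in>C. diam_pow s (cball x r))"
        using C by (subst infsum_finite) (auto simp: sep_def sum.reindex inj_on_def)
      moreover have "diam_pow s (cball x r) = diam_pow s (cball 0 r)" for x :: real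
        using r by (auto simp: diam_pow_def)
      then have "(\<Sum>x\<in>C. diam_pow s (cball x r)) = (\<Sum>x\<in>C. diam_pow s (cball 0 r))"
        by (intro sum.cong refl)
      ultimately show ?thesis by simp
    qed
    \<comment> \<open>All balls of radius \<open>r\<close> have the same positive weight, so
      separated sets of unbounded size would make the supremum over packings infinite.\<close>
    have "\<exists>N. \<forall>C. sep C \<longrightarrow> card C < N"
    proof (rule ccontr)
      assume no: "\<not> ?thesis"
      have "of_nat n * diam_pow s (cball 0 r) \<le> ?S" for n
      proof -
        obtain C where C: "sep C" "\<not> card C < n" using no by blast
        have "of_nat n * diam_pow s (cball 0 r) \<le> of_nat (card C) * diam_pow s (cball 0 r)"
          using C by (intro mult_right_mono) auto
        also have "\<dots> \<le> ?S" using cS C by blast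
        finally show ?thesis .
      qed
      then have "(SUP n. of_nat n * diam_pow s (cball 0 r)) \<le> ?S" by (rule SUP_least)
      moreover have "diam_pow s (cball (0::real) r) \<noteq> 0"
        using diam_pow_cball_pos[OF r(1), of s 0] by (metis order_less_irrefl)
      ultimately have "top \<le> ?S"
        using diam_pow_cball_pos[OF r(1), of s 0] by (simp add: ennreal_SUP_of_nat_eq_top SUP_mult_right_ennreal[symmetric] ennreal_mult_eq_top_iff ennreal_top_mult)
      then show False using False by (simp add: top_unique)
    qed
    moreover have "sep {}" by (simp add: sep_def)
    ultimately obtain C where C: "sep C" "\<And>C'. sep C' \<Longrightarrow> card C' \<le> card C"
      using ex_has_greatest_nat[of sep "{}" card] by (metis order_less_imp_le)
    have cov: "B \<subseteq> (\<Union>x\<in>C. cball x (2 * r))"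
    proof
      fix y assume y: "y \<in> B"
      show "y \<in> (\<Union>x\<in>C. cball x (2 * r))"
      proof (rule ccontr)
        assume no: "y \<notin> (\<Union>x\<in>C. cball x (2 * r))"
        then have far: "\<bar>x - y\<bar> > 2 * r" if "x \<in> C" for x using that by (auto simp: dist_real_def)
        then have "y \<notin> C" using r by force
        have "sep (insert y C)" using C(1) y far by (auto simp: sep_def abs_minus_commute)
        from C(2)[OF this] show False using \<open>y \<notin> C\<close> C(1) by (simp add: sep_def)
      qed
    qed
    have "hausdorff_premeasure s \<delta> B \<le> (\<Sum>x\<in>C. diam_pow s (cball x (2 * r)))"
      using C(1) cov r d by (intro hausdorff_premeasure_finite_cover) (auto simp: sep_def)
    then have "ennreal (2 powr (- s)) * hausdorff_premeasure s \<delta> B \<le> ennreal (2 powr (- s)) * (\<Sum>x\<in>C. diam_pow s (cball x (2 * r)))"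
      by (rule mult_left_mono) simp
    also have "\<dots> = (\<Sum>x\<in>C. diam_pow s (cball 0 r))"
      unfolding sum_distrib_left using r s by (intro sum.cong diam_pow_cball_scale) auto
    also have "\<dots> \<le> ?S" using cS[OF C(1)] by simp
    finally show ?thesis .
  qed
  then show "ennreal (2 powr (- s)) * hausdorff_measure s B \<le> ?S"
    unfolding hausdorff_measure_def by (subst SUP_mult_left_ennreal) (auto intro: SUP_least)
qed

lemma hausdorff_dim_le_packing_dim: "hausdorff_dim A \<le> packing_dim A"
  unfolding hausdorff_dim_def packing_dim_def
proof (rule Inf_superset_mono, safe)
  fix s :: real assume s: "s \<ge> 0" "packing_measure s A = 0"
  have "ennreal (2 powr (- s)) * hausdorff_measure s A \<le> packing_measure s A"
    unfolding packing_measure_def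
  proof (rule INF_greatest)
    fix B :: "nat \<Rightarrow> real set" assume B: "B \<in> {B. A \<subseteq> (\<Union>i. B i)}"
    have "hausdorff_measure s A \<le> hausdorff_measure s (\<Union>i. B i)" using B by (intro hausdorff_measure_mono) auto
    also have "\<dots> \<le> (\<Sum>i. hausdorff_measure s (B i))" by (rule hausdorff_measure_UN)
    finally have "ennreal (2 powr (- s)) * hausdorff_measure s A \<le> ennreal (2 powr (- s)) * (\<Sum>i. hausdorff_measure s (B i))"
      by (rule mult_left_mono) simp
    also have "\<dots> = (\<Sum>i. ennreal (2 powr (- s)) * hausdorff_measure s (B i))" by simp
    also have "\<dots> \<le> (\<Sum>i. packing_premeasure s (B i))"
      using s by (intro suminf_le hausdorff_le_packing) auto
    finally show "ennreal (2 powr (- s)) * hausdorff_measure s A \<le> (\<Sum>i. packing_premeasure s (B i))" .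
  qed
  then have "hausdorff_measure s A = 0" using s by simp
  then show "\<exists>s'. ereal s = ereal s' \<and> 0 \<le> s' \<and> hausdorff_measure s' A = 0" using s by blast
qed

lemma hausdorff_dim_nonneg: "0 \<le> hausdorff_dim A"
  unfolding hausdorff_dim_def by (rule Inf_greatest) auto

section \<open>The Minkowski dimension of the support\<close>

lemma covering_number_le:
  assumes "finite F" "\<And>U. U \<in> F \<Longrightarrow> bounded U \<and> diameter U \<le> \<delta>" "E \<subseteq> \<Union>F"
  shows "covering_number \<delta> E \<le> card F"
  unfolding covering_number_def by (rule Least_le) (use assms in blast)

text \<open>The minimum is attained only because some finite cover exists; without one,
  \<open>LEAST\<close> would be unspecified.\<close>

lemma covering_number_obtain:
  assumes "finite F" "\<And>U. U \<in> F \<Longrightarrow> bounded U \<and> diameter U \<le> \<delta>" "E \<subseteq> \<Union>F"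
  obtains G where "finite G" "card G = covering_number \<delta> E" "\<And>U. U \<in> G \<Longrightarrow> bounded U \<and> diameter U \<le> \<delta>" "E \<subseteq> \<Union>G"
proof -
  have "\<exists>m. \<exists>F. finite F \<and> card F = m \<and> (\<forall>U\<in>F. bounded U \<and> diameter U \<le> \<delta>) \<and> E \<subseteq> \<Union>F"
    using assms by blast
  from LeastI_ex[OF this] show thesis using that unfolding covering_number_def by blast
qed

context unit_interval_measure
begin

text \<open>The closure of \<open>dyadic n k\<close>. The support may contain the left end point of
  an interval of positive mass, which \<open>dyadic\<close> omits, while the interval to its left is
  a null set.\<close>

definition cell :: "nat \<Rightarrow> nat \<Rightarrow> real set" where
  "cell n k = {real k / 2 ^ n .. (real k + 1) / 2 ^ n}"

lemma dyadic_subset_cell: "dyadic n k \<subseteq> cell n k" by (auto simp: dyadic_def cell_def)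

lemma diameter_cell: "diameter (cell n k) = 1 / 2 ^ n"
  by (simp add: cell_def divide_right_mono diff_divide_distrib[symmetric] not_less)

text \<open>Finitely many closed cells have an open complement, and this complement is covered by
  null dyadic intervals and the null set outside (0,1).\<close>

lemma supp_subset_cells: "supp \<nu> \<subseteq> (\<Union>k\<in>pos_idx n. cell n k)"
proof
  fix x assume x: "x \<in> supp \<nu>"
  show "x \<in> (\<Union>k\<in>pos_idx n. cell n k)"
  proof (rule ccontr)
    assume no: "x \<notin> (\<Union>k\<in>pos_idx n. cell n k)"
    let ?U = "- (\<Union>k\<in>pos_idx n. cell n k)"
    have "open ?U" by (intro open_Compl closed_UN) (auto simp: cell_def)
    then have setsU: "?U \<in> sets \<nu>" by simp
    have "emeasure \<nu> ?U > 0" using \<open>open ?U\<close> x no by (auto simp: supp_def)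
    moreover have "emeasure \<nu> ?U = 0"
    proof -
      have sub: "?U \<subseteq> - {0<..<1} \<union> (\<Union>k\<in>{..<2 ^ n} - pos_idx n. dyadic n k)"
      proof
        fix y assume y: "y \<in> ?U"
        show "y \<in> - {0<..<1} \<union> (\<Union>k\<in>{..<2 ^ n} - pos_idx n. dyadic n k)"
        proof (cases "y \<in> {0<..<1}")
          case True
          then obtain k where "k < 2 ^ n" "y \<in> dyadic n k" using ex_dyadic[of y n] by auto
          then show ?thesis using y dyadic_subset_cell[of n k] by auto
        qed simp
      qed
      have "(\<Union>k\<in>{..<2 ^ n} - pos_idx n. dyadic n k) \<in> null_sets \<nu>"
      proof (rule null_sets.finite_UN)
        fix k assume "k \<in> {..<2 ^ n} - pos_idx n"
        then have "mass n k = 0" using mass_nonneg[of n k] by (auto simp: pos_idx_def less_le)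
        then show "dyadic n k \<in> null_sets \<nu>" by (auto intro!: null_setsI simp: mass_def emeasure_eq_measure)
      qed simp
      moreover have "- {0<..<1::real} \<in> null_sets \<nu>" using null_outside by (auto intro!: null_setsI)
      ultimately have "- {0<..<1} \<union> (\<Union>k\<in>{..<2 ^ n} - pos_idx n. dyadic n k) \<in> null_sets \<nu>"
        by (intro null_sets.Un)
      from null_sets_subset[OF this setsU sub]
      show ?thesis by auto
    qed
    ultimately show False by simp
  qed
qed

lemma supp_dyadic: assumes "k \<in> pos_idx n" shows "\<exists>x. x \<in> dyadic n k \<and> x \<in> supp \<nu>"
proof (rule ccontr)
  assume "\<not> ?thesis"
  then have "dyadic n k \<subseteq> - supp \<nu>" by blast
  then have "emeasure \<nu> (dyadic n k) \<le> emeasure \<nu> (- supp \<nu>)"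
    using closed_supp by (intro emeasure_mono) auto
  then have "emeasure \<nu> (dyadic n k) = 0" using null_compl_supp by simp
  then show False using assms by (simp add: pos_idx_def mass_def measure_def)
qed

lemma cells_cover: "finite (cell n ` pos_idx n)" "U \<in> cell n ` pos_idx n \<Longrightarrow> bounded U \<and> diameter U \<le> 1 / 2 ^ n"
    "supp \<nu> \<subseteq> \<Union>(cell n ` pos_idx n)"
  using supp_subset_cells[of n] diameter_cell[of n] by (auto simp: cell_def)

lemma covering_number_supp_le:
  assumes "1 / 2 ^ n \<le> \<delta>"
  shows "covering_number \<delta> (supp \<nu>) \<le> card (pos_idx n)"
proof -
  have "covering_number \<delta> (supp \<nu>) \<le> card (cell n ` pos_idx n)"
    using cells_cover(2) assms order_trans by (intro covering_number_le cells_cover(1,3)) blast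
  also have "\<dots> \<le> card (pos_idx n)" by (rule card_image_le) simp
  finally show ?thesis .
qed

lemma close_dyadic_index:
  assumes "x \<in> dyadic n i" "y \<in> dyadic n j" "\<bar>x - y\<bar> \<le> 1 / 2 ^ n"
  shows "i \<le> j + 1"
proof -
  have "2 ^ n * (x - y) \<le> 1" using assms(3) by (simp add: field_simps abs_le_iff)
  then have "2 ^ n * x \<le> 2 ^ n * y + 1" by (simp add: right_diff_distrib)
  then have "real i < real j + 2" using assms(1,2) by (simp add: dyadic_less_iff)
  then show ?thesis by linarith
qed

text \<open>Pick a point of the support in every interval of positive mass. A set of diameter at
  most 2^(-n) contains the chosen points of at most two intervals: intervals that are not adjacent
  are more than 2^(-n) apart pointwise, as they are half-open.\<close>

lemma card_pos_idx_le_covering: "card (pos_idx n) \<le> 2 * covering_number (1 / 2 ^ n) (supp \<nu>)"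
proof -
  obtain G where G: "finite G" "card G = covering_number (1 / 2 ^ n) (supp \<nu>)"
      "\<And>U. U \<in> G \<Longrightarrow> bounded U \<and> diameter U \<le> 1 / 2 ^ n" "supp \<nu> \<subseteq> \<Union>G"
    using covering_number_obtain[OF cells_cover(1) cells_cover(2) cells_cover(3)] by metis
  have "\<forall>k\<in>pos_idx n. \<exists>x. x \<in> dyadic n k \<and> x \<in> supp \<nu>" using supp_dyadic by blast
  from bchoice[OF this] obtain x where x: "\<And>k. k \<in> pos_idx n \<Longrightarrow> x k \<in> dyadic n k \<and> x k \<in> supp \<nu>"
    by blast
  have "pos_idx n \<subseteq> (\<Union>U\<in>G. {k \<in> pos_idx n. x k \<in> U})" using x G(4) by blast
  then have "card (pos_idx n) \<le> card (\<Union>U\<in>G. {k \<in> pos_idx n. x k \<in> U})"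
    using G(1) by (intro card_mono) auto
  also have "\<dots> \<le> (\<Sum>U\<in>G. card {k \<in> pos_idx n. x k \<in> U})" by (rule card_UN_le[OF G(1)])
  also have "\<dots> \<le> (\<Sum>U\<in>G. 2)"
  proof (rule sum_mono)
    fix U assume U: "U \<in> G"
    let ?K = "{k \<in> pos_idx n. x k \<in> U}"
    have close: "i \<le> j + 1" if "i \<in> ?K" "j \<in> ?K" for i j
    proof (rule close_dyadic_index)
      show "x i \<in> dyadic n i" "x j \<in> dyadic n j" using x that by auto
      have "dist (x i) (x j) \<le> diameter U" using that G(3)[OF U] by (intro diameter_bounded_bound) auto
      then show "\<bar>x i - x j\<bar> \<le> 1 / 2 ^ n" using G(3)[OF U] by (simp add: dist_real_def)
    qed
    show "card ?K \<le> 2"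
    proof (cases "?K = {}")
      case False
      define m where "m = Min ?K"
      have m: "m \<in> ?K" unfolding m_def using False by (intro Min_in) auto
      have "?K \<subseteq> {m, m + 1}"
      proof
        fix k assume k: "k \<in> ?K"
        then have "m \<le> k" unfolding m_def by (intro Min_le) auto
        moreover have "k \<le> m + 1" using close[OF k m] .
        ultimately show "k \<in> {m, m + 1}" by auto
      qed
      then have "card ?K \<le> card {m, m + 1}" by (intro card_mono) auto
      then show ?thesis by simp
    next
      case True
      show ?thesis unfolding True by simp
    qed
  qed
  also have "\<dots> = 2 * covering_number (1 / 2 ^ n) (supp \<nu>)" using G(2) by simp
  finally show ?thesis .
qed

text \<open>At scale 2^(-n) the covering number and the number of intervals of positive mass differ
  by a factor of at most 2, which adds 1/n to the exponent. For arbitrary \<delta> the level is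
  rounded up, so that 2^(-n) <= \<delta> < 2^(1-n), at the cost of a factor n/(n-1). The limit over
  \<delta> is needed for one inequality only, the other follows along powers of 2.\<close>

lemma dim_M_eq: "dim_M_measure \<nu> = ereal (bet 0)"
proof (rule antisym)
  define f where "f \<delta> = ln (real (covering_number \<delta> (supp \<nu>))) / - ln \<delta>" for \<delta>
  have dim: "dim_M_measure \<nu> = Limsup (at_right 0) (\<lambda>\<delta>. ereal (f \<delta>))"
    by (simp add: dim_M_measure_def upper_minkowski_dim_def f_def)
  have b0: "bet 0 \<ge> 0" by (rule bet_nonneg) auto
  show "dim_M_measure \<nu> \<le> ereal (bet 0)"
  proof (rule ereal_le_epsilon2)
    fix e :: real assume e: "e > 0"
    define B where "B = bet 0 + e / 2"
    have "eventually (\<lambda>n. beta_n \<nu> n 0 < B) sequentially" using e by (intro bet_less) (auto simp: B_def)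
    moreover have "eventually (\<lambda>n. B * (real n / (real n - 1)) < bet 0 + e) sequentially"
    proof -
      have "(\<lambda>n. B * (real n / (real n - 1))) \<longlonglongrightarrow> B" by real_asymp
      then show ?thesis using e by (intro order_tendstoD(2)) (auto simp: B_def)
    qed
    ultimately obtain n0 where n0: "\<And>n. n \<ge> n0 \<Longrightarrow> beta_n \<nu> n 0 < B \<and> B * (real n / (real n - 1)) < bet 0 + e"
      unfolding eventually_sequentially by (metis (mono_tags) linorder_le_cases order_trans)
    have "\<forall>\<^sub>F \<delta> in at_right 0. ereal (f \<delta>) \<le> ereal (bet 0 + e)"
    proof -
      have "\<forall>\<^sub>F \<delta> in at_right (0::real). 0 < \<delta> \<and> \<delta> < 1 / 2 ^ (n0 + 2)"
        using eventually_at_right_real[of 0 "1 / 2 ^ (n0 + 2)"] by simp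
      then show ?thesis
      proof eventually_elim
        case (elim \<delta>)
        define n where "n = nat \<lceil>- log 2 \<delta>\<rceil>"
        have l: "- log 2 \<delta> > real (n0 + 2)"
        proof -
          have "log 2 (1 / 2 ^ m) = - real m" for m :: nat by (simp add: log_divide log_nat_power)
          from this[of "n0 + 2"] have e: "log 2 (1 / 2 ^ (n0 + 2)) = - real (n0 + 2)" .
          have "log 2 \<delta> < log 2 (1 / 2 ^ (n0 + 2))" using elim by (subst log_less_cancel_iff) auto
          also note e
          finally show ?thesis by simp
        qed
        have n: "- log 2 \<delta> \<le> real n" "real n - 1 < - log 2 \<delta>" using l unfolding n_def by linarith+
        have nn: "n \<ge> n0" "n \<ge> 2" using n l by linarith+
        have "1 / 2 ^ n \<le> \<delta>"
        proof -
          have "2 powr (- real n) \<le> 2 powr (log 2 \<delta>)" using n by (intro powr_mono) auto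
          moreover have "2 powr (log 2 \<delta>) = \<delta>" using elim by simp
          moreover have "2 powr (- real n) = 1 / 2 ^ n" by (simp add: powr_minus powr_realpow inverse_eq_divide)
          ultimately show ?thesis by linarith
        qed
        then have c: "covering_number \<delta> (supp \<nu>) \<le> card (pos_idx n)" by (rule covering_number_supp_le)
        have m: "card (pos_idx n) \<ge> 1" using pos_idx_nonempty[of n] by (simp add: Suc_leI card_gt_0_iff)
        have "ln (real (covering_number \<delta> (supp \<nu>))) \<le> ln (real (card (pos_idx n)))"
          using c m by (cases "covering_number \<delta> (supp \<nu>) = 0") (auto simp: ln_le_cancel_iff)
        also have "\<dots> = beta_n \<nu> n 0 * (real n * ln 2)" using nn by (simp add: beta_n_0)
        also have "\<dots> \<le> B * (real n * ln 2)" using n0[OF nn(1)] nn by (intro mult_right_mono) auto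
        finally have A: "ln (real (covering_number \<delta> (supp \<nu>))) \<le> B * (real n * ln 2)" .
        have L: "(real n - 1) * ln 2 \<le> - ln \<delta>"
        proof -
          have "(real n - 1) * ln 2 \<le> - log 2 \<delta> * ln 2" using n by (intro mult_right_mono) auto
          then show ?thesis by (simp add: log_def)
        qed
        have p: "(real n - 1) * ln 2 > 0" using nn by simp
        have "f \<delta> \<le> B * (real n * ln 2) / - ln \<delta>"
          unfolding f_def using A L p by (intro divide_right_mono) auto
        also have "\<dots> \<le> B * (real n * ln 2) / ((real n - 1) * ln 2)"
        proof (rule divide_left_mono[OF L])
          show "0 \<le> B * (real n * ln 2)" using b0 e by (simp add: B_def)
          show "0 < - ln \<delta> * ((real n - 1) * ln 2)" using L p by (intro mult_pos_pos[OF _ p]) linarith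
        qed
        also have "\<dots> = B * (real n / (real n - 1))" by simp
        finally show ?case using n0[OF nn(1)] by simp
      qed
    qed
    then show "dim_M_measure \<nu> \<le> ereal (bet 0) + ereal e"
      unfolding dim by (simp add: Limsup_bounded)
  qed
  show "ereal (bet 0) \<le> dim_M_measure \<nu>"
  proof (rule ccontr)
    assume "\<not> ?thesis"
    then have "dim_M_measure \<nu> < ereal (bet 0)" by simp
    from ereal_dense2[OF this] obtain B where B: "dim_M_measure \<nu> < ereal B" "ereal B < ereal (bet 0)"
      by blast
    define e where "e = (bet 0 - B) / 2"
    have e: "e > 0" "B + e < bet 0" using B(2) by (auto simp: e_def field_simps)
    have "eventually (\<lambda>\<delta>. ereal (f \<delta>) < ereal B) (at_right 0)"
      using B(1) unfolding dim by (rule Limsup_lessD)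
    moreover have "filterlim (\<lambda>n. 1 / 2 ^ n :: real) (at_right 0) sequentially" by real_asymp
    ultimately have "eventually (\<lambda>n. ereal (f (1 / 2 ^ n)) < ereal B) sequentially"
      by (rule eventually_compose_filterlim)
    moreover have "eventually (\<lambda>n. 1 / real n < e) sequentially" using e by real_asymp
    ultimately have "eventually (\<lambda>n. beta_n \<nu> n 0 \<le> B + e) sequentially"
      using eventually_ge_at_top[of 1]
    proof eventually_elim
      case (elim n)
      let ?c = "covering_number (1 / 2 ^ n) (supp \<nu>)"
      have m: "card (pos_idx n) \<ge> 1" using pos_idx_nonempty[of n] by (simp add: Suc_leI card_gt_0_iff)
      have le: "card (pos_idx n) \<le> 2 * ?c" by (rule card_pos_idx_le_covering)
      then have c: "?c \<ge> 1" using m by linarith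
      have "real (card (pos_idx n)) \<le> 2 * real ?c"
        using le by (metis of_nat_le_iff of_nat_mult of_nat_numeral)
      then have "ln (real (card (pos_idx n))) \<le> ln (2 * real ?c)"
        using m c by (subst ln_le_cancel_iff) auto
      also have "\<dots> = ln 2 + ln (real ?c)" using c by (simp add: ln_mult)
      also have "\<dots> = ln 2 + f (1 / 2 ^ n) * (real n * ln 2)"
        using elim by (simp add: f_def ln_div ln_realpow)
      also have "\<dots> \<le> ln 2 + B * (real n * ln 2)" using elim by (intro add_left_mono mult_right_mono) auto
      finally have "ln (real (card (pos_idx n))) / (real n * ln 2) \<le> (ln 2 + B * (real n * ln 2)) / (real n * ln 2)"
        by (intro divide_right_mono) auto
      also have "\<dots> = 1 / real n + B" using elim by (simp add: add_divide_distrib)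
      finally show ?case using elim by (simp add: beta_n_0)
    qed
    then have "bet 0 \<le> B + e" by (intro bet_leI) auto
    then show False using e by simp
  qed
qed

section \<open>The slope at one\<close>

text \<open>Since \<open>bet 1 = 0\<close>, this is minus the slope of the chord over [t,1].
  Convexity makes it decrease in t, so its infimum \<open>delta\<close> is its limit at 1, minus the
  left derivative of \<open>bet\<close> there.\<close>

definition slope :: "real \<Rightarrow> real" where "slope t = bet t / (1 - t)"
definition delta :: real where "delta = Inf (slope ` {0..<1})"

lemma slope_antimono: assumes "0 \<le> t" "t \<le> u" "u < 1" shows "slope u \<le> slope t"
proof (cases "t = u")
  case False
  have "(1 - t) * bet u \<le> (1 - u) * bet t + (u - t) * bet 1" using assms False by (intro bet_three) auto
  then show ?thesis using assms False by (simp add: slope_def bet_1 divide_simps mult.commute)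
qed simp

lemma slope_nonneg: "0 \<le> t \<Longrightarrow> t < 1 \<Longrightarrow> 0 \<le> slope t"
  using bet_nonneg[of t] by (simp add: slope_def)

lemma slope_bdd: "bdd_below (slope ` {0..<1})"
  unfolding bdd_below_def using slope_nonneg by (intro exI[of _ 0]) auto

lemma delta_le: "0 \<le> t \<Longrightarrow> t < 1 \<Longrightarrow> delta \<le> slope t"
  unfolding delta_def using slope_bdd by (intro cInf_lower) auto

lemma delta_nonneg: "0 \<le> delta"
  unfolding delta_def using slope_nonneg by (intro cInf_greatest) auto

lemma delta_le_bet_0: "delta \<le> bet 0"
  using delta_le[of 0] by (simp add: slope_def)

lemma slope_tendsto: "(slope \<longlongrightarrow> delta) (at_left 1)"
proof (rule order_tendstoI)
  fix a assume "a < delta"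
  then show "eventually (\<lambda>t. a < slope t) (at_left 1)"
    using delta_le by (subst eventually_at_left[of 0]) (auto intro!: exI[of _ 0] intro: less_le_trans)
next
  fix a assume "delta < a"
  then obtain t where t: "0 \<le> t" "t < 1" "slope t < a"
    unfolding delta_def using slope_bdd by (subst (asm) cInf_less_iff) auto
  then show "eventually (\<lambda>t. slope t < a) (at_left 1)"
    using slope_antimono[OF t(1)] by (subst eventually_at_left[of 0]) (auto intro!: exI[of _ t] intro: le_less_trans less_imp_le)
qed

lemma delta_upper_eq: "delta_upper \<nu> = ereal delta"
proof -
  have "((\<lambda>t. ereal (slope t)) \<longlongrightarrow> ereal delta) (at_left 1)" using slope_tendsto by (rule tendsto_ereal)
  moreover have "eventually (\<lambda>t. ereal (slope t) = beta \<nu> t / ereal (1 - t)) (at_left 1)"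
    by (subst eventually_at_left[of 0]) (auto intro!: exI[of _ 0] simp: beta_bet slope_def)
  ultimately have "((\<lambda>t. beta \<nu> t / ereal (1 - t)) \<longlongrightarrow> ereal delta) (at_left 1)"
    by (rule Lim_transform_eventually)
  then show ?thesis unfolding delta_upper_def by (intro tendsto_Lim) auto
qed

text \<open>For \<open>q0 > 0\<close> the fixed point gives \<open>slope q0 = q0 / (1 - q0)\<close>,
  and \<open>slope 0 = bet 0\<close>; the right-hand side says that these two agree. A decreasing
  function with limit equal to its initial value is constant, which gives one direction. In the
  other, convexity through the points at 0 and \<open>q0\<close> prevents \<open>slope\<close> from
  dropping beyond \<open>q0\<close>.\<close>

lemma delta_eq_iff: "delta = bet 0 \<longleftrightarrow> q0 = bet 0 / (1 + bet 0)"
proof (cases "q0 = 0")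
  \<comment> \<open>Here \<open>bet\<close> vanishes on (0,1) and may jump at 0, so
    \<open>delta = 0\<close> and both sides reduce to \<open>bet 0 = 0\<close>.\<close>
  case True
  have z: "bet t = 0" if t: "0 < t" "t < 1" for t
  proof -
    have "bet t \<le> e" if "e > 0" for e
    proof -
      have "bet t \<le> bet (min e t)" using t that by (intro bet_antimono) auto
      also have "\<dots> < min e t" using t that True by (intro bet_less_q) auto
      finally show ?thesis by simp
    qed
    then have "bet t \<le> 0 + e" if "e > 0" for e using that by simp
    then have "bet t \<le> 0" by (rule field_le_epsilon)
    then show ?thesis using bet_nonneg[of t] t by simp
  qed
  have "delta \<le> slope (1/2)" by (rule delta_le) auto
  then have d: "delta = 0" using z[of "1/2"] delta_nonneg by (simp add: slope_def)
  have "bet 0 \<ge> 0" by (rule bet_nonneg) auto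
  then show ?thesis using d True by (auto simp: add_nonneg_eq_0_iff)
next
  case False
  then have q: "q0 > 0" using q0_bounds by simp
  have bq: "bet q0 = q0" by (rule bet_q0[OF q])
  then have q1: "q0 < 1" using q0_bounds q bet_1 by (cases "q0 = 1") auto
  have b0: "bet 0 \<ge> 0" by (rule bet_nonneg) auto
  show ?thesis
  proof
    assume "delta = bet 0"
    then have "bet 0 \<le> slope q0" using delta_le[of q0] q q1 by simp
    moreover have "slope q0 \<le> bet 0" using slope_antimono[of 0 q0] q q1 by (simp add: slope_def)
    ultimately have "q0 / (1 - q0) = bet 0" by (simp add: slope_def bq)
    then have "q0 = bet 0 * (1 - q0)" using q1 by (simp add: field_simps)
    then have "q0 * (1 + bet 0) = bet 0" by argo
    then show "q0 = bet 0 / (1 + bet 0)" using b0 by (simp add: eq_divide_eq)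
  next
    assume "q0 = bet 0 / (1 + bet 0)"
    then have "q0 * (1 + bet 0) = bet 0" using b0 by (simp add: eq_divide_eq)
    then have e: "q0 = bet 0 * (1 - q0)" by argo
    have "bet 0 \<le> slope t" if t: "0 \<le> t" "t < 1" for t
    proof (cases "t \<le> q0")
      case True
      have "slope q0 \<le> slope t" using True t q1 by (intro slope_antimono) auto
      moreover have "slope q0 = bet 0" using e q1 bq by (simp add: slope_def divide_eq_eq)
      ultimately show ?thesis by simp
    next
      case False
      have "(t - 0) * bet q0 \<le> (t - q0) * bet 0 + (q0 - 0) * bet t"
        using False q by (intro bet_three) auto
      then have "t * (bet 0 * (1 - q0)) \<le> (t - q0) * bet 0 + q0 * bet t" using bq e by simp
      then have "q0 * (bet 0 * (1 - t)) \<le> q0 * bet t" by argo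
      then have "bet 0 * (1 - t) \<le> bet t" using q by simp
      then show ?thesis using t by (simp add: slope_def pos_le_divide_eq)
    qed
    then have "bet 0 \<le> delta" unfolding delta_def by (intro cInf_greatest) auto
    then show "delta = bet 0" using delta_le_bet_0 by simp
  qed
qed

end

section \<open>Dimensions of the measure\<close>

lemma diam_pow_mono:
  assumes "s \<ge> 0" "diameter U \<le> d" "bounded U"
  shows "diam_pow s U \<le> ennreal (if s = 0 then 1 else d powr s)"
  using assms diameter_ge_0[of U] by (auto simp: diam_pow_def intro!: ennreal_leI powr_mono2)

context unit_interval_measure
begin

text \<open>With local dimension meaning -log2(mass)/n, \<open>light d\<close> collects the
  intervals of local dimension above \<open>d\<close>, and \<open>heavy d\<close> those
  below.\<close>

definition light :: "real \<Rightarrow> nat \<Rightarrow> nat set" where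
  "light d n = {k \<in> pos_idx n. mass n k < 2 powr (- (real n * d))}"
definition heavy :: "real \<Rightarrow> nat \<Rightarrow> nat set" where
  "heavy d n = {k \<in> pos_idx n. 2 powr (- (real n * d)) < mass n k}"
definition null_idx :: "nat \<Rightarrow> nat set" where
  "null_idx n = {..<2 ^ n} - pos_idx n"

lemma mass_null_idx: "k \<in> null_idx n \<Longrightarrow> mass n k = 0"
  using mass_nonneg[of n k] by (auto simp: null_idx_def pos_idx_def less_le)

lemma measure_UN_dyadic:
  assumes "finite I"
  shows "measure \<nu> (\<Union>k\<in>I. dyadic n k) = (\<Sum>k\<in>I. mass n k)"
  unfolding mass_def using assms
  by (intro finite_measure_finite_Union) (auto simp: disjoint_family_on_def dest: dyadic_eqI)

lemma summable_beta_n: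
  assumes q: "q \<ge> 0" and c: "bet q + c < 0"
    and f: "\<And>n. n \<ge> 1 \<Longrightarrow> 0 \<le> f n \<and> f n \<le> 2 powr (real n * (beta_n \<nu> n q + c))"
  shows "summable f"
proof -
  define r where "r = - (bet q + c) / 2"
  have r: "r > 0" "bet q < - c - r" using c by (auto simp: r_def field_simps)
  show ?thesis
  proof (rule summable_comparison_test_ev)
    show "\<forall>\<^sub>F n in sequentially. norm (f n) \<le> (2 powr (- r)) ^ n"
      using bet_less[OF q r(2)] eventually_ge_at_top[of 1]
    proof eventually_elim
      case (elim n)
      have "norm (f n) \<le> 2 powr (real n * (beta_n \<nu> n q + c))" using f[OF elim(2)] by simp
      also have "\<dots> \<le> 2 powr (real n * (- r))" using elim by (intro powr_mono mult_left_mono) auto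
      also have "\<dots> = (2 powr (- r)) ^ n" by (simp add: powr_powr powr_realpow[symmetric] mult.commute)
      finally show ?case .
    qed
    have "2 powr (- r) < 2 powr 0" using r by (intro powr_less_mono) auto
    then show "summable (\<lambda>n. (2 powr (- r)) ^ n)" by (intro summable_geometric) simp
  qed
qed

text \<open>Splitting off the factor \<open>mass powr (1 - t)\<close>, which is small on light
  intervals, bounds the sum by 2^(n(beta_n(t) - d(1 - t))); the condition on \<open>t\<close> makes
  the exponent eventually at most a negative multiple of n.\<close>

lemma summable_light:
  assumes t: "0 \<le> t" "t < 1" "bet t < d * (1 - t)"
  shows "summable (\<lambda>n. \<Sum>k\<in>light d n. mass n k)"
proof (rule summable_beta_n[of t "- (d * (1 - t))"])
  fix n :: nat assume n: "n \<ge> 1"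
  have "(\<Sum>k\<in>light d n. mass n k) \<le> (\<Sum>k\<in>light d n. mass n k powr t * 2 powr (- (real n * d) * (1 - t)))"
  proof (rule sum_mono)
    fix k assume k: "k \<in> light d n"
    then have m: "mass n k > 0" by (simp add: light_def pos_idx_def)
    have "mass n k = mass n k powr t * mass n k powr (1 - t)" using m by (simp add: powr_add[symmetric])
    also have "mass n k powr (1 - t) \<le> (2 powr (- (real n * d))) powr (1 - t)"
      using k t by (intro powr_mono2) (auto simp: light_def)
    finally show "mass n k \<le> mass n k powr t * 2 powr (- (real n * d) * (1 - t))"
      by (simp add: powr_powr mult_left_mono)
  qed
  also have "\<dots> = (\<Sum>k\<in>light d n. mass n k powr t) * 2 powr (- (real n * d) * (1 - t))" by (simp add: sum_distrib_right)
  also have "\<dots> \<le> psum n t * 2 powr (- (real n * d) * (1 - t))"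
    unfolding psum_def by (intro mult_right_mono sum_mono2) (auto simp: light_def)
  also have "\<dots> = 2 powr (real n * (beta_n \<nu> n t + - (d * (1 - t))))"
    unfolding psum_beta_n[OF n] by (simp add: powr_add[symmetric] algebra_simps)
  finally show "0 \<le> (\<Sum>k\<in>light d n. mass n k) \<and> (\<Sum>k\<in>light d n. mass n k) \<le> 2 powr (real n * (beta_n \<nu> n t + - (d * (1 - t))))"
    by (simp add: sum_nonneg)
qed (use t in auto)

text \<open>The same splitting with \<open>t > 1\<close>: now \<open>mass powr (- (t - 1))\<close>
  is small because the intervals are heavy.\<close>

lemma summable_heavy:
  assumes t: "1 < t" "bet t < - d * (t - 1)"
  shows "summable (\<lambda>n. \<Sum>k\<in>heavy d n. mass n k)"
proof (rule summable_beta_n[of t "d * (t - 1)"])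
  fix n :: nat assume n: "n \<ge> 1"
  have "(\<Sum>k\<in>heavy d n. mass n k) \<le> (\<Sum>k\<in>heavy d n. mass n k powr t * 2 powr (real n * d * (t - 1)))"
  proof (rule sum_mono)
    fix k assume k: "k \<in> heavy d n"
    then have m: "mass n k > 0" by (simp add: heavy_def pos_idx_def)
    have "mass n k = mass n k powr t * mass n k powr (- (t - 1))" using m by (simp add: powr_add[symmetric])
    also have "\<dots> \<le> mass n k powr t * (2 powr (- (real n * d))) powr (- (t - 1))"
      using k t by (intro mult_left_mono powr_mono2') (auto simp: heavy_def)
    also have "(2 powr (- (real n * d))) powr (- (t - 1)) = 2 powr (real n * d * (t - 1))"
      unfolding powr_powr by (simp only: minus_mult_minus)
    finally show "mass n k \<le> mass n k powr t * 2 powr (real n * d * (t - 1))" .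
  qed
  also have "\<dots> = (\<Sum>k\<in>heavy d n. mass n k powr t) * 2 powr (real n * d * (t - 1))" by (simp add: sum_distrib_right)
  also have "\<dots> \<le> psum n t * 2 powr (real n * d * (t - 1))"
    unfolding psum_def by (intro mult_right_mono sum_mono2) (auto simp: heavy_def)
  also have "\<dots> = 2 powr (real n * (beta_n \<nu> n t + d * (t - 1)))"
    unfolding psum_beta_n[OF n] by (simp add: powr_add[symmetric] algebra_simps)
  finally show "0 \<le> (\<Sum>k\<in>heavy d n. mass n k) \<and> (\<Sum>k\<in>heavy d n. mass n k) \<le> 2 powr (real n * (beta_n \<nu> n t + d * (t - 1)))"
    by (simp add: sum_nonneg)
qed (use t in auto)

text \<open>Both tail sets are discarded together with the dyadic intervals of measure zero, so that what
  remains at level \<open>n\<close> is described by the masses of the intervals of \<open>pos_idx n\<close> only.\<close>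

lemma AE_eventually_not_in:
  assumes sub: "\<And>n. I n \<subseteq> pos_idx n" and sm: "summable (\<lambda>n. \<Sum>k\<in>I n. mass n k)"
  shows "AE x in \<nu>. eventually (\<lambda>n. x \<notin> (\<Union>k\<in>I n \<union> null_idx n. dyadic n k)) sequentially"
proof -
  have fin: "finite (I n)" for n using finite_subset[OF sub] by simp
  have fnull: "finite (null_idx n)" for n by (simp add: null_idx_def)
  have "AE x in \<nu>. eventually (\<lambda>n. x \<in> space \<nu> - (\<Union>k\<in>I n \<union> null_idx n. dyadic n k)) sequentially"
  proof (rule borel_cantelli_AE1)
    have "measure \<nu> (\<Union>k\<in>I n \<union> null_idx n. dyadic n k) = (\<Sum>k\<in>I n. mass n k)" for n
    proof -
      have "measure \<nu> (\<Union>k\<in>I n \<union> null_idx n. dyadic n k) = (\<Sum>k\<in>I n \<union> null_idx n. mass n k)"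
        using fin fnull by (intro measure_UN_dyadic) auto
      also have "\<dots> = (\<Sum>k\<in>I n. mass n k)"
        using fin fnull mass_null_idx by (intro sum.mono_neutral_right) auto
      finally show ?thesis .
    qed
    then show "summable (\<lambda>n. measure \<nu> (\<Union>k\<in>I n \<union> null_idx n. dyadic n k))" using sm by simp
    show "(\<Union>k\<in>I n \<union> null_idx n. dyadic n k) \<in> sets \<nu>" for n
      using fin fnull by (intro sets.finite_UN) auto
  qed (simp add: emeasure_eq_measure)
  then show ?thesis by (rule AE_mp) (auto intro!: AE_I2 elim: eventually_mono)
qed

text \<open>Almost every point lies, from some level on, only in intervals of mass at least 2^(-nd),
  and each level has at most \<open>total\<close> times 2^(nd) of them. They cover
  \<open>A N\<close> on every level from N on, so the s-dimensional Hausdorff measure of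
  \<open>A N\<close> vanishes for every s > d.\<close>

lemma dim_H_le_of_light:
  assumes t: "0 \<le> t" "t < 1" "bet t < d * (1 - t)"
  shows "dim_H_measure \<nu> \<le> ereal d"
proof -
  define Bad where "Bad n = (\<Union>k\<in>light d n \<union> null_idx n. dyadic n k)" for n
  have fin: "finite (light d n)" "finite (null_idx n)" for n by (auto simp: light_def null_idx_def)
  have Bm: "Bad n \<in> sets borel" for n unfolding Bad_def using fin by (intro sets.finite_UN) auto
  define A where "A N = {0<..<1} - (\<Union>n\<in>{N..}. Bad n)" for N :: nat
  have Am: "A N \<in> sets borel" for N unfolding A_def using Bm by (intro sets.Diff sets.countable_UN') auto
  have null: "emeasure \<nu> (- (\<Union>N. A N)) = 0"
  proof -
    have "AE x in \<nu>. eventually (\<lambda>n. x \<notin> Bad n) sequentially"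
      unfolding Bad_def by (rule AE_eventually_not_in[OF _ summable_light[OF t]]) (auto simp: light_def)
    then have "AE x in \<nu>. x \<in> (\<Union>N. A N)"
      using AE_unit
    proof eventually_elim
      case (elim x)
      then obtain N where "\<forall>n\<ge>N. x \<notin> Bad n" by (auto simp: eventually_sequentially)
      then have "x \<in> A N" using elim by (auto simp: A_def)
      then show ?case by blast
    qed
    moreover have "(AE x in \<nu>. x \<in> (\<Union>N. A N)) \<longleftrightarrow> emeasure \<nu> (- (\<Union>N. A N)) = 0"
      by (rule AE_iff_measurable) (use Am in \<open>auto intro!: borel_comp\<close>)
    ultimately show ?thesis by blast
  qed
  have d0: "d > 0"
  proof (rule ccontr)
    assume "\<not> d > 0"
    then have "d * (1 - t) \<le> 0" using t by (simp add: mult_nonpos_nonneg)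
    then show False using t bet_nonneg[of t] by simp
  qed
  have HA: "hausdorff_measure s (A N) = 0" if s: "s > d" for s N
  proof -
    have "hausdorff_premeasure s \<delta> (A N) = 0" if dl: "\<delta> > 0" for \<delta>
    proof -
      have "hausdorff_premeasure s \<delta> (A N) \<le> ennreal (total * 2 powr (real n * (d - s)))"
        if n: "n \<ge> N" "1 / 2 ^ n \<le> \<delta>" for n
      proof -
        let ?G = "pos_idx n - light d n"
        have cov: "A N \<subseteq> (\<Union>k\<in>?G. dyadic n k)"
        proof
          fix x assume x: "x \<in> A N"
          then obtain k where k: "k < 2 ^ n" "x \<in> dyadic n k" using ex_dyadic[of x n] by (auto simp: A_def)
          have "x \<notin> Bad n" using x n by (auto simp: A_def)
          then have "k \<in> ?G" using k by (auto simp: Bad_def null_idx_def)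
          then show "x \<in> (\<Union>k\<in>?G. dyadic n k)" using k by blast
        qed
        have dia: "bounded (dyadic n k) \<and> diameter (dyadic n k) \<le> 1 / 2 ^ n" for k
        proof -
          have "bounded (cell n k)" by (simp add: cell_def)
          then show ?thesis
            using dyadic_subset_cell[of n k] diameter_cell[of n k] diameter_subset bounded_subset by metis
        qed
        have "hausdorff_premeasure s \<delta> (A N) \<le> (\<Sum>k\<in>?G. diam_pow s (dyadic n k))"
          using cov dia n dl by (intro hausdorff_premeasure_finite_cover) (auto intro: order_trans)
        also have "\<dots> \<le> (\<Sum>k\<in>?G. ennreal ((1 / 2 ^ n) powr s))"
          using diam_pow_mono[of s "dyadic n _" "1 / 2 ^ n"] dia s d0 by (intro sum_mono) auto
        also have "\<dots> = ennreal (real (card ?G) * (1 / 2 ^ n) powr s)"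
          by (simp add: ennreal_mult ennreal_of_nat_eq_real_of_nat)
        also have "\<dots> \<le> ennreal (total * 2 powr (real n * (d - s)))"
        proof (rule ennreal_leI)
          have "real (card ?G) * 2 powr (- (real n * d)) = (\<Sum>k\<in>?G. 2 powr (- (real n * d)))" by simp
          also have "\<dots> \<le> (\<Sum>k\<in>?G. mass n k)" by (intro sum_mono) (auto simp: light_def)
          also have "\<dots> \<le> (\<Sum>k\<in>pos_idx n. mass n k)" by (intro sum_mono2) auto
          finally have c: "real (card ?G) * 2 powr (- (real n * d)) \<le> total" by (simp add: sum_pos_idx)
          have e1: "(1 / 2 ^ n) powr s = 2 powr (- (real n * s))"
            by (simp add: powr_divide powr_minus_divide powr_realpow[symmetric] powr_powr)
          have e2: "2 powr (- (real n * s)) = 2 powr (- (real n * d)) * 2 powr (real n * (d - s))"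
            by (simp add: powr_add[symmetric] algebra_simps)
          have "real (card ?G) * (1 / 2 ^ n) powr s = (real (card ?G) * 2 powr (- (real n * d))) * 2 powr (real n * (d - s))"
            unfolding e1 e2 by simp
          also have "\<dots> \<le> total * 2 powr (real n * (d - s))" using c by (rule mult_right_mono) simp
          finally show "real (card ?G) * (1 / 2 ^ n) powr s \<le> total * 2 powr (real n * (d - s))" .
        qed
        finally show ?thesis .
      qed
      moreover have "eventually (\<lambda>n. n \<ge> N \<and> 1 / 2 ^ n \<le> \<delta>) sequentially"
      proof -
        have "(\<lambda>n. 1 / 2 ^ n :: real) \<longlonglongrightarrow> 0" by real_asymp
        then have "eventually (\<lambda>n. 1 / 2 ^ n < \<delta>) sequentially" using dl by (rule order_tendstoD)
        with eventually_ge_at_top[of N] show ?thesis by eventually_elim auto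
      qed
      ultimately have "eventually (\<lambda>n. hausdorff_premeasure s \<delta> (A N) \<le> ennreal (total * 2 powr (real n * (d - s)))) sequentially"
        by (auto elim: eventually_mono)
      moreover have "(\<lambda>n. ennreal (total * 2 powr (real n * (d - s)))) \<longlonglongrightarrow> ennreal 0"
      proof (rule tendsto_ennrealI)
        show "(\<lambda>n. total * 2 powr (real n * (d - s))) \<longlonglongrightarrow> 0"
        proof (rule tendsto_mult_right_zero)
          have "2 powr (d - s) < 2 powr 0" using s by (intro powr_less_mono) auto
          then have "(\<lambda>n. (2 powr (d - s)) ^ n) \<longlonglongrightarrow> 0" by (intro LIMSEQ_power_zero) simp
          moreover have "(2 powr (d - s)) ^ n = 2 powr (real n * (d - s))" for n
            by (simp add: powr_powr powr_realpow[symmetric] mult.commute)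
          ultimately show "(\<lambda>n. 2 powr (real n * (d - s))) \<longlonglongrightarrow> 0" by simp
        qed
      qed
      ultimately have "hausdorff_premeasure s \<delta> (A N) \<le> ennreal 0"
        by (intro tendsto_lowerbound[of _ _ sequentially]) auto
      then show ?thesis by simp
    qed
    then show ?thesis unfolding hausdorff_measure_def by simp
  qed
  have "hausdorff_dim (\<Union>N. A N) \<le> ereal d"
  proof (rule ereal_le_epsilon2)
    fix e :: real assume e: "e > 0"
    have "hausdorff_measure (d + e) (\<Union>N. A N) \<le> (\<Sum>N. hausdorff_measure (d + e) (A N))" by (rule hausdorff_measure_UN)
    also have "\<dots> = 0" using HA[of "d + e"] e by simp
    finally have "hausdorff_measure (d + e) (\<Union>N. A N) = 0" by simp
    then show "hausdorff_dim (\<Union>N. A N) \<le> ereal d + ereal e"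
      unfolding hausdorff_dim_def using d0 e by (intro Inf_lower) auto
  qed
  moreover have "dim_H_measure \<nu> \<le> hausdorff_dim (\<Union>N. A N)"
    unfolding dim_H_measure_def using Am null by (intro Inf_lower) auto
  ultimately show ?thesis by simp
qed

lemma dim_H_le_delta: "dim_H_measure \<nu> \<le> ereal delta"
proof (rule ereal_le_epsilon2)
  fix e :: real assume e: "e > 0"
  then have "delta < delta + e" by simp
  then obtain t where t: "0 \<le> t" "t < 1" "slope t < delta + e"
    unfolding delta_def[symmetric] using slope_bdd
    by (metis (no_types, lifting) atLeastLessThan_iff cInf_lessD delta_def image_iff image_is_empty atLeastLessThan_empty_iff zero_less_one)
  then have "bet t < (delta + e) * (1 - t)" by (simp add: slope_def pos_divide_less_eq)
  from dim_H_le_of_light[OF t(1,2) this] show "dim_H_measure \<nu> \<le> ereal delta + ereal e" by simp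
qed

text \<open>The mass distribution principle. A part \<open>A N\<close> of \<open>E\<close> of
  positive measure has all its points in intervals of mass at most 2^(-nd) from level N on, so a
  small set of diameter r meets \<open>A N\<close> in a set of measure at most a multiple of r^s for
  s < d.\<close>

lemma lower_dim_H_ge:
  assumes t: "1 < t" "bet t < - d * (t - 1)" and d: "d > 0"
  shows "ereal d \<le> lower_dim_H_measure \<nu>"
  unfolding lower_dim_H_measure_def
proof (rule Inf_greatest, safe)
  fix E assume E: "E \<in> sets borel" "emeasure \<nu> E > 0"
  define Bad where "Bad n = (\<Union>k\<in>heavy d n \<union> null_idx n. dyadic n k)" for n
  have fin: "finite (heavy d n)" "finite (null_idx n)" for n by (auto simp: heavy_def null_idx_def)
  have Bm: "Bad n \<in> sets borel" for n unfolding Bad_def using fin by (intro sets.finite_UN) auto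
  define A where "A N = E \<inter> {0<..<1} - (\<Union>n\<in>{N..}. Bad n)" for N :: nat
  have Am: "A N \<in> sets borel" for N unfolding A_def using Bm E by (intro sets.Diff sets.countable_UN' sets.Int) auto
  have "\<exists>N. emeasure \<nu> (A N) \<noteq> 0"
  proof (rule ccontr)
    assume "\<not> ?thesis"
    then have "(\<Union>N. A N) \<in> null_sets \<nu>" using Am by (intro null_sets_UN) (auto intro!: null_setsI)
    then have "AE x in \<nu>. x \<notin> (\<Union>N. A N)" by (rule AE_not_in)
    moreover have "AE x in \<nu>. eventually (\<lambda>n. x \<notin> Bad n) sequentially"
      unfolding Bad_def by (rule AE_eventually_not_in[OF _ summable_heavy[OF t]]) (auto simp: heavy_def)
    ultimately have "AE x in \<nu>. x \<notin> E"
      using AE_unit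
    proof eventually_elim
      case (elim x)
      then obtain N where "\<forall>n\<ge>N. x \<notin> Bad n" by (auto simp: eventually_sequentially)
      then have "x \<in> E \<Longrightarrow> x \<in> A N" using elim by (auto simp: A_def)
      then show ?case using elim by blast
    qed
    then have "emeasure \<nu> E = 0" using E by (subst (asm) AE_iff_measurable[OF _ refl]) auto
    then show False using E by simp
  qed
  then obtain N where N: "emeasure \<nu> (A N) > 0" by (auto simp: zero_less_iff_neq_zero)
  have mass_le: "mass n k \<le> 2 powr (- (real n * d))" if "x \<in> A N" "x \<in> dyadic n k" "k < 2 ^ n" "n \<ge> N" for x n k
  proof -
    have "x \<notin> Bad n" using that by (auto simp: A_def)
    then show ?thesis using that by (auto simp: Bad_def heavy_def null_idx_def)
  qed
  show "ereal d \<le> hausdorff_dim E"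
    unfolding hausdorff_dim_def
  proof (rule Inf_greatest, safe)
    fix s :: real assume s: "s \<ge> 0" "hausdorff_measure s E = 0"
    show "ereal d \<le> ereal s"
    proof (rule ccontr)
      assume "\<not> ?thesis"
      then have sd: "s < d" by simp
      \<comment> \<open>The 2 counts the intervals of comparable size that a set can meet,
        \<open>2 powr s\<close> pays for rounding its diameter to a power of 2.\<close>
      define C where "C = 2 * 2 powr s"
      have C0: "C > 0" by (simp add: C_def)
      \<comment> \<open>Covering sets need not be measurable; each is replaced by a measurable set
        containing its trace on \<open>A N\<close>.\<close>
      have V: "\<exists>V. V \<in> sets \<nu> \<and> A N \<inter> U \<subseteq> V \<and> emeasure \<nu> V \<le> ennreal C * diam_pow s U"
        if U: "bounded U" "diameter U \<le> 1 / 2 ^ N" for U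
      proof (cases "A N \<inter> U = {}")
        case True then show ?thesis by (intro exI[of _ "{}"]) auto
      next
        case False
        then obtain x where x: "x \<in> A N" "x \<in> U" by blast
        have dist_le: "\<bar>y - z\<bar> \<le> diameter U" if "y \<in> U" "z \<in> U" for y z
          using diameter_bounded_bound[OF U(1) that] by (simp add: dist_real_def)
        show ?thesis
        \<comment> \<open>Diameter 0 determines no dyadic level. The trace is then a single point of
          \<open>A N\<close>, and this is no atom because \<open>d > 0\<close>.\<close>
        proof (cases "diameter U = 0")
          case True
          then have UU: "U \<subseteq> {x}" using dist_le[OF _ x(2)] by fastforce
          have "measure \<nu> {x} \<le> 2 powr (- (real n * d))" if "n \<ge> N" for n
          proof -
            obtain k where k: "k < 2 ^ n" "x \<in> dyadic n k" using ex_dyadic[of x n] x by (auto simp: A_def)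
            have "measure \<nu> {x} \<le> mass n k" unfolding mass_def using k by (intro finite_measure_mono) auto
            also have "\<dots> \<le> 2 powr (- (real n * d))" using mass_le[OF x(1) k(2,1) that] .
            finally show ?thesis .
          qed
          then have "eventually (\<lambda>n. measure \<nu> {x} \<le> 2 powr (- (real n * d))) sequentially"
            by (auto simp: eventually_sequentially)
          moreover have "(\<lambda>n. 2 powr (- (real n * d))) \<longlonglongrightarrow> 0" using d by real_asymp
          ultimately have "measure \<nu> {x} \<le> 0" by (intro tendsto_lowerbound[of _ _ sequentially]) auto
          then have "emeasure \<nu> {x} = 0" by (simp add: emeasure_eq_measure measure_le_0_iff)
          then show ?thesis using UU by (intro exI[of _ "{x}"]) auto
        next
          case False
          define r where "r = diameter U"
          have r: "r > 0" "r \<le> 1 / 2 ^ N" using False U diameter_ge_0[OF U(1)] by (auto simp: r_def)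
          define n where "n = nat \<lfloor>- log 2 r\<rfloor>"
          have lN: "real N \<le> - log 2 r"
          proof -
            have "log 2 r \<le> log 2 (1 / 2 ^ N)" using r by (subst log_le_cancel_iff) auto
            also have "\<dots> = - real N" by (simp add: log_divide log_nat_power)
            finally show ?thesis by simp
          qed
          then have n: "real n \<le> - log 2 r" "- log 2 r < real n + 1" "n \<ge> N" unfolding n_def by linarith+
          have r1: "r \<le> 1 / 2 ^ n"
          proof -
            have "2 powr (log 2 r) \<le> 2 powr (- real n)" using n by (intro powr_mono) auto
            moreover have "2 powr (log 2 r) = r" using r by simp
            moreover have "2 powr (- real n) = 1 / 2 ^ n" by (simp add: powr_minus powr_realpow inverse_eq_divide)
            ultimately show ?thesis by linarith
          qed
          have r2: "2 powr (- (real n + 1)) \<le> r"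
          proof -
            have "2 powr (- (real n + 1)) \<le> 2 powr (log 2 r)" using n by (intro powr_mono) auto
            moreover have "2 powr (log 2 r) = r" using r by simp
            ultimately show ?thesis by linarith
          qed
          define K where "K = {k. k < 2 ^ n \<and> dyadic n k \<inter> (A N \<inter> U) \<noteq> {}}"
          have fK: "finite K" by (simp add: K_def)
          have close: "i \<le> j + 1" if ij: "i \<in> K" "j \<in> K" for i j
          proof -
            obtain y z where "y \<in> dyadic n i" "y \<in> U" "z \<in> dyadic n j" "z \<in> U" using ij by (auto simp: K_def)
            then show ?thesis using close_dyadic_index[of y n i z j] dist_le[of y z] r1 by (simp add: r_def)
          qed
          have cK: "card K \<le> 2"
          proof (cases "K = {}")
            case False
            define m where "m = Min K"
            have m: "m \<in> K" unfolding m_def using False fK by (intro Min_in)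
            have "K \<subseteq> {m, m + 1}"
            proof
              fix k assume k: "k \<in> K"
              then have "m \<le> k" unfolding m_def using fK by (intro Min_le)
              moreover have "k \<le> m + 1" using close[OF k m] .
              ultimately show "k \<in> {m, m + 1}" by auto
            qed
            then have "card K \<le> card {m, m + 1}" by (intro card_mono) auto
            then show ?thesis by simp
          qed simp
          let ?V = "\<Union>k\<in>K. dyadic n k"
          have "A N \<inter> U \<subseteq> ?V"
          proof
            fix y assume y: "y \<in> A N \<inter> U"
            then obtain k where "k < 2 ^ n" "y \<in> dyadic n k" using ex_dyadic[of y n] by (auto simp: A_def)
            then show "y \<in> ?V" using y by (auto simp: K_def)
          qed
          moreover have "?V \<in> sets \<nu>" using fK by (intro sets.finite_UN) auto
          moreover have "emeasure \<nu> ?V \<le> ennreal C * diam_pow s U"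
          proof -
            have "measure \<nu> ?V = (\<Sum>k\<in>K. mass n k)" using fK by (rule measure_UN_dyadic)
            also have "\<dots> \<le> (\<Sum>k\<in>K. 2 powr (- (real n * d)))"
              using mass_le n(3) by (intro sum_mono) (auto simp: K_def)
            also have "\<dots> = real (card K) * 2 powr (- (real n * d))" by simp
            also have "\<dots> \<le> 2 * 2 powr (- (real n * d))" using cK by (intro mult_right_mono) auto
            also have "\<dots> \<le> 2 * 2 powr (- (real n * s))" using sd by (intro mult_left_mono powr_mono) (auto intro: mult_left_mono)
            also have "\<dots> = C * (2 powr (- (real n + 1))) powr s"
              by (simp add: C_def powr_powr powr_add[symmetric] algebra_simps)
            also have "\<dots> \<le> C * r powr s" using r2 s C0 by (intro mult_left_mono powr_mono2) auto
            finally have "emeasure \<nu> ?V \<le> ennreal (C * r powr s)" by (simp add: emeasure_eq_measure ennreal_leI)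
            also have "\<dots> = ennreal C * ennreal (r powr s)" using C0 by (intro ennreal_mult) auto
            also have "ennreal (r powr s) = diam_pow s U"
              using x r by (auto simp: diam_pow_def r_def)
            finally show ?thesis .
          qed
          ultimately show ?thesis by blast
        qed
      qed
      have "emeasure \<nu> (A N) / ennreal C \<le> hausdorff_premeasure s (1 / 2 ^ N) E"
        unfolding hausdorff_premeasure_def
      proof (rule INF_greatest)
        fix U :: "nat \<Rightarrow> real set"
        assume U: "U \<in> {U. (\<forall>i. bounded (U i) \<and> diameter (U i) \<le> 1 / 2 ^ N) \<and> E \<subseteq> (\<Union>i. U i)}"
        then have "\<forall>i. \<exists>V. V \<in> sets \<nu> \<and> A N \<inter> U i \<subseteq> V \<and> emeasure \<nu> V \<le> ennreal C * diam_pow s (U i)"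
          using V by blast
        then obtain V where V: "\<And>i. V i \<in> sets \<nu>" "\<And>i. A N \<inter> U i \<subseteq> V i" "\<And>i. emeasure \<nu> (V i) \<le> ennreal C * diam_pow s (U i)"
          by metis
        have "A N \<subseteq> (\<Union>i. V i)"
        proof
          fix y assume y: "y \<in> A N"
          then have "y \<in> E" by (simp add: A_def)
          then obtain i where "y \<in> U i" using U by blast
          then show "y \<in> (\<Union>i. V i)" using y V(2)[of i] by blast
        qed
        then have "emeasure \<nu> (A N) \<le> emeasure \<nu> (\<Union>i. V i)" using V(1) by (intro emeasure_mono) auto
        also have "\<dots> \<le> (\<Sum>i. emeasure \<nu> (V i))" using V(1) by (intro emeasure_subadditive_countably) auto
        also have "\<dots> \<le> (\<Sum>i. ennreal C * diam_pow s (U i))" using V(3) by (intro suminf_le) auto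
        also have "\<dots> = ennreal C * (\<Sum>i. diam_pow s (U i))" by simp
        finally show "emeasure \<nu> (A N) / ennreal C \<le> (\<Sum>i. diam_pow s (U i))"
          using C0 by (subst divide_le_posI_ennreal) (auto simp: mult.commute)
      qed
      also have "\<dots> \<le> hausdorff_measure s E" by (rule hausdorff_premeasure_le_measure) simp
      finally have "emeasure \<nu> (A N) / ennreal C = 0" using s by simp
      then show False using N by (auto simp: ennreal_divide_eq_0_iff)
    qed
  qed
qed

lemma lower_dim_le_dim_H: "lower_dim_H_measure \<nu> \<le> dim_H_measure \<nu>"
  unfolding lower_dim_H_measure_def dim_H_measure_def
proof (rule Inf_superset_mono, safe)
  fix A assume A: "A \<in> sets borel" "emeasure \<nu> (- A) = 0"
  have "emeasure \<nu> A > 0"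
  proof (rule ccontr)
    assume "\<not> ?thesis"
    then have "emeasure \<nu> A = 0" by (simp add: zero_less_iff_neq_zero)
    then have "emeasure \<nu> (A \<union> - A) \<le> 0 + 0" using emeasure_subadditive[of A \<nu> "- A"] A by simp
    then have "emeasure \<nu> UNIV = 0" by (simp add: Un_absorb)
    then show False using total_pos by (simp add: total_def measure_def)
  qed
  then show "\<exists>E. hausdorff_dim A = hausdorff_dim E \<and> E \<in> sets borel \<and> 0 < emeasure \<nu> E" using A by blast
qed

lemma dim_H_le_dim_P: "dim_H_measure \<nu> \<le> dim_P_measure \<nu>"
  unfolding dim_P_measure_def
proof (rule Inf_greatest, safe)
  fix A assume A: "A \<in> sets borel" "emeasure \<nu> (- A) = 0"
  have "dim_H_measure \<nu> \<le> hausdorff_dim A" unfolding dim_H_measure_def using A by (intro Inf_lower) auto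
  also have "\<dots> \<le> packing_dim A" by (rule hausdorff_dim_le_packing_dim)
  finally show "dim_H_measure \<nu> \<le> packing_dim A" .
qed

end

section \<open>Packing dimension and the derivative at one\<close>

context unit_interval_measure
begin

text \<open>Balls are sorted by the level n with r <= 2^(-n) < 2r. Disjoint balls of one level have
  centres more than 2^(-n) apart, hence in different cells, so there are at most
  \<open>card (pos_idx n)\<close> of them. The rest is a geometric series with ratio
  \<open>2 powr (d - s)\<close> starting at \<open>m\<close>.\<close>

lemma packing_sum_le:
  assumes F: "finite F" "F \<in> packings (1 / 2 ^ m) (supp \<nu>)" and s: "d < s" "0 < s"
    and card: "\<And>n. n \<ge> m \<Longrightarrow> real (card (pos_idx n)) \<le> 2 powr (real n * d)"
  shows "(\<Sum>(x, r)\<in>F. diam_pow s (cball x r)) \<le> ennreal (2 powr s / (1 - 2 powr (d - s)) * (2 powr (d - s)) ^ m)"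
proof -
  define c where "c = 2 powr (d - s)"
  have c: "0 < c" "c < 1" using s powr_less_mono[of "d - s" 0 2] by (auto simp: c_def)
  define lev where "lev p = nat \<lfloor>- log 2 (snd p)\<rfloor>" for p :: "real \<times> real"
  have Fp: "fst p \<in> supp \<nu>" "0 < snd p" "snd p \<le> 1 / 2 ^ m" if "p \<in> F" for p
    using F(2) that by (auto simp: packings_def case_prod_unfold)
  have lev: "lev p \<ge> m" "snd p \<le> 1 / 2 ^ lev p" "1 / 2 ^ lev p < 2 * snd p" if p: "p \<in> F" for p
  proof -
    have pos: "0 < snd p" using Fp[OF p] by simp
    have "log 2 (snd p) \<le> log 2 (1 / 2 ^ m)" using Fp[OF p] by (subst log_le_cancel_iff) auto
    also have "\<dots> = - real m" by (simp add: log_divide log_nat_power)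
    finally have m: "real m \<le> - log 2 (snd p)" by simp
    then have n: "real (lev p) \<le> - log 2 (snd p)" "- log 2 (snd p) < real (lev p) + 1" "m \<le> lev p"
      unfolding lev_def by linarith+
    show "m \<le> lev p" by fact
    have e: "2 powr (log 2 (snd p)) = snd p" "2 powr (- real (lev p)) = 1 / 2 ^ lev p"
      using pos by (auto simp: powr_minus powr_realpow inverse_eq_divide)
    have "2 powr (log 2 (snd p)) \<le> 2 powr (- real (lev p))" using n by (intro powr_mono) auto
    then show "snd p \<le> 1 / 2 ^ lev p" unfolding e .
    have "2 powr (- real (lev p)) < 2 powr (1 + log 2 (snd p))" using n by (intro powr_less_mono) auto
    also have "\<dots> = 2 * 2 powr (log 2 (snd p))" by (simp add: powr_add)
    finally show "1 / 2 ^ lev p < 2 * snd p" unfolding e .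
  qed
  have far: "snd p + snd q < \<bar>fst p - fst q\<bar>" if pq: "p \<in> F" "q \<in> F" "p \<noteq> q" for p q
  proof -
    have dis: "cball (fst p) (snd p) \<inter> cball (fst q) (snd q) = {}"
      using F(2) pq unfolding packings_def disjoint_family_on_def by (force simp: case_prod_unfold)
    \<comment> \<open>On the line, closed balls whose centres are no farther apart than the sum of
      the radii meet: \<open>min (x + r) y\<close> lies in both.\<close>
    have *: False if "cball x r \<inter> cball y r' = {}" "x \<le> y" "y - x \<le> r + r'" "0 < r" "0 < r'" for x y r r' :: real
    proof -
      have "min (x + r) y \<in> cball x r" "min (x + r) y \<in> cball y r'"
        using that by (auto simp: dist_real_def min_def)
      then show False using that(1) by blast
    qed
    show ?thesis
    proof (rule ccontr)
      assume "\<not> ?thesis"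
      then show False
        using *[OF dis] *[of "fst q" "snd q" "fst p" "snd p"] dis Fp[OF pq(1)] Fp[OF pq(2)]
        by (cases "fst p \<le> fst q") (auto simp: Int_commute)
    qed
  qed
  have cnt: "card {p \<in> F. lev p = n} \<le> card (pos_idx n)" for n
  proof -
    have "\<forall>p\<in>F. \<exists>k. k \<in> pos_idx n \<and> fst p \<in> cell n k" using Fp(1) supp_subset_cells[of n] by blast
    from bchoice[OF this] obtain k where k: "\<And>p. p \<in> F \<Longrightarrow> k p \<in> pos_idx n \<and> fst p \<in> cell n (k p)" by blast
    have "inj_on k {p \<in> F. lev p = n}"
    proof (rule inj_onI)
      fix p q assume p: "p \<in> {p \<in> F. lev p = n}" and q: "q \<in> {p \<in> F. lev p = n}" and eq: "k p = k q"
      show "p = q"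
      proof (rule ccontr)
        assume "p \<noteq> q"
        then have f: "snd p + snd q < \<bar>fst p - fst q\<bar>" using far p q by blast
        have "fst p \<in> cell n (k p)" "fst q \<in> cell n (k p)" using k[of p] k[of q] p q eq by auto
        moreover have "bounded (cell n (k p))" by (simp add: cell_def)
        ultimately have "dist (fst p) (fst q) \<le> diameter (cell n (k p))" by (intro diameter_bounded_bound)
        then have "\<bar>fst p - fst q\<bar> \<le> 1 / 2 ^ n" by (simp add: diameter_cell dist_real_def)
        moreover have "1 / 2 ^ n < 2 * snd p" "1 / 2 ^ n < 2 * snd q" using lev(3)[of p] lev(3)[of q] p q by auto
        ultimately show False using f by linarith
      qed
    qed
    then show ?thesis using k F(1) by (intro card_inj_on_le[of k]) auto
  qed
  have "(\<Sum>(x, r)\<in>F. diam_pow s (cball x r)) \<le> (\<Sum>p\<in>F. ennreal (2 powr s * (1 / 2 ^ lev p) powr s))"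
  proof (rule sum_mono)
    fix p assume p: "p \<in> F"
    have "(2 * snd p) powr s \<le> (2 * (1 / 2 ^ lev p)) powr s"
      using lev(2)[OF p] Fp[OF p] s by (intro powr_mono2) auto
    also have "\<dots> = 2 powr s * (1 / 2 ^ lev p) powr s" by (rule powr_mult)
    finally show "(case p of (x, r) \<Rightarrow> diam_pow s (cball x r)) \<le> ennreal (2 powr s * (1 / 2 ^ lev p) powr s)"
      using Fp[OF p] s by (auto simp: case_prod_unfold diam_pow_def intro!: ennreal_leI)
  qed
  also have "\<dots> = ennreal (\<Sum>p\<in>F. 2 powr s * (1 / 2 ^ lev p) powr s)" by (rule sum_ennreal) auto
  also have "\<dots> \<le> ennreal (2 powr s / (1 - c) * c ^ m)"
  proof (rule ennreal_leI)
    have "(\<Sum>p\<in>F. 2 powr s * (1 / 2 ^ lev p) powr s) = (\<Sum>n\<in>lev ` F. \<Sum>p\<in>{p \<in> F. lev p = n}. 2 powr s * (1 / 2 ^ lev p) powr s)"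
      using F(1) by (rule sum.image_gen)
    also have "\<dots> = (\<Sum>n\<in>lev ` F. real (card {p \<in> F. lev p = n}) * (2 powr s * (1 / 2 ^ n) powr s))"
      by (intro sum.cong refl) simp
    also have "\<dots> \<le> (\<Sum>n\<in>lev ` F. 2 powr s * c ^ n)"
    proof (rule sum_mono)
      fix n assume "n \<in> lev ` F"
      then have n: "n \<ge> m" using lev(1) by auto
      have "real (card {p \<in> F. lev p = n}) \<le> 2 powr (real n * d)" using cnt[of n] card[OF n] by linarith
      then have "real (card {p \<in> F. lev p = n}) * (2 powr s * (1 / 2 ^ n) powr s) \<le> 2 powr (real n * d) * (2 powr s * (1 / 2 ^ n) powr s)"
        by (rule mult_right_mono) simp
      also have e: "(1 / 2 ^ n) powr s = 2 powr (- (real n * s))"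
        by (simp add: powr_divide powr_minus_divide powr_realpow[symmetric] powr_powr)
      also have "2 powr (real n * d) * (2 powr s * 2 powr (- (real n * s))) = 2 powr s * c ^ n"
      proof -
        have "c ^ n = 2 powr (real n * (d - s))" by (simp add: c_def powr_powr powr_realpow[symmetric] mult.commute)
        also have "\<dots> = 2 powr (real n * d) * 2 powr (- (real n * s))" by (simp add: powr_add[symmetric] right_diff_distrib)
        finally show ?thesis by simp
      qed
      finally show "real (card {p \<in> F. lev p = n}) * (2 powr s * (1 / 2 ^ n) powr s) \<le> 2 powr s * c ^ n"
        unfolding e .
    qed
    also have "\<dots> = 2 powr s * (\<Sum>n\<in>lev ` F. c ^ n)" by (simp add: sum_distrib_left)
    also have "(\<Sum>n\<in>lev ` F. c ^ n) \<le> c ^ m / (1 - c)"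
    proof -
      have "(\<Sum>n\<in>lev ` F. c ^ n) = (\<Sum>n\<in>lev ` F. c ^ m * c ^ (n - m))"
        using lev(1) by (intro sum.cong refl) (auto simp: power_add[symmetric])
      also have "\<dots> = c ^ m * (\<Sum>n\<in>lev ` F. c ^ (n - m))" by (simp add: sum_distrib_left)
      also have "(\<Sum>n\<in>lev ` F. c ^ (n - m)) = (\<Sum>i\<in>(\<lambda>n. n - m) ` lev ` F. c ^ i)"
        using lev(1) by (subst sum.reindex) (auto simp: inj_on_def eq_diff_iff)
      also have "c ^ m * (\<Sum>i\<in>(\<lambda>n. n - m) ` lev ` F. c ^ i) \<le> c ^ m * (\<Sum>i. c ^ i)"
        using c F(1) by (intro mult_left_mono sum_le_suminf summable_geometric) auto
      also have "(\<Sum>i. c ^ i) = 1 / (1 - c)" using c by (intro suminf_geometric) auto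
      finally show ?thesis by simp
    qed
    finally show "(\<Sum>p\<in>F. 2 powr s * (1 / 2 ^ lev p) powr s) \<le> 2 powr s / (1 - c) * c ^ m"
      by (simp add: mult_left_mono)
  qed
  finally show ?thesis by (simp add: c_def)
qed

text \<open>For s above \<open>bet 0\<close> the premeasure of the whole support already vanishes,
  so the constant sequence is a sufficient cover. The exponent \<open>d\<close> lies between
  \<open>bet 0\<close> and \<open>s\<close>: above the former to bound the number of cells, below
  the latter for the geometric series.\<close>

lemma packing_dim_supp_le: "packing_dim (supp \<nu>) \<le> ereal (bet 0)"
proof (rule ereal_le_epsilon2)
  fix e :: real assume e: "e > 0"
  define d where "d = bet 0 + e / 2"
  define s where "s = bet 0 + e"
  define c where "c = 2 powr (d - s)"
  have b0: "bet 0 \<ge> 0" by (rule bet_nonneg) auto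
  have s: "d < s" "0 < s" using e b0 by (auto simp: d_def s_def)
  have c: "0 < c" "c < 1" using s powr_less_mono[of "d - s" 0 2] by (auto simp: c_def)
  have "eventually (\<lambda>n. beta_n \<nu> n 0 < d) sequentially" using e by (intro bet_less) (auto simp: d_def)
  then obtain n0 where n0: "\<And>n. n \<ge> n0 \<Longrightarrow> beta_n \<nu> n 0 < d" by (auto simp: eventually_sequentially)
  have card: "real (card (pos_idx n)) \<le> 2 powr (real n * d)" if "n \<ge> max n0 1" for n
  proof -
    have "real (card (pos_idx n)) = psum n 0" by (simp add: psum_def pos_idx_def)
    also have "\<dots> = 2 powr (real n * beta_n \<nu> n 0)" using that by (intro psum_beta_n) simp
    also have "\<dots> \<le> 2 powr (real n * d)" using n0[of n] that by (intro powr_mono mult_left_mono) auto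
    finally show ?thesis .
  qed
  have P: "packing_premeasure s (supp \<nu>) \<le> ennreal (2 powr s / (1 - c) * c ^ m)" if m: "m \<ge> max n0 1" for m
  proof -
    have "packing_premeasure s (supp \<nu>) \<le> (SUP F\<in>packings (1 / 2 ^ m) (supp \<nu>). \<Sum>\<^sub>\<infinity>(x, r)\<in>F. diam_pow s (cball x r))"
      unfolding packing_premeasure_def by (intro INF_lower) auto
    also have "\<dots> \<le> ennreal (2 powr s / (1 - c) * c ^ m)"
    proof (rule SUP_least)
      fix F assume F: "F \<in> packings (1 / 2 ^ m) (supp \<nu>)"
      show "(\<Sum>\<^sub>\<infinity>(x, r)\<in>F. diam_pow s (cball x r)) \<le> ennreal (2 powr s / (1 - c) * c ^ m)"
      proof (rule infsum_le_finite_sums)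
        show "(\<lambda>(x, r). diam_pow s (cball x r)) summable_on F" by (rule nonneg_summable_on_complete) simp
        fix G assume G: "finite G" "G \<subseteq> F"
        then have "G \<in> packings (1 / 2 ^ m) (supp \<nu>)"
          using F unfolding packings_def disjoint_family_on_def by blast
        from packing_sum_le[OF G(1) this s card] m
        show "(\<Sum>(x, r)\<in>G. diam_pow s (cball x r)) \<le> ennreal (2 powr s / (1 - c) * c ^ m)"
          by (simp add: c_def)
      qed
    qed
    finally show ?thesis .
  qed
  have "packing_premeasure s (supp \<nu>) \<le> ennreal 0"
  proof (rule tendsto_lowerbound)
    show "(\<lambda>m. ennreal (2 powr s / (1 - c) * c ^ m)) \<longlonglongrightarrow> ennreal 0"
      using c by (intro tendsto_ennrealI tendsto_mult_right_zero LIMSEQ_power_zero) auto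
    show "\<forall>\<^sub>F m in sequentially. packing_premeasure s (supp \<nu>) \<le> ennreal (2 powr s / (1 - c) * c ^ m)"
      using eventually_ge_at_top[of "max n0 1"] by eventually_elim (rule P)
  qed simp
  then have z: "packing_premeasure s (supp \<nu>) = 0" by simp
  have "packing_measure s (supp \<nu>) \<le> (\<Sum>i::nat. packing_premeasure s (supp \<nu>))"
    unfolding packing_measure_def by (rule INF_lower2[of "\<lambda>_. supp \<nu>"]) auto
  then have "packing_measure s (supp \<nu>) = 0" using z by simp
  then show "packing_dim (supp \<nu>) \<le> ereal (bet 0) + ereal e"
    unfolding packing_dim_def using s by (intro Inf_lower) (auto simp: s_def)
qed

lemma dim_P_le: "dim_P_measure \<nu> \<le> ereal (bet 0)"
proof -
  have "dim_P_measure \<nu> \<le> packing_dim (supp \<nu>)"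
    unfolding dim_P_measure_def using closed_supp null_compl_supp by (intro Inf_lower) auto
  then show ?thesis using packing_dim_supp_le by (rule order_trans)
qed

text \<open>Differentiability makes the right derivative at 1 equal to the left one, which is
  \<open>- delta\<close>. For \<open>0 < d < delta\<close> some \<open>t > 1\<close> therefore
  satisfies \<open>bet t < - d * (t - 1)\<close>, the condition under which heavy intervals are
  negligible.\<close>

lemma delta_le_lower_dim_H:
  assumes "ereal_differentiable_at (beta \<nu>) 1"
  shows "ereal delta \<le> lower_dim_H_measure \<nu>"
proof -
  have "bet differentiable (at 1)" using assms by (simp add: ereal_differentiable_at_def bet_def[abs_def])
  then obtain D where "(bet has_real_derivative D) (at 1)" by (auto simp: real_differentiable_def)
  then have lim: "((\<lambda>t. (bet t - bet 1) / (t - 1)) \<longlongrightarrow> D) (at 1)" by (simp add: has_field_derivative_iff)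
  then have "((\<lambda>t. (bet t - bet 1) / (t - 1)) \<longlongrightarrow> D) (at_left 1)" by (simp add: filterlim_at_split)
  moreover have "(\<lambda>t. (bet t - bet 1) / (t - 1)) = (\<lambda>t. - slope t)"
  proof
    fix t :: real
    have "t - 1 = - (1 - t)" by simp
    then show "(bet t - bet 1) / (t - 1) = - slope t" by (simp only: bet_1 slope_def divide_minus_right diff_0_right)
  qed
  moreover have "((\<lambda>t. - slope t) \<longlongrightarrow> - delta) (at_left 1)" by (intro tendsto_minus slope_tendsto)
  ultimately have D: "D = - delta" by (intro tendsto_unique[of "at_left (1::real)"]) auto
  show ?thesis
  proof (cases "delta = 0")
    case True
    have "0 \<le> lower_dim_H_measure \<nu>"
      unfolding lower_dim_H_measure_def using hausdorff_dim_nonneg by (intro Inf_greatest) auto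
    then show ?thesis using True by (simp add: zero_ereal_def)
  next
    case False
    then have d0: "delta > 0" using delta_nonneg by simp
    have main: "ereal d \<le> lower_dim_H_measure \<nu>" if d: "0 < d" "d < delta" for d
    proof -
      have "((\<lambda>t. (bet t - bet 1) / (t - 1)) \<longlongrightarrow> D) (at_right 1)" using lim by (simp add: filterlim_at_split)
      then have "eventually (\<lambda>t. (bet t - bet 1) / (t - 1) < - d) (at_right 1)"
        using d D by (intro order_tendstoD(2)) auto
      moreover have "eventually (\<lambda>t. t > 1) (at_right (1::real))" by (rule eventually_at_right_less)
      ultimately have "eventually (\<lambda>t. t > 1 \<and> (bet t - bet 1) / (t - 1) < - d) (at_right 1)"
        by eventually_elim auto
      then obtain t where t: "t > 1" "(bet t - bet 1) / (t - 1) < - d"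
        using eventually_happens[of _ "at_right (1::real)"] by (auto simp: trivial_limit_at_right_real)
      then have "bet t < - d * (t - 1)" by (simp add: bet_1 pos_divide_less_eq)
      from lower_dim_H_ge[OF t(1) this d(1)] show ?thesis .
    qed
    show ?thesis
    proof (rule ereal_le_epsilon2)
      fix e :: real assume e: "e > 0"
      define d where "d = max (delta / 2) (delta - e)"
      have "ereal d \<le> lower_dim_H_measure \<nu>" using d0 e by (intro main) (auto simp: d_def less_max_iff_disj)
      moreover have "delta - e \<le> d" by (simp add: d_def)
      ultimately have "ereal (delta - e) \<le> lower_dim_H_measure \<nu>" by (meson ereal_less_eq(3) order_trans)
      then show "ereal delta \<le> lower_dim_H_measure \<nu> + ereal e"
        by (cases "lower_dim_H_measure \<nu>") auto
    qed
  qed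
qed

end

theorem corollary1p9:
  fixes \<nu> :: "real measure"
  assumes "sets \<nu> = sets borel"
    and "finite_measure \<nu>"
    and "emeasure \<nu> (- {0<..<1}) = 0"
    and "emeasure \<nu> {0<..<1} \<noteq> 0"
    and "Lq_regular \<nu>"
  shows "\<exists>s::real. s_lower \<nu> = ereal s \<and> s_upper \<nu> = ereal s \<and>
    (delta_upper \<nu> = dim_M_measure \<nu> \<longleftrightarrow> ereal s = dim_M_measure \<nu> / (1 + dim_M_measure \<nu>)) \<and>
    (dim_M_measure \<nu> = dim_H_measure \<nu> \<longrightarrow> ereal s = dim_M_measure \<nu> / (1 + dim_M_measure \<nu>)) \<and>
    (ereal_differentiable_at (beta \<nu>) 1 \<and> ereal s = dim_M_measure \<nu> / (1 + dim_M_measure \<nu>) \<longrightarrow>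
       dim_M_measure \<nu> = dim_H_measure \<nu> \<and> dim_H_measure \<nu> = lower_dim_H_measure \<nu> \<and>
       lower_dim_H_measure \<nu> = dim_P_measure \<nu>)"
proof -
  interpret unit_interval_measure \<nu>
    using assms(1-4) by (intro unit_interval_measure.intro unit_interval_measure_axioms.intro)
  have b0: "bet 0 \<ge> 0" by (rule bet_nonneg) auto
  have quot: "dim_M_measure \<nu> / (1 + dim_M_measure \<nu>) = ereal (bet 0 / (1 + bet 0))"
    using b0 by (simp add: dim_M_eq one_ereal_def)
  have iff: "delta_upper \<nu> = dim_M_measure \<nu> \<longleftrightarrow> ereal q0 = dim_M_measure \<nu> / (1 + dim_M_measure \<nu>)"
    unfolding quot unfolding delta_upper_eq dim_M_eq using delta_eq_iff by simp
  have two: "ereal q0 = dim_M_measure \<nu> / (1 + dim_M_measure \<nu>)" if "dim_M_measure \<nu> = dim_H_measure \<nu>"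
  proof -
    \<comment> \<open>The Hausdorff dimension of the measure is at most \<open>delta\<close>, and
      \<open>delta\<close> is at most \<open>bet 0\<close>; equal dimensions leave no room in
      between.\<close>
    have "ereal (bet 0) \<le> ereal delta" using that dim_H_le_delta dim_M_eq by simp
    then have "delta_upper \<nu> = dim_M_measure \<nu>" using delta_le_bet_0 by (simp add: delta_upper_eq dim_M_eq)
    then show ?thesis using iff by simp
  qed
  have three: "dim_M_measure \<nu> = dim_H_measure \<nu> \<and> dim_H_measure \<nu> = lower_dim_H_measure \<nu> \<and>
       lower_dim_H_measure \<nu> = dim_P_measure \<nu>"
    if "ereal_differentiable_at (beta \<nu>) 1" "ereal q0 = dim_M_measure \<nu> / (1 + dim_M_measure \<nu>)"
  proof -
    have "delta = bet 0" using that(2) iff by (simp add: delta_upper_eq dim_M_eq)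
    then have "ereal (bet 0) \<le> lower_dim_H_measure \<nu>" using delta_le_lower_dim_H[OF that(1)] by simp
    \<comment> \<open>Lower Hausdorff, Hausdorff and packing dimension form an increasing chain,
      enclosed by \<open>bet 0\<close> on both sides.\<close>
    then show ?thesis
      using lower_dim_le_dim_H dim_H_le_dim_P dim_P_le unfolding dim_M_eq by (meson antisym order_trans)
  qed
  show ?thesis
    using spectral_dim_eq[OF assms(5)] iff two three by blast
qed

end
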